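(* Let $l$ be odd, $R=\mathbb F_2[x]/(x^l+1)$, let $A\in R^{m_A\times n_A}$, $B\in R^{m_B\times n_B}$, and let $\mathcal M$ be the chain complex over $R$ of the lifted-product code $\mathrm{LP}_l(A,B)$. With the matrices $G_C,E_C,G_{C^*},E_{C^*}$ ($C\in\{A,B\}$) constructed in the context (using the same exponents $m^{(i)}_k$ and dual elements $h^{(i)}_{m}$ for $A$ and $B$), the $Z$-type logical operators, corresponding to $H_1(\mathcal M)$, have supports generated by $$L_Z^M=\big(G_A\otimes_R E_B\big)\oplus\big(E_A\otimes_R G_B\big),$$ and the $X$-type logical operators, corresponding to $H^1(\mathcal M)$, have supports generated by $$L_X^M=\big(E_{A^*}\otimes_R G_{B^*}\big)\oplus\big(G_{A^*}\otimes_R E_{B^*}\big).$$ Explicitly, for each $i\in\{1,\dots,t\}$ and $m\in\{m^{(i)}_0,\dots,m^{(i)}_{d_i-1}\}$, the nonzero rows are: in the left sector $\mathcal A_1\otimes_R\mathcal B_0$, for $p\in I_A^{(i)}$, $q\in I^{(i)}_{B^*}$, $$\mathrm{supp}\,\bar Z^{(L,i)}_{p,q,m}=c_{b^{(i)}}h^{(i)}_m\,\zeta^{(i,p)}_{\mathcal A_1}\otimes_R e^{(q)}_{\mathcal B_0},\qquad \mathrm{supp}\,\bar X^{(L,i)}_{p,q,m}=\overline{c_{b^{(i)}}}\,x^m e^{(p)}_{\mathcal A_1}\otimes_R\bar\xi^{(i,q)}_{\mathcal B_0},$$ and in the right sector $\mathcal A_0\otimes_R\mathcal B_1$, for $p\in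 I^{(i)}_{A^*}$, $q\in I^{(i)}_B$, $$\mathrm{supp}\,\bar Z^{(R,i)}_{p,q,m}=h^{(i)}_m c_{b^{(i)}}\,e^{(p)}_{\mathcal A_0}\otimes_R\zeta^{(i,q)}_{\mathcal B_1},\qquad \mathrm{supp}\,\bar X^{(R,i)}_{p,q,m}=x^m\,\overline{c_{b^{(i)}}}\,\bar\xi^{(i,p)}_{\mathcal A_0}\otimes_R e^{(q)}_{\mathcal B_1}.$$ Then the (classes of the) $\mathrm{supp}\,\bar Z^{(s,i)}_{p,q,m}$ and the $\mathrm{supp}\,\bar X^{(s,i)}_{p,q,m}$, $s\in\{L,R\}$, form $\mathbb F_2$-bases of $H_1(\mathcal M)$ and $H^1(\mathcal M)$ respectively, and they are conjugate: $$\big\langle \mathrm{supp}\,\bar Z^{(s,i)}_{p,q,m},\ \mathrm{supp}\,\bar X^{(s',i')}_{p',q',m'}\big\rangle_R=\delta_{ss'}\,\delta_{ii'}\,\delta_{pp'}\,\delta_{qq'}\,\delta_{mm'} .$$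
   Context: Conjugation: for $f\in R$, $\bar f(x)=f(x^{-1})$ with $x^{-1}=x^{l-1}$, applied entrywise; for a matrix $C$, $C^*=\bar C^{T}$. Pairing: $\langle u,v\rangle_R=\sum_k [x^0](u_k\bar v_k)\in\mathbb F_2$, where $[x^0]$ is the constant coefficient. Lifted-product code: put $\mathcal A_1=R^{n_A}$, $\mathcal A_0=R^{m_A}$, $\mathcal B_1=R^{n_B}$, $\mathcal B_0=R^{m_B}$. $\mathcal M$ is $\mathcal M_2\xrightarrow{\partial_2}\mathcal M_1\xrightarrow{\partial_1}\mathcal M_0$ with $\mathcal M_2=\mathcal A_1\otimes_R\mathcal B_1$, $\mathcal M_1=(\mathcal A_1\otimes_R\mathcal B_0)\oplus(\mathcal A_0\otimes_R\mathcal B_1)$, $\mathcal M_0=\mathcal A_0\otimes_R\mathcal B_0$, $\partial_1=(A\otimes I,\ I\otimes B)$ and $\partial_2=\binom{I\otimes B}{A\otimes I}$. $H_1(\mathcal M)=\ker\partial_1/\mathrm{im}\,\partial_2$, $H^1(\mathcal M)=\ker\partial_2^*/\mathrm{im}\,\partial_1^*$. Binarizing (replacing ring elements by coefficient vectors) gives the qubit CSS code. Field components: $x^l+1=\prod_{i=1}^t b^{(i)}$ with distinct irreducible $b^{(i)}\in\mathbb F_2[x]$, $d_i=\deg b^{(i)}$, $q_i=2^{d_i}$, $\beta_i$ a root of $b^{(i)}$, $R_{(i)}=\mathbb F_2[x]/(b^{(i)})\cong\mathbb F_{q_i}$. $c_{b^{(i)}}\in R$ is the central idempotent with $c_{b^{(i)}}\equiv1\bmod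 b^{(i)}$ and $\equiv0\bmod b^{(j)}$, $j\ne i$. $\mathrm{ev}_{\beta_i}:c_{b^{(i)}}R\to\mathbb F_{q_i}$, $h\mapsto h(\beta_i)$, is a ring isomorphism, applied entrywise; $C_{(i)}=C(\beta_i)$ for a matrix $C$. Construction for $C\in\{A,B\}$, $C\in R^{m_C\times n_C}$, $\mathcal C_1=R^{n_C}$, $\mathcal C_0=R^{m_C}$. An information set of a linear code of dimension $k$ is a set of $k$ coordinates on which restriction is injective; the systematic generator matrix with respect to it restricts to the identity there. For each $i$: let $I_C^{(i)}\subseteq[n_C]$ be an information set of $\ker C_{(i)}$, with systematic basis rows $g^{(i,j)}_{\mathcal C_1}$, $j\in I_C^{(i)}$, and put $\zeta^{(i,j)}_{\mathcal C_1}=\mathrm{ev}_{\beta_i}^{-1}(g^{(i,j)}_{\mathcal C_1})$; let $I_{C^*}^{(i)}\subseteq[m_C]$ be an information set of $\ker C_{(i)}^T$, with systematic basis rows $g^{(i,j)}_{\mathcal C_0}$, $j\in I_{C^*}^{(i)}$, and put $\bar\xi^{(i,j)}_{\mathcal C_0}=\overline{\mathrm{ev}_{\beta_i}^{-1}(g^{(i,j)}_{\mathcal C_0})}$. $e^{(j)}_{\mathcal C_1},e^{(j)}_{\mathcal C_0}$ are standard unit vectors. Choose distinct $m^{(i)}_0,\dots,m^{(i)}_{d_i-1}\in\{0,\dots,l-1\}$ such that $\{\beta_i^{-m_k^{(i)}}\}_k$ is an $\mathbb F_2$-basis of $\mathbb F_{q_i}$ (e.g. $m^{(i)}_k=k$),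 and $h^{(i)}_{m_k^{(i)}}\in R$ with $[x^{m^{(i)}_j}]\big(c_{b^{(i)}}h^{(i)}_{m^{(i)}_k}\big)=\delta_{jk}$ ($[x^m]f$ is the coefficient of $x^m$). Then: - $G_C$ has rows $\zeta^{(i,j)}_{\mathcal C_1}$ ($1\le i\le t$, $j\in I_C^{(i)}$); - $E_C$ has rows $h^{(i)}_{m}c_{b^{(i)}}e^{(j)}_{\mathcal C_0}$ ($j\in I_{C^*}^{(i)}$, $m\in\{m_k^{(i)}\}$); - $G_{C^*}$ has rows $x^{m}\,\overline{c_{b^{(i)}}}\,\bar\xi^{(i,j)}_{\mathcal C_0}$ ($j\in I_{C^*}^{(i)}$, $m\in\{m_k^{(i)}\}$); - $E_{C^*}$ has rows $\overline{c_{b^{(i)}}}\,e^{(j)}_{\mathcal C_1}$ ($j\in I_C^{(i)}$). "Supports generated by $L$" means the $\mathbb F_2$-span of the rows of $L$ represents the whole (co)homology group. *)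

theory Defs
  imports
    "HOL-Library.Z2"
    "HOL-Library.Cardinality"
    "HOL-Algebra.Algebraic_Closure_Type"
    "HOL-Number_Theory.Cong"
    "Jordan_Normal_Form.Matrix_Kernel"
begin

hide_const (open) Multiset.mult Polynomial.smult

section \<open>The ring of circulants\<close>

text \<open>The type \<open>'l cyc\<close> is the ring \<open>R\<close> of polynomials over the two-element field modulo
  \<open>x^l + 1\<close>, where \<open>l = CARD('l)\<close>; every \<open>l \<ge> 1\<close> is the cardinality of some finite type.\<close>

definition cyc_modulus :: "'l itself \<Rightarrow> bit poly" where
  "cyc_modulus _ = monom 1 CARD('l) + 1"

definition cyc_rel :: "'l itself \<Rightarrow> bit poly \<Rightarrow> bit poly \<Rightarrow> bool" where
  "cyc_rel T f g \<longleftrightarrow> cyc_modulus T dvd f - g"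

quotient_type 'l cyc = "bit poly" / "cyc_rel TYPE('l::finite)"
proof (rule equivpI)
  show "reflp (cyc_rel TYPE('l))"
    by (simp add: reflp_def cyc_rel_def)
  show "symp (cyc_rel TYPE('l))"
    by (simp only: symp_def cyc_rel_def) (metis dvd_minus_iff minus_diff_eq)
  show "transp (cyc_rel TYPE('l))"
    by (simp only: transp_def cyc_rel_def) (metis diff_add_cancel dvd_add add_diff_eq)
qed

lemma degree_cyc_modulus: "degree (cyc_modulus TYPE('l::finite)) = CARD('l)"
  unfolding cyc_modulus_def by (subst degree_add_eq_left) (simp_all add: degree_monom_eq)

lemma cyc_rel_iff_mod: "cyc_rel T f g \<longleftrightarrow> f mod cyc_modulus T = g mod cyc_modulus T"
  by (simp only: cyc_rel_def mod_eq_dvd_iff)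

instantiation cyc :: (finite) comm_ring_1
begin

lift_definition zero_cyc :: "'a cyc" is 0 .
lift_definition one_cyc :: "'a cyc" is 1 .
lift_definition plus_cyc :: "'a cyc \<Rightarrow> 'a cyc \<Rightarrow> 'a cyc" is "(+)"
  by (simp only: cyc_rel_iff_mod) (metis mod_add_cong)
lift_definition minus_cyc :: "'a cyc \<Rightarrow> 'a cyc \<Rightarrow> 'a cyc" is "(-)"
  by (simp only: cyc_rel_iff_mod) (metis mod_diff_cong)
lift_definition uminus_cyc :: "'a cyc \<Rightarrow> 'a cyc" is uminus
  by (simp only: cyc_rel_iff_mod) (metis mod_minus_cong)
lift_definition times_cyc :: "'a cyc \<Rightarrow> 'a cyc \<Rightarrow> 'a cyc" is "(*)"
  by (simp only: cyc_rel_iff_mod) (metis mod_mult_cong)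

instance
proof
  show "(0 :: 'a cyc) \<noteq> 1"
  proof transfer
    have "\<not> cyc_modulus TYPE('a) dvd 1"
      using dvd_imp_degree_le[of "cyc_modulus TYPE('a)" 1] degree_cyc_modulus[where 'l = 'a]
      by auto
    then show "\<not> cyc_rel TYPE('a) 0 1"
      by (simp add: cyc_rel_def)
  qed
qed (transfer; simp add: cyc_rel_def algebra_simps)+

end

lift_definition cyc_x :: "('l::finite) cyc" is "monom 1 1" .

lift_definition cyc_const :: "bit \<Rightarrow> ('l::finite) cyc" is "\<lambda>a. [:a:]" .

text \<open>The representative of degree less than \<open>l\<close>.\<close>

lift_definition cyc_rep :: "('l::finite) cyc \<Rightarrow> bit poly"
  is "\<lambda>f. f mod cyc_modulus TYPE('l)"
  by (simp add: cyc_rel_iff_mod)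

definition cyc_coeff :: "('l::finite) cyc \<Rightarrow> nat \<Rightarrow> bit" where
  "cyc_coeff f k = coeff (cyc_rep f) k"

lemma cyc_modulus_dvd_pcompose:
  "cyc_modulus TYPE('l::finite) dvd pcompose (cyc_modulus TYPE('l)) (monom 1 n)"
proof -
  let ?X = "monom 1 CARD('l) :: bit poly"
  have "cyc_modulus TYPE('l) = ?X - 1"
    by (simp add: cyc_modulus_def poly_eq_iff)
  moreover have "pcompose (monom 1 k) p = p ^ k" for k and p :: "bit poly"
    by (induction k) (simp_all add: monom_Suc pcompose_pCons pcompose_1)
  then have "pcompose ?X (monom 1 n) = ?X ^ n"
    by (simp add: monom_power mult.commute)
  moreover have "?X - 1 dvd ?X ^ n - 1"
    by (simp add: power_diff_1_eq)
  ultimately show ?thesis by (simp add: pcompose_diff pcompose_1)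
qed

text \<open>Conjugation: substitution of \<open>x^(l-1)\<close>, the inverse of \<open>x\<close> in \<open>R\<close>, for \<open>x\<close>.\<close>

lift_definition cyc_conj :: "('l::finite) cyc \<Rightarrow> 'l cyc"
  is "\<lambda>f. pcompose f (monom 1 (CARD('l) - 1))"
proof -
  fix f g :: "bit poly"
  let ?s = "monom 1 (CARD('l) - 1) :: bit poly"
  assume "cyc_rel TYPE('l) f g"
  then obtain k where "f - g = cyc_modulus TYPE('l) * k"
    by (auto simp: cyc_rel_def)
  then have "pcompose f ?s - pcompose g ?s = pcompose (cyc_modulus TYPE('l)) ?s * pcompose k ?s"
    by (metis pcompose_diff pcompose_mult)
  then show "cyc_rel TYPE('l) (pcompose f ?s) (pcompose g ?s)"
    using cyc_modulus_dvd_pcompose unfolding cyc_rel_def by (metis dvd_mult2)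
qed

definition conj_transpose :: "('l::finite) cyc mat \<Rightarrow> 'l cyc mat" where
  "conj_transpose C = transpose_mat (map_mat cyc_conj C)"

definition pairing :: "('l::finite) cyc vec \<Rightarrow> 'l cyc vec \<Rightarrow> bit" where
  "pairing u v = (\<Sum>k<dim_vec u. cyc_coeff (u $ k * cyc_conj (v $ k)) 0)"


section \<open>Quotients of complexes as vector spaces over the two-element field\<close>

text \<open>\<open>R^n\<close> with scalars restricted to the constants.\<close>

definition binary_module :: "nat \<Rightarrow> (bit, ('l::finite) cyc vec) module" where
  "binary_module n = \<lparr>
    carrier = carrier_vec n,
    mult = undefined,
    one = undefined,
    zero = 0\<^sub>v n,
    add = (+),
    smult = (\<lambda>a v. cyc_const a \<cdot>\<^sub>v v)\<rparr>"

definition quotient_module ::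
  "('a, 'v, 'm) module_scheme \<Rightarrow> 'v set \<Rightarrow> ('a, 'v set) module" where
  "quotient_module V N = \<lparr>
    carrier = a_rcosets\<^bsub>V\<^esub> N,
    mult = undefined,
    one = undefined,
    zero = N,
    add = set_add V,
    smult = (\<lambda>a S. \<Union>x\<in>S. N +>\<^bsub>V\<^esub> (a \<odot>\<^bsub>V\<^esub> x))\<rparr>"

definition boundaries :: "('l::finite) cyc mat \<Rightarrow> 'l cyc vec set" where
  "boundaries D = (\<lambda>w. D *\<^sub>v w) ` carrier_vec (dim_col D)"

text \<open>The homology \<open>ker D1 / im D2\<close> at the middle term of a two-step complex with maps
  \<open>D2\<close> followed by \<open>D1\<close>.\<close>

definition homology ::
  "('l::finite) cyc mat \<Rightarrow> 'l cyc mat \<Rightarrow> (bit, 'l cyc vec set) module" where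
  "homology D1 D2 =
    quotient_module (binary_module (dim_col D1)\<lparr>carrier := mat_kernel D1\<rparr>) (boundaries D2)"

definition homology_class ::
  "('l::finite) cyc mat \<Rightarrow> 'l cyc mat \<Rightarrow> 'l cyc vec \<Rightarrow> 'l cyc vec set" where
  "homology_class D1 D2 v = boundaries D2 +>\<^bsub>binary_module (dim_col D1)\<^esub> v"

definition generates_homology ::
  "('l::finite) cyc mat \<Rightarrow> 'l cyc mat \<Rightarrow> 'l cyc vec set \<Rightarrow> bool" where
  "generates_homology D1 D2 S \<longleftrightarrow>
    S \<subseteq> mat_kernel D1 \<and>
    homology_class D1 D2 ` module.span class_ring (binary_module (dim_col D1)) S
      = carrier (homology D1 D2)"

lemma quotient_module_module:
  assumes "module R M" and "Module.submodule N R M"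
  shows "module R (quotient_module M N)"
proof -
  interpret M: module R M by fact
  interpret N: Module.submodule N R M by fact
  interpret N: abelian_subgroup N M
    by (intro abelian_subgroupI3 additive_subgroup.intro N.subgroup_axioms M.abelian_group_axioms)
  let ?Q = "quotient_module M N"
  have carrier: "carrier ?Q = (\<lambda>x. N +>\<^bsub>M\<^esub> x) ` carrier M"
    by (auto simp: quotient_module_def A_RCOSETS_def')
  have add: "(N +>\<^bsub>M\<^esub> x) \<oplus>\<^bsub>?Q\<^esub> (N +>\<^bsub>M\<^esub> y) = N +>\<^bsub>M\<^esub> (x \<oplus>\<^bsub>M\<^esub> y)"
    if "x \<in> carrier M" "y \<in> carrier M" for x y
    using that by (simp add: quotient_module_def N.a_rcos_sum)
  have smult: "a \<odot>\<^bsub>?Q\<^esub> (N +>\<^bsub>M\<^esub> x) = N +>\<^bsub>M\<^esub> (a \<odot>\<^bsub>M\<^esub> x)"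
    if a: "a \<in> carrier R" and x: "x \<in> carrier M" for a x
  proof -
    have eq: "N +>\<^bsub>M\<^esub> (a \<odot>\<^bsub>M\<^esub> y) = N +>\<^bsub>M\<^esub> (a \<odot>\<^bsub>M\<^esub> x)" if "y \<in> N +>\<^bsub>M\<^esub> x" for y
    proof -
      obtain n where n: "n \<in> N" "y = n \<oplus>\<^bsub>M\<^esub> x"
        using \<open>y \<in> N +>\<^bsub>M\<^esub> x\<close> by (auto simp: a_r_coset_def')
      then have nM: "n \<in> carrier M" using N.a_subset by auto
      have "a \<odot>\<^bsub>M\<^esub> y = (a \<odot>\<^bsub>M\<^esub> n) \<oplus>\<^bsub>M\<^esub> (a \<odot>\<^bsub>M\<^esub> x)"
        using n nM a x by (simp add: M.smult_r_distr)
      moreover have "a \<odot>\<^bsub>M\<^esub> n \<in> N" using a n by simp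
      ultimately have "a \<odot>\<^bsub>M\<^esub> y \<in> N +>\<^bsub>M\<^esub> (a \<odot>\<^bsub>M\<^esub> x)"
        by (auto simp: a_r_coset_def')
      then show ?thesis
        using a x by (metis M.smult_closed N.a_repr_independence')
    qed
    have "x \<in> N +>\<^bsub>M\<^esub> x" using x by (rule N.a_rcos_self)
    then have "(\<Union>y\<in>N +>\<^bsub>M\<^esub> x. N +>\<^bsub>M\<^esub> (a \<odot>\<^bsub>M\<^esub> y)) = N +>\<^bsub>M\<^esub> (a \<odot>\<^bsub>M\<^esub> x)"
      using eq by blast
    then show ?thesis by (simp add: quotient_module_def)
  qed
  have zero: "\<zero>\<^bsub>?Q\<^esub> = N +>\<^bsub>M\<^esub> \<zero>\<^bsub>M\<^esub>"
    using M.a_coset_join2[OF M.zero_closed N.a_subgroup] by (simp add: quotient_module_def)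
  have "abelian_group ?Q"
  proof (rule abelian_groupI)
    fix S assume "S \<in> carrier ?Q"
    then obtain x where "x \<in> carrier M" "S = N +>\<^bsub>M\<^esub> x" by (auto simp: carrier)
    then show "\<exists>T \<in> carrier ?Q. T \<oplus>\<^bsub>?Q\<^esub> S = \<zero>\<^bsub>?Q\<^esub>"
      by (intro bexI[of _ "N +>\<^bsub>M\<^esub> (\<ominus>\<^bsub>M\<^esub> x)"]) (auto simp: carrier add zero M.l_neg)
  next
    fix S T assume "S \<in> carrier ?Q" "T \<in> carrier ?Q"
    then show "S \<oplus>\<^bsub>?Q\<^esub> T = T \<oplus>\<^bsub>?Q\<^esub> S"
      by (auto simp: carrier add) (simp_all add: M.a_comm)
  qed (auto simp: carrier add zero M.a_assoc)
  then show ?thesis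
    by (intro moduleI M.R.cring_axioms)
      (auto simp: carrier add smult M.smult_l_distr M.smult_r_distr M.smult_assoc1)
qed

lemma cyc_const_1: "cyc_const 1 = (1 :: ('l::finite) cyc)"
  by transfer (simp add: cyc_rel_def one_pCons)

lemma cyc_const_add: "cyc_const (a + b) = cyc_const a + (cyc_const b :: ('l::finite) cyc)"
proof transfer
  fix a b :: bit
  have "[:a + b:] = [:a:] + [:b:]" by (simp only: add_pCons add_0)
  then show "cyc_rel TYPE('l) [:a + b:] ([:a:] + [:b:])"
    by (simp only: cyc_rel_def diff_self dvd_0_right)
qed

lemma cyc_const_mult: "cyc_const (a * b) = cyc_const a * (cyc_const b :: ('l::finite) cyc)"
proof transfer
  fix a b :: bit
  have "[:a * b:] = [:a:] * [:b:]" by (simp only: mult_pCons_left mult_zero_left smult_pCons smult_0_right pCons_0_0 add_0_right)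
  then show "cyc_rel TYPE('l) [:a * b:] ([:a:] * [:b:])"
    by (simp only: cyc_rel_def diff_self dvd_0_right)
qed

lemma module_binary_module:
  "module class_ring (binary_module n :: (bit, ('l::finite) cyc vec) module)"
proof -
  let ?V = "binary_module n :: (bit, 'l cyc vec) module"
  have inv: "\<exists>w \<in> carrier_vec n. w + v = 0\<^sub>v n" if "v \<in> carrier_vec n" for v :: "'l cyc vec"
    using that by (intro bexI[of _ "- v"]) simp_all
  have "abelian_group ?V"
  proof (rule abelian_groupI)
    fix u v w assume "u \<in> carrier ?V" "v \<in> carrier ?V" "w \<in> carrier ?V"
    then show "u \<oplus>\<^bsub>?V\<^esub> v \<oplus>\<^bsub>?V\<^esub> w = u \<oplus>\<^bsub>?V\<^esub> (v \<oplus>\<^bsub>?V\<^esub> w)"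
      unfolding binary_module_def by (simp add: assoc_add_vec)
  next
    fix u v assume "u \<in> carrier ?V" "v \<in> carrier ?V"
    then show "u \<oplus>\<^bsub>?V\<^esub> v = v \<oplus>\<^bsub>?V\<^esub> u"
      unfolding binary_module_def by (simp add: comm_add_vec)
  qed (use inv in \<open>simp_all add: binary_module_def\<close>)
  then show ?thesis
  proof (rule moduleI[OF class_cring.is_cring])
    show "(a \<oplus>\<^bsub>class_ring\<^esub> b) \<odot>\<^bsub>?V\<^esub> v = a \<odot>\<^bsub>?V\<^esub> v \<oplus>\<^bsub>?V\<^esub> b \<odot>\<^bsub>?V\<^esub> v" for a b v
      by (simp only: binary_module_def module.simps ring.simps cyc_const_add add_smult_distrib_vec)
    show "(a \<otimes>\<^bsub>class_ring\<^esub> b) \<odot>\<^bsub>?V\<^esub> v = a \<odot>\<^bsub>?V\<^esub> (b \<odot>\<^bsub>?V\<^esub> v)" for a b v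
      by (simp only: binary_module_def module.simps monoid.simps cyc_const_mult smult_smult_assoc)
    show "\<one>\<^bsub>class_ring\<^esub> \<odot>\<^bsub>?V\<^esub> v = v" for v
      by (simp only: binary_module_def module.simps monoid.simps cyc_const_1 one_smult_vec)
  qed (simp_all add: binary_module_def smult_add_distrib_vec)
qed

lemma vectorspace_homology:
  fixes D1 D2 :: "('l::finite) cyc mat"
  assumes D1: "D1 \<in> carrier_mat m n" and D2: "D2 \<in> carrier_mat n k" and "D1 * D2 = 0\<^sub>m m k"
  shows "vectorspace class_ring (homology D1 D2)"
proof -
  let ?V = "binary_module n :: (bit, 'l cyc vec) module"
  let ?K = "?V\<lparr>carrier := mat_kernel D1\<rparr>"
  interpret V: module class_ring ?V by (rule module_binary_module)
  have minv: "\<ominus>\<^bsub>?V\<^esub> v = - v" if "v \<in> carrier_vec n" for v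
    using that by (intro V.minus_equality) (auto simp: binary_module_def)
  have neg: "D *\<^sub>v (- v) = - (D *\<^sub>v v)" if "v \<in> carrier_vec (dim_col D)"
    for v and D :: "'l cyc mat"
    using that by (intro eq_vecI) auto
  have scale: "D *\<^sub>v (a \<cdot>\<^sub>v v) = a \<cdot>\<^sub>v (D *\<^sub>v v)" if "v \<in> carrier_vec (dim_col D)"
    for a v and D :: "'l cyc mat"
    using that by (intro eq_vecI) auto
  have ker: "Module.submodule (mat_kernel D1) class_ring ?V"
    using D1 by (intro V.submoduleI)
      (auto simp: mat_kernel_def minv neg, auto simp: binary_module_def scale mult_add_distrib_mat_vec)
  have K: "module class_ring ?K"
    by (rule Module.submodule.submodule_is_module[OF ker V.module_axioms])
  have img: "Module.submodule (boundaries D2) class_ring ?V"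
  proof (intro V.submoduleI)
    show "boundaries D2 \<subseteq> carrier ?V"
      using D2 by (auto simp: boundaries_def binary_module_def)
    show "\<zero>\<^bsub>?V\<^esub> \<in> boundaries D2"
      using D2 unfolding boundaries_def
      by (intro image_eqI[of _ _ "0\<^sub>v k"]) (auto simp: binary_module_def)
    fix v assume "v \<in> boundaries D2"
    then obtain w where w: "w \<in> carrier_vec k" "v = D2 *\<^sub>v w"
      using D2 by (auto simp: boundaries_def)
    show "\<ominus>\<^bsub>?V\<^esub> v \<in> boundaries D2"
      using D2 w unfolding boundaries_def
      by (intro image_eqI[of _ _ "- w"]) (auto simp: minv neg)
    show "a \<odot>\<^bsub>?V\<^esub> v \<in> boundaries D2" for a
      using D2 w unfolding boundaries_def
      by (intro image_eqI[of _ _ "cyc_const a \<cdot>\<^sub>v w"]) (auto simp: binary_module_def scale)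
    fix v' assume "v' \<in> boundaries D2"
    then obtain w' where w': "w' \<in> carrier_vec k" "v' = D2 *\<^sub>v w'"
      using D2 by (auto simp: boundaries_def)
    show "v \<oplus>\<^bsub>?V\<^esub> v' \<in> boundaries D2"
      using D2 w w' unfolding boundaries_def
      by (intro image_eqI[of _ _ "w + w'"]) (auto simp: binary_module_def mult_add_distrib_mat_vec)
  qed
  have sub: "boundaries D2 \<subseteq> mat_kernel D1"
  proof
    fix v assume "v \<in> boundaries D2"
    then obtain w where w: "w \<in> carrier_vec k" "v = D2 *\<^sub>v w"
      using D2 by (auto simp: boundaries_def)
    have "D1 *\<^sub>v v = (D1 * D2) *\<^sub>v w"
      using D1 D2 w by (simp add: assoc_mult_mat_vec)
    with assms w show "v \<in> mat_kernel D1"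
      by (auto simp: mat_kernel_def)
  qed
  have "Module.submodule (boundaries D2) class_ring ?K"
    using Module.submodule.submodule_is_module[OF img V.module_axioms]
    by (intro module.module_incl_imp_submodule[OF K]) (use sub in auto)
  then have "module class_ring (homology D1 D2)"
    using quotient_module_module[OF K] D1 by (simp add: homology_def)
  then show ?thesis
    by (intro vectorspace.intro class_field)
qed

text \<open>An indexed family is a basis if it is injective and its range is a basis.\<close>

definition family_basis ::
  "('a, 'm) ring_scheme \<Rightarrow> ('a, 'v, 'n) module_scheme \<Rightarrow> 'j set \<Rightarrow> ('j \<Rightarrow> 'v) \<Rightarrow> bool" where
  "family_basis K V J f \<longleftrightarrow> inj_on f J \<and> vectorspace.basis K V (f ` J)"


section \<open>The lifted product complex\<close>

text \<open>\<open>R^m \<otimes> R^n\<close> is identified with \<open>R^(m*n)\<close>, the unit vectors \<open>i\<close> and \<open>j\<close> having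
  \<open>i * n + j\<close> as their product.\<close>

definition kron_vec :: "'a::times vec \<Rightarrow> 'a vec \<Rightarrow> 'a vec" where
  "kron_vec u v = vec (dim_vec u * dim_vec v)
    (\<lambda>k. u $ (k div dim_vec v) * v $ (k mod dim_vec v))"

definition kron_mat :: "'a::times mat \<Rightarrow> 'a mat \<Rightarrow> 'a mat" where
  "kron_mat C D = mat (dim_row C * dim_row D) (dim_col C * dim_col D)
    (\<lambda>(i, j). C $$ (i div dim_row D, j div dim_col D) * D $$ (i mod dim_row D, j mod dim_col D))"

definition append_cols :: "'a::zero mat \<Rightarrow> 'a mat \<Rightarrow> 'a mat" where
  "append_cols C D = four_block_mat C D (0\<^sub>m 0 (dim_col C)) (0\<^sub>m 0 (dim_col D))"

definition lp_boundary1 :: "('l::finite) cyc mat \<Rightarrow> 'l cyc mat \<Rightarrow> 'l cyc mat" where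
  "lp_boundary1 A B =
    append_cols (kron_mat A (1\<^sub>m (dim_row B))) (kron_mat (1\<^sub>m (dim_row A)) B)"

definition lp_boundary2 :: "('l::finite) cyc mat \<Rightarrow> 'l cyc mat \<Rightarrow> 'l cyc mat" where
  "lp_boundary2 A B = kron_mat (1\<^sub>m (dim_col A)) B @\<^sub>r kron_mat A (1\<^sub>m (dim_col B))"

lemma kron_mat_mult:
  fixes A1 A2 B1 B2 :: "'a::comm_ring_1 mat"
  assumes "A1 \<in> carrier_mat m1 n1" "B1 \<in> carrier_mat m2 n2"
    and "A2 \<in> carrier_mat n1 k1" "B2 \<in> carrier_mat n2 k2"
  shows "kron_mat A1 B1 * kron_mat A2 B2 = kron_mat (A1 * A2) (B1 * B2)"
proof (rule eq_matI)
  fix i j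
  assume "i < dim_row (kron_mat (A1 * A2) (B1 * B2))" "j < dim_col (kron_mat (A1 * A2) (B1 * B2))"
  then have i: "i < m1 * m2" and j: "j < k1 * k2"
    using assms by (auto simp: kron_mat_def)
  then have pos: "m2 > 0" "k2 > 0" by (auto intro: gr0I)
  have div: "i div m2 < m1" "j div k2 < k1" "i mod m2 < m2" "j mod k2 < k2"
    using i j pos by (auto simp: less_mult_imp_div_less)
  let ?f = "\<lambda>p q. A1 $$ (i div m2, p) * B1 $$ (i mod m2, q) * (A2 $$ (p, j div k2) * B2 $$ (q, j mod k2))"
  have bound: "p * n2 + q < n1 * n2" if "p < n1" "q < n2" for p q :: nat
    using mult_le_mono1[of "Suc p" n1 n2] that by simp
  have pos2: "n2 > 0" if "r < n1 * n2" for r :: nat using that by (auto intro: gr0I)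
  have "(kron_mat A1 B1 * kron_mat A2 B2) $$ (i, j) = (\<Sum>r<n1 * n2. ?f (r div n2) (r mod n2))"
    using assms i j by (simp add: kron_mat_def scalar_prod_def atLeast0LessThan)
  also have "\<dots> = (\<Sum>p<n1. \<Sum>q<n2. ?f p q)"
    unfolding sum.cartesian_product
  proof (rule sum.reindex_bij_witness[of _ "\<lambda>(p, q). p * n2 + q" "\<lambda>r. (r div n2, r mod n2)"])
    fix r assume "r \<in> {..<n1 * n2}"
    then show "(r div n2, r mod n2) \<in> {..<n1} \<times> {..<n2}"
      using pos2[of r] by (simp add: less_mult_imp_div_less)
  next
    fix y assume "y \<in> {..<n1} \<times> {..<n2}"
    then obtain p q where y: "y = (p, q)" "p < n1" "q < n2" by blast
    show "(case y of (p, q) \<Rightarrow> p * n2 + q) \<in> {..<n1 * n2}"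
      using bound[OF y(2,3)] by (simp add: y(1))
    show "((case y of (p, q) \<Rightarrow> p * n2 + q) div n2, (case y of (p, q) \<Rightarrow> p * n2 + q) mod n2) = y"
      using y(3) by (simp add: y(1))
  qed simp_all
  also have "\<dots> = (A1 * A2) $$ (i div m2, j div k2) * (B1 * B2) $$ (i mod m2, j mod k2)"
  proof -
    have "(\<Sum>p<n1. \<Sum>q<n2. ?f p q) =
        (\<Sum>p<n1. A1 $$ (i div m2, p) * A2 $$ (p, j div k2)) *
        (\<Sum>q<n2. B1 $$ (i mod m2, q) * B2 $$ (q, j mod k2))"
      unfolding sum_product by (intro sum.cong refl) (simp only: mult_ac)
    then show ?thesis
      using assms div by (simp add: scalar_prod_def atLeast0LessThan)
  qed
  also have "\<dots> = kron_mat (A1 * A2) (B1 * B2) $$ (i, j)"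
    using assms i j by (simp add: kron_mat_def)
  finally show "(kron_mat A1 B1 * kron_mat A2 B2) $$ (i, j) = kron_mat (A1 * A2) (B1 * B2) $$ (i, j)" .
qed (use assms in \<open>auto simp: kron_mat_def\<close>)

lemma kron_mat_carrier [simp]:
  "A \<in> carrier_mat m n \<Longrightarrow> B \<in> carrier_mat m' n' \<Longrightarrow>
    kron_mat A B \<in> carrier_mat (m * m') (n * n')"
  by (auto simp: kron_mat_def)

lemma kron_mat_dim [simp]:
  "dim_row (kron_mat A B) = dim_row A * dim_row B"
  "dim_col (kron_mat A B) = dim_col A * dim_col B"
  by (simp_all add: kron_mat_def)

lemma cyc_add_self: "x + x = (0 :: ('l::finite) cyc)"
proof transfer
  fix p :: "bit poly"
  have "a + a = 0" for a :: bit by (cases a) simp_all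
  then have "p + p = 0" by (intro poly_eqI) (simp only: coeff_add coeff_0)
  then show "cyc_rel TYPE('l) (p + p) 0" by (simp only: cyc_rel_def diff_0_right dvd_0_right)
qed

lemma lp_boundary_comp:
  fixes A B :: "('l::finite) cyc mat"
  assumes A: "A \<in> carrier_mat mA nA" and B: "B \<in> carrier_mat mB nB"
  shows "lp_boundary1 A B * lp_boundary2 A B = 0\<^sub>m (mA * mB) (nA * nB)"
proof -
  let ?K = "kron_mat A B"
  have K: "?K \<in> carrier_mat (mA * mB) (nA * nB)" using A B by simp
  have 1: "kron_mat A (1\<^sub>m mB) * kron_mat (1\<^sub>m nA) B = ?K"
    using A B by (subst kron_mat_mult) auto
  have 2: "kron_mat (1\<^sub>m mA) B * kron_mat A (1\<^sub>m nB) = ?K"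
    using A B by (subst kron_mat_mult) auto
  have "lp_boundary1 A B * lp_boundary2 A B =
      four_block_mat (?K + ?K) (0\<^sub>m (mA * mB) 0) (0\<^sub>m 0 (nA * nB)) (0\<^sub>m 0 0)"
    unfolding lp_boundary1_def lp_boundary2_def append_cols_def append_rows_def
    using A B
    by (subst mult_four_block_mat[where ?nr1.0 = "mA * mB" and ?nr2.0 = 0 and ?n1.0 = "nA * mB"
          and ?n2.0 = "mA * nB" and ?nc1.0 = "nA * nB" and ?nc2.0 = 0])
      (simp_all add: 1 2)
  also have "?K + ?K = 0\<^sub>m (mA * mB) (nA * nB)"
  proof (rule eq_matI)
    fix r s assume "r < dim_row (0\<^sub>m (mA * mB) (nA * nB) :: 'l cyc mat)"
      "s < dim_col (0\<^sub>m (mA * mB) (nA * nB) :: 'l cyc mat)"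
    then have "r < mA * mB" "s < nA * nB" by simp_all
    with K show "(?K + ?K) $$ (r, s) = 0\<^sub>m (mA * mB) (nA * nB) $$ (r, s)"
      by (simp only: carrier_matD index_add_mat index_zero_mat cyc_add_self)
  qed (use K in \<open>simp_all only: carrier_matD index_add_mat index_zero_mat\<close>)
  finally show ?thesis by (auto simp: four_block_mat_def Let_def)
qed


section \<open>Evaluation at roots and information sets\<close>

text \<open>Field elements live in the algebraic closure of the two-element field;
  \<open>gen_field \<beta>\<close> is the finite field generated by \<open>\<beta>\<close>. Evaluation uses the representative of
  degree less than \<open>l\<close>; for an \<open>l\<close>-th root of unity \<open>\<beta>\<close> any other would give the same value.\<close>

definition gen_field :: "bit alg_closure \<Rightarrow> bit alg_closure set" where
  "gen_field \<beta> = range (\<lambda>f. poly (map_poly to_ac f) \<beta>)"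

definition cyc_eval :: "bit alg_closure \<Rightarrow> ('l::finite) cyc \<Rightarrow> bit alg_closure" where
  "cyc_eval \<beta> f = poly (map_poly to_ac (cyc_rep f)) \<beta>"

text \<open>The inverse of evaluation at \<open>\<beta>\<close> on the ideal \<open>c R\<close>.\<close>

definition cyc_lift :: "('l::finite) cyc \<Rightarrow> bit alg_closure \<Rightarrow> bit alg_closure \<Rightarrow> 'l cyc" where
  "cyc_lift c \<beta> = inv_into (range ((*) c)) (cyc_eval \<beta>)"

text \<open>\<open>gen_field \<beta>\<close> as a vector space over the two-element field.\<close>

definition gen_field_module :: "bit alg_closure \<Rightarrow> (bit, bit alg_closure) module" where
  "gen_field_module \<beta> = \<lparr>
    carrier = gen_field \<beta>,
    mult = (*),
    one = 1,
    zero = 0,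
    add = (+),
    smult = (\<lambda>a y. to_ac a * y)\<rparr>"

text \<open>The linear code over \<open>gen_field \<beta>\<close> with parity check matrix \<open>M\<close>.\<close>

definition kernel_code :: "bit alg_closure \<Rightarrow> bit alg_closure mat \<Rightarrow> bit alg_closure vec set" where
  "kernel_code \<beta> M = {v \<in> mat_kernel M. set\<^sub>v v \<subseteq> gen_field \<beta>}"

definition code_dim :: "bit alg_closure \<Rightarrow> nat \<Rightarrow> bit alg_closure vec set \<Rightarrow> nat" where
  "code_dim \<beta> n V = vectorspace.dim
    (class_ring\<lparr>carrier := gen_field \<beta>\<rparr>)
    (module_vec TYPE(bit alg_closure) n\<lparr>carrier := V\<rparr>)"

definition information_set ::
  "bit alg_closure \<Rightarrow> nat \<Rightarrow> bit alg_closure vec set \<Rightarrow> nat set \<Rightarrow> bool" where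
  "information_set \<beta> n V I \<longleftrightarrow>
    I \<subseteq> {..<n} \<and> card I = code_dim \<beta> n V \<and> inj_on (\<lambda>v. restrict (\<lambda>k. v $ k) I) V"

definition systematic_row ::
  "bit alg_closure vec set \<Rightarrow> nat set \<Rightarrow> nat \<Rightarrow> bit alg_closure vec" where
  "systematic_row V I j = (THE g. g \<in> V \<and> (\<forall>k\<in>I. g $ k = (if k = j then 1 else 0)))"

definition zeta ::
  "('l::finite) cyc \<Rightarrow> bit alg_closure \<Rightarrow> 'l cyc mat \<Rightarrow> nat set \<Rightarrow> nat \<Rightarrow> 'l cyc vec" where
  "zeta c \<beta> C I j =
    map_vec (cyc_lift c \<beta>) (systematic_row (kernel_code \<beta> (map_mat (cyc_eval \<beta>) C)) I j)"

definition xi_bar ::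
  "('l::finite) cyc \<Rightarrow> bit alg_closure \<Rightarrow> 'l cyc mat \<Rightarrow> nat set \<Rightarrow> nat \<Rightarrow> 'l cyc vec" where
  "xi_bar c \<beta> C I j =
    map_vec (\<lambda>y. cyc_conj (cyc_lift c \<beta> y))
      (systematic_row (kernel_code \<beta> (transpose_mat (map_mat (cyc_eval \<beta>) C))) I j)"


section \<open>The generator matrices and logical operators\<close>

text \<open>Components are numbered from \<open>0\<close> to \<open>t - 1\<close>. Throughout, \<open>b i\<close> are the irreducible
  factors, \<open>\<beta> i\<close> their chosen roots, \<open>c i\<close> the central idempotents, \<open>e i k\<close> the exponents
  (for \<open>k < degree (b i)\<close>) and \<open>h i m\<close> the dual element belonging to the exponent \<open>m\<close>.
  \<open>I i\<close> is an information set of the kernel of \<open>C\<close> and \<open>Is i\<close> of the kernel of the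
  transpose, both evaluated at \<open>\<beta> i\<close>.\<close>

definition exponents :: "(nat \<Rightarrow> bit poly) \<Rightarrow> (nat \<Rightarrow> nat \<Rightarrow> nat) \<Rightarrow> nat \<Rightarrow> nat list" where
  "exponents b e i = map (e i) [0..<degree (b i)]"

definition G_mat ::
  "nat \<Rightarrow> (nat \<Rightarrow> ('l::finite) cyc) \<Rightarrow> (nat \<Rightarrow> bit alg_closure) \<Rightarrow>
   'l cyc mat \<Rightarrow> (nat \<Rightarrow> nat set) \<Rightarrow> 'l cyc mat" where
  "G_mat t c \<beta> C I = mat_of_rows (dim_col C)
    [zeta (c i) (\<beta> i) C (I i) j. i \<leftarrow> [0..<t], j \<leftarrow> sorted_list_of_set (I i)]"

definition E_mat ::
  "nat \<Rightarrow> (nat \<Rightarrow> bit poly) \<Rightarrow> (nat \<Rightarrow> ('l::finite) cyc) \<Rightarrow> (nat \<Rightarrow> nat \<Rightarrow> nat) \<Rightarrow>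
   (nat \<Rightarrow> nat \<Rightarrow> 'l cyc) \<Rightarrow> 'l cyc mat \<Rightarrow> (nat \<Rightarrow> nat set) \<Rightarrow> 'l cyc mat" where
  "E_mat t b c e h C Is = mat_of_rows (dim_row C)
    [(h i m * c i) \<cdot>\<^sub>v unit_vec (dim_row C) j.
      i \<leftarrow> [0..<t], j \<leftarrow> sorted_list_of_set (Is i), m \<leftarrow> exponents b e i]"

definition G_star_mat ::
  "nat \<Rightarrow> (nat \<Rightarrow> bit poly) \<Rightarrow> (nat \<Rightarrow> ('l::finite) cyc) \<Rightarrow> (nat \<Rightarrow> bit alg_closure) \<Rightarrow>
   (nat \<Rightarrow> nat \<Rightarrow> nat) \<Rightarrow> 'l cyc mat \<Rightarrow> (nat \<Rightarrow> nat set) \<Rightarrow> 'l cyc mat" where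
  "G_star_mat t b c \<beta> e C Is = mat_of_rows (dim_row C)
    [(cyc_x ^ m * cyc_conj (c i)) \<cdot>\<^sub>v xi_bar (c i) (\<beta> i) C (Is i) j.
      i \<leftarrow> [0..<t], j \<leftarrow> sorted_list_of_set (Is i), m \<leftarrow> exponents b e i]"

definition E_star_mat ::
  "nat \<Rightarrow> (nat \<Rightarrow> ('l::finite) cyc) \<Rightarrow> 'l cyc mat \<Rightarrow> (nat \<Rightarrow> nat set) \<Rightarrow> 'l cyc mat" where
  "E_star_mat t c C I = mat_of_rows (dim_col C)
    [cyc_conj (c i) \<cdot>\<^sub>v unit_vec (dim_col C) j. i \<leftarrow> [0..<t], j \<leftarrow> sorted_list_of_set (I i)]"

text \<open>The direct sums are block diagonal, along the decomposition of the middle term into its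
  left and right sectors.\<close>

definition L_Z ::
  "nat \<Rightarrow> (nat \<Rightarrow> bit poly) \<Rightarrow> (nat \<Rightarrow> ('l::finite) cyc) \<Rightarrow> (nat \<Rightarrow> bit alg_closure) \<Rightarrow>
   (nat \<Rightarrow> nat \<Rightarrow> nat) \<Rightarrow> (nat \<Rightarrow> nat \<Rightarrow> 'l cyc) \<Rightarrow> 'l cyc mat \<Rightarrow> 'l cyc mat \<Rightarrow>
   (nat \<Rightarrow> nat set) \<Rightarrow> (nat \<Rightarrow> nat set) \<Rightarrow> (nat \<Rightarrow> nat set) \<Rightarrow> (nat \<Rightarrow> nat set) \<Rightarrow> 'l cyc mat" where
  "L_Z t b c \<beta> e h A B IA IAs IB IBs = diag_block_mat
    [kron_mat (G_mat t c \<beta> A IA) (E_mat t b c e h B IBs),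
     kron_mat (E_mat t b c e h A IAs) (G_mat t c \<beta> B IB)]"

definition L_X ::
  "nat \<Rightarrow> (nat \<Rightarrow> bit poly) \<Rightarrow> (nat \<Rightarrow> ('l::finite) cyc) \<Rightarrow> (nat \<Rightarrow> bit alg_closure) \<Rightarrow>
   (nat \<Rightarrow> nat \<Rightarrow> nat) \<Rightarrow> 'l cyc mat \<Rightarrow> 'l cyc mat \<Rightarrow>
   (nat \<Rightarrow> nat set) \<Rightarrow> (nat \<Rightarrow> nat set) \<Rightarrow> (nat \<Rightarrow> nat set) \<Rightarrow> (nat \<Rightarrow> nat set) \<Rightarrow> 'l cyc mat" where
  "L_X t b c \<beta> e A B IA IAs IB IBs = diag_block_mat
    [kron_mat (E_star_mat t c A IA) (G_star_mat t b c \<beta> e B IBs),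
     kron_mat (G_star_mat t b c \<beta> e A IAs) (E_star_mat t c B IB)]"

datatype sector = LeftSector | RightSector

definition logical_index ::
  "nat \<Rightarrow> (nat \<Rightarrow> bit poly) \<Rightarrow> (nat \<Rightarrow> nat \<Rightarrow> nat) \<Rightarrow>
   (nat \<Rightarrow> nat set) \<Rightarrow> (nat \<Rightarrow> nat set) \<Rightarrow> (nat \<Rightarrow> nat set) \<Rightarrow> (nat \<Rightarrow> nat set) \<Rightarrow>
   (sector \<times> nat \<times> nat \<times> nat \<times> nat) set" where
  "logical_index t b e IA IAs IB IBs =
    {(LeftSector, i, p, q, m) | i p q m.
       i < t \<and> p \<in> IA i \<and> q \<in> IBs i \<and> m \<in> set (exponents b e i)} \<union>
    {(RightSector, i, p, q, m) | i p q m.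
       i < t \<and> p \<in> IAs i \<and> q \<in> IB i \<and> m \<in> set (exponents b e i)}"

fun supp_Z ::
  "(nat \<Rightarrow> ('l::finite) cyc) \<Rightarrow> (nat \<Rightarrow> bit alg_closure) \<Rightarrow> (nat \<Rightarrow> nat \<Rightarrow> 'l cyc) \<Rightarrow>
   'l cyc mat \<Rightarrow> 'l cyc mat \<Rightarrow> (nat \<Rightarrow> nat set) \<Rightarrow> (nat \<Rightarrow> nat set) \<Rightarrow>
   sector \<times> nat \<times> nat \<times> nat \<times> nat \<Rightarrow> 'l cyc vec" where
  "supp_Z c \<beta> h A B IA IB (LeftSector, i, p, q, m) =
    kron_vec ((c i * h i m) \<cdot>\<^sub>v zeta (c i) (\<beta> i) A (IA i) p) (unit_vec (dim_row B) q)
    @\<^sub>v 0\<^sub>v (dim_row A * dim_col B)"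
| "supp_Z c \<beta> h A B IA IB (RightSector, i, p, q, m) =
    0\<^sub>v (dim_col A * dim_row B) @\<^sub>v
    kron_vec ((h i m * c i) \<cdot>\<^sub>v unit_vec (dim_row A) p) (zeta (c i) (\<beta> i) B (IB i) q)"

fun supp_X ::
  "(nat \<Rightarrow> ('l::finite) cyc) \<Rightarrow> (nat \<Rightarrow> bit alg_closure) \<Rightarrow>
   'l cyc mat \<Rightarrow> 'l cyc mat \<Rightarrow> (nat \<Rightarrow> nat set) \<Rightarrow> (nat \<Rightarrow> nat set) \<Rightarrow>
   sector \<times> nat \<times> nat \<times> nat \<times> nat \<Rightarrow> 'l cyc vec" where
  "supp_X c \<beta> A B IAs IBs (LeftSector, i, p, q, m) =
    kron_vec ((cyc_conj (c i) * cyc_x ^ m) \<cdot>\<^sub>v unit_vec (dim_col A) p)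
      (xi_bar (c i) (\<beta> i) B (IBs i) q)
    @\<^sub>v 0\<^sub>v (dim_row A * dim_col B)"
| "supp_X c \<beta> A B IAs IBs (RightSector, i, p, q, m) =
    0\<^sub>v (dim_col A * dim_row B) @\<^sub>v
    kron_vec ((cyc_x ^ m * cyc_conj (c i)) \<cdot>\<^sub>v xi_bar (c i) (\<beta> i) A (IAs i) p)
      (unit_vec (dim_col B) q)"

end

theory Submission
  imports Defs
begin

text \<open>By the Chinese remainder theorem \<open>R\<close> is the product of the fields generated by the roots, so
  the systematic bases of the component kernels assemble to matrices over \<open>R\<close>: a projection \<open>G\<close>
  onto the kernel of \<open>C\<close>, and a projection \<open>F\<close> killing its image. Since \<open>R\<close> is a finite Frobenius
  ring, the image of \<open>C\<close> is the annihilator of the kernel of its transpose, and this gives a matrix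
  \<open>Z\<close> with \<open>Z C = 1 + G\<close> and \<open>C Z = 1 + F\<close>. Tensoring these contractions of \<open>A\<close> and \<open>B\<close> yields a
  homotopy on the lifted product complex between the identity and the block diagonal matrix of
  \<open>GA \<otimes> FB\<close> and \<open>FA \<otimes> GB\<close>, whose range is spanned by the claimed operators; the conjugate
  transpose of the same identity treats cohomology. Independence of both families follows from the
  pairing, which descends to classes.\<close>

text \<open>The Frobenius form is \<open>cyc_coeff (f * g) 0\<close>. It is nondegenerate and
  represents every additive functional on \<open>R\<close>, which turns an annihilator condition
  into solvability of a linear system. Solving gives two one-sided contractions of \<open>C\<close>
  by different matrices, whereas the homotopy needs one matrix serving both sides. A further gap
  remains after the homotopy: the range of the block diagonal matrix is at first spanned with
  coefficients from \<open>R\<close>, not from the two-element field. A coefficient \<open>f\<close>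
  in front of a vector of component \<open>i\<close> acts only through \<open>c i * f\<close>, so it
  is enough to span the ideal \<open>c i R\<close> over the two-element field. The products of
  \<open>c i\<close> with the inverse powers of \<open>x\<close> do so because the inverse powers of
  the root span the component field; after conjugation this serves cohomology. The elements
  \<open>c i * h i m\<close> do so because pairing with those inverse powers reads off exactly the
  coefficients fixed by \<open>dual\<close>. Spanning together with duality gives bases, so no
  dimension of homology is ever computed.\<close>

no_notation fps_nth (infixl "$" 75)

section \<open>Circulants\<close>

lemma bit_add_self: "a + a = (0 :: bit)"
  by (cases a) simp_all

lemma finite_UNIV_bit: "finite (UNIV :: bit set)"
proof (rule finite_subset)
  show "(UNIV :: bit set) \<subseteq> {0, 1}" by (metis bit_not_one_iff insert_iff subsetI)
qed simp

lemma abs_cyc_cyc_rep: "abs_cyc (cyc_rep f) = f"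
  by transfer (simp add: cyc_rel_iff_mod)

lemma cyc_rep_abs_cyc: "cyc_rep (abs_cyc p :: ('l::finite) cyc) = p mod cyc_modulus TYPE('l)"
  by (rule cyc_rep.abs_eq)

lemma cyc_x_power: "cyc_x ^ k = (abs_cyc (monom 1 k) :: ('l::finite) cyc)"
proof (induction k)
  case 0
  show ?case by (simp add: one_cyc.abs_eq)
next
  case (Suc k)
  have "abs_cyc (monom 1 1) * abs_cyc (monom 1 k) = (abs_cyc (monom 1 (Suc k)) :: 'l cyc)"
    by (simp add: times_cyc.abs_eq mult_monom)
  with Suc show ?case by (simp add: cyc_x.abs_eq)
qed

lemma cyc_x_power_card: "cyc_x ^ CARD('l) = (1 :: ('l::finite) cyc)"
proof -
  have "cyc_rel TYPE('l) (monom 1 CARD('l)) 1"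
    unfolding cyc_rel_def cyc_modulus_def
    by (rule dvdI[of _ _ 1]) (simp add: poly_eq_iff)
  then show ?thesis
    by (simp add: cyc_x_power one_cyc.abs_eq cyc.abs_eq_iff)
qed

lemma cyc_x_power_mod: "cyc_x ^ k = (cyc_x ^ (k mod CARD('l)) :: ('l::finite) cyc)"
proof -
  have "k = CARD('l) * (k div CARD('l)) + k mod CARD('l)" by simp
  then have "(cyc_x :: 'l cyc) ^ k = (cyc_x ^ CARD('l)) ^ (k div CARD('l)) * cyc_x ^ (k mod CARD('l))"
    by (metis power_add power_mult)
  then show ?thesis by (simp add: cyc_x_power_card)
qed

lemma cyc_coeff_x_power:
  assumes "j < CARD('l)"
  shows "cyc_coeff (cyc_x ^ k :: ('l::finite) cyc) j = of_bool (k mod CARD('l) = j)"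
proof -
  let ?r = "k mod CARD('l)"
  have "degree (monom 1 ?r :: bit poly) < degree (cyc_modulus TYPE('l))"
    by (simp add: degree_monom_eq degree_cyc_modulus)
  then have "cyc_rep (cyc_x ^ ?r :: 'l cyc) = monom 1 ?r"
    by (simp add: cyc_x_power cyc_rep_abs_cyc mod_poly_less)
  then show ?thesis
    by (subst cyc_x_power_mod) (simp add: cyc_coeff_def coeff_monom)
qed

lemma cyc_rep_add: "cyc_rep (f + g) = cyc_rep f + cyc_rep g"
  by transfer (simp add: poly_mod_add_left)

lemma cyc_rep_0: "cyc_rep 0 = 0"
  by transfer simp

lemma cyc_coeff_add: "cyc_coeff (f + g) k = cyc_coeff f k + cyc_coeff g k"
  by (simp add: cyc_coeff_def cyc_rep_add)

lemma cyc_coeff_0: "cyc_coeff 0 k = 0"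
  by (simp add: cyc_coeff_def cyc_rep_0)

lemma cyc_coeff_sum: "cyc_coeff (\<Sum>x\<in>S. f x) k = (\<Sum>x\<in>S. cyc_coeff (f x) k)"
  by (induction S rule: infinite_finite_induct) (simp_all add: cyc_coeff_add cyc_coeff_0)

text \<open>With scalars only 0 and 1, the powers of \<open>cyc_x\<close> generate \<open>R\<close>
  as an additive group. Identities between additive maps thus reduce to these powers, where they
  become statements about exponents modulo \<open>l\<close>.\<close>

lemma cyc_additive_induct [case_names zero add power]:
  fixes f :: "('l::finite) cyc"
  assumes "P 0" "\<And>f g. P f \<Longrightarrow> P g \<Longrightarrow> P (f + g)" "\<And>k. P (cyc_x ^ k)"
  shows "P f"
proof -
  have monom: "P (abs_cyc (monom a k))" for a k
    by (cases a) (use assms(1,3)[unfolded zero_cyc.abs_eq cyc_x_power] in simp_all)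
  have "P (abs_cyc (\<Sum>k\<in>K. monom (a k) k))" for a and K :: "nat set"
  proof (induction K rule: infinite_finite_induct)
    case (insert k K)
    then show ?case using assms(2)[OF monom insert.IH] by (simp add: plus_cyc.abs_eq)
  qed (use assms(1)[unfolded zero_cyc.abs_eq] in simp_all)
  then have "P (abs_cyc (\<Sum>k\<le>degree (cyc_rep f). monom (coeff (cyc_rep f) k) k))" .
  then show ?thesis by (simp add: poly_as_sum_of_monoms abs_cyc_cyc_rep)
qed

lemma cyc_coeff_eqI:
  fixes f g :: "('l::finite) cyc"
  assumes "\<And>k. k < CARD('l) \<Longrightarrow> cyc_coeff f k = cyc_coeff g k"
  shows "f = g"
proof -
  have deg: "degree (cyc_rep h) < CARD('l)" for h :: "'l cyc"
  proof -
    have "cyc_rep h = cyc_rep h mod cyc_modulus TYPE('l)" by transfer simp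
    moreover have "degree (cyc_rep h mod cyc_modulus TYPE('l)) < degree (cyc_modulus TYPE('l))"
      using degree_mod_less[of "cyc_modulus TYPE('l)" "cyc_rep h"] degree_cyc_modulus[where 'l = 'l]
      by fastforce
    ultimately show ?thesis by (simp add: degree_cyc_modulus)
  qed
  have "cyc_rep f = cyc_rep g"
  proof (rule poly_eqI)
    fix k show "coeff (cyc_rep f) k = coeff (cyc_rep g) k"
      using assms[of k] deg[of f] deg[of g]
      by (cases "k < CARD('l)") (simp_all add: cyc_coeff_def coeff_eq_0)
  qed
  then show ?thesis by (metis abs_cyc_cyc_rep)
qed

text \<open>Finiteness serves two purposes: choosing maximal subgroups of \<open>R^n\<close>, and
  counting codewords over the component fields, which are images of \<open>R\<close>.\<close>

lemma finite_UNIV_cyc: "finite (UNIV :: ('l::finite) cyc set)"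
proof (rule inj_on_finite)
  show "inj_on (\<lambda>f :: 'l cyc. restrict (cyc_coeff f) {..<CARD('l)}) UNIV"
    by (rule inj_onI) (metis cyc_coeff_eqI restrict_apply' lessThan_iff)
  show "finite (PiE {..<CARD('l)} (\<lambda>_. UNIV :: bit set))"
    by (intro finite_PiE finite_lessThan finite_UNIV_bit)
qed (auto simp: restrict_def PiE_def extensional_def)

lemma finite_carrier_vec_cyc: "finite (carrier_vec n :: ('l::finite) cyc vec set)"
proof -
  have "finite {xs :: 'l cyc list. set xs \<subseteq> UNIV \<and> length xs = n}"
    by (intro finite_lists_length_eq finite_UNIV_cyc)
  then have "finite (vec_of_list ` {xs :: 'l cyc list. length xs = n})" by simp
  moreover have "carrier_vec n \<subseteq> vec_of_list ` {xs :: 'l cyc list. length xs = n}"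
  proof
    fix v :: "'l cyc vec" assume "v \<in> carrier_vec n"
    then show "v \<in> vec_of_list ` {xs. length xs = n}"
      by (intro image_eqI[of _ _ "list_of_vec v"]) (simp_all add: vec_list)
  qed
  ultimately show ?thesis by (rule finite_subset[rotated])
qed


section \<open>Conjugation and the constant-coefficient form\<close>

lemma pcompose_monom: "pcompose (monom 1 k) p = p ^ k" for p :: "'a::comm_ring_1 poly"
  by (induction k) (simp_all add: monom_Suc pcompose_pCons pcompose_1)

lemma cyc_conj_0 [simp]: "cyc_conj 0 = 0"
  by transfer (simp add: cyc_rel_def)

lemma cyc_conj_1 [simp]: "cyc_conj 1 = 1"
  by transfer (simp add: cyc_rel_def pcompose_1)

lemma cyc_conj_add: "cyc_conj (f + g) = cyc_conj f + cyc_conj g"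
  by transfer (simp add: cyc_rel_def pcompose_add)

lemma cyc_conj_mult: "cyc_conj (f * g) = cyc_conj f * cyc_conj g"
  by transfer (simp add: cyc_rel_def pcompose_mult)

lemma cyc_conj_sum: "cyc_conj (\<Sum>x\<in>S. f x) = (\<Sum>x\<in>S. cyc_conj (f x))"
  by (induction S rule: infinite_finite_induct) (simp_all add: cyc_conj_add)

lemma cyc_conj_power: "cyc_conj (f ^ k) = cyc_conj f ^ k"
  by (induction k) (simp_all add: cyc_conj_mult)

lemma cyc_conj_x: "cyc_conj cyc_x = (cyc_x ^ (CARD('l) - 1) :: ('l::finite) cyc)"
  unfolding cyc_x_power by (simp add: cyc_x.abs_eq cyc_conj.abs_eq pcompose_monom del: One_nat_def)

lemma cyc_conj_x_mult: "cyc_conj cyc_x * cyc_x = (1 :: ('l::finite) cyc)"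
proof -
  have "Suc (CARD('l) - 1) = CARD('l)" by simp
  then show ?thesis
    by (metis cyc_conj_x cyc_x_power_card power_Suc2)
qed

lemma cyc_conj_conj [simp]: "cyc_conj (cyc_conj f) = (f :: ('l::finite) cyc)"
proof (induction f rule: cyc_additive_induct)
  case (power k)
  \<comment> \<open>Both \<open>cyc_conj (cyc_conj cyc_x)\<close> and \<open>cyc_x\<close> are
    inverses of \<open>cyc_conj cyc_x\<close>, hence equal.\<close>
  have "cyc_conj (cyc_conj cyc_x) = cyc_conj (cyc_conj cyc_x) * (cyc_conj cyc_x * cyc_x :: 'l cyc)"
    by (simp add: cyc_conj_x_mult)
  also have "\<dots> = cyc_conj (cyc_conj cyc_x * cyc_x) * cyc_x"
    by (simp only: cyc_conj_mult mult.assoc)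
  also have "\<dots> = cyc_x"
    by (simp add: cyc_conj_x_mult)
  finally have "cyc_conj (cyc_conj cyc_x) = (cyc_x :: 'l cyc)" .
  then show ?case by (simp add: cyc_conj_power)
qed (simp_all add: cyc_conj_add)

text \<open>The conjugate of \<open>x^m\<close> is \<open>x^(-m)\<close>, so the product shifts
  coefficient \<open>m\<close> to position 0. This converts the coefficient condition on the dual
  elements into a statement about the pairing.\<close>

lemma cyc_coeff_mult_conj_x_power:
  assumes "m < CARD('l)"
  shows "cyc_coeff (f * cyc_conj (cyc_x ^ m)) 0 = cyc_coeff (f :: ('l::finite) cyc) m"
proof (induction f rule: cyc_additive_induct)
  case (power k)
  let ?l = "CARD('l)"
  \<comment> \<open>Modulo \<open>l\<close>, \<open>(?l - 1) * m\<close> is \<open>-m\<close>;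
    adding \<open>m\<close> on both sides avoids subtraction of natural numbers.\<close>
  have "(k + (?l - 1) * m) mod ?l = 0 \<longleftrightarrow> k mod ?l = m"
  proof -
    have "(k + (?l - 1) * m) mod ?l = 0 \<longleftrightarrow> (k + (?l - 1) * m + m) mod ?l = m mod ?l"
      using cong_add_rcancel_nat[of "k + (?l - 1) * m" m 0 ?l] by (simp add: cong_def)
    also have "k + (?l - 1) * m + m = k + ?l * m"
      by (cases ?l) simp_all
    finally show ?thesis using assms by simp
  qed
  then show ?case
    using assms by (simp add: cyc_conj_power cyc_conj_x cyc_coeff_x_power flip: power_add power_mult)
qed (simp_all add: cyc_coeff_0 cyc_coeff_add distrib_right)

text \<open>\<open>x^k\<close> and \<open>x^(-k)\<close> have constant coefficient 1 for the same
  \<open>k\<close>. This is the source of the symmetry of the pairing.\<close>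

lemma cyc_coeff_conj: "cyc_coeff (cyc_conj f) 0 = cyc_coeff (f :: ('l::finite) cyc) 0"
proof (induction f rule: cyc_additive_induct)
  case (power k)
  have "cyc_coeff (1 * cyc_conj (cyc_x ^ (k mod CARD('l))) :: 'l cyc) 0 = cyc_coeff (cyc_x ^ 0 :: 'l cyc) (k mod CARD('l))"
    by (subst cyc_coeff_mult_conj_x_power) simp_all
  also have "\<dots> = cyc_coeff (cyc_x ^ k :: 'l cyc) 0"
    using cyc_coeff_x_power[of "k mod CARD('l)" 0, where 'l = 'l]
    by (simp add: cyc_coeff_x_power[of 0] eq_commute[of 0])
  finally show ?case by (metis cyc_x_power_mod mult_1)
qed (simp_all add: cyc_conj_add cyc_coeff_add)

text \<open>Nondegeneracy of the Frobenius form: letting \<open>g\<close> run through the inverse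
  powers of \<open>x\<close> recovers every coefficient of \<open>f\<close>.\<close>

lemma cyc_eq_0I:
  fixes f :: "('l::finite) cyc"
  assumes "\<And>g. cyc_coeff (f * g) 0 = 0"
  shows "f = 0"
  by (rule cyc_coeff_eqI) (metis assms cyc_coeff_0 cyc_coeff_mult_conj_x_power)


section \<open>Evaluation at roots of unity\<close>

lemma poly_to_ac_add:
  "poly (map_poly to_ac (p + q)) \<beta> = poly (map_poly to_ac p) \<beta> + poly (map_poly to_ac q) \<beta>"
proof -
  have "map_poly to_ac (p + q) = map_poly to_ac p + map_poly to_ac q"
    by (intro poly_eqI) (simp add: coeff_map_poly)
  then show ?thesis by simp
qed

lemma poly_to_ac_mult:
  "poly (map_poly to_ac (p * q)) \<beta> = poly (map_poly to_ac p) \<beta> * poly (map_poly to_ac q) \<beta>"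
proof (induction p)
  case (pCons a p)
  have "poly (map_poly to_ac (Polynomial.smult a q)) \<beta> = to_ac a * poly (map_poly to_ac q) \<beta>"
    by (subst map_poly_smult) simp_all
  with pCons show ?case
    by (simp add: poly_to_ac_add map_poly_pCons algebra_simps)
qed simp

lemma poly_to_ac_monom: "poly (map_poly to_ac (monom 1 k)) \<beta> = \<beta> ^ k"
  by (simp add: map_poly_monom poly_monom)

lemma poly_to_ac_const: "poly (map_poly to_ac [:a:]) \<beta> = to_ac a"
  by (simp add: map_poly_pCons)

lemma gen_field_0: "0 \<in> gen_field \<beta>"
  unfolding gen_field_def by (rule range_eqI[of _ _ 0]) simp

lemma gen_field_to_ac: "to_ac a \<in> gen_field \<beta>"
  unfolding gen_field_def by (rule range_eqI[of _ _ "[:a:]"]) (simp add: poly_to_ac_const)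

lemma gen_field_1: "1 \<in> gen_field \<beta>"
  using gen_field_to_ac[of 1] by simp

lemma gen_field_add: "y \<in> gen_field \<beta> \<Longrightarrow> z \<in> gen_field \<beta> \<Longrightarrow> y + z \<in> gen_field \<beta>"
  unfolding gen_field_def by (auto simp flip: poly_to_ac_add)

lemma gen_field_mult: "y \<in> gen_field \<beta> \<Longrightarrow> z \<in> gen_field \<beta> \<Longrightarrow> y * z \<in> gen_field \<beta>"
  unfolding gen_field_def by (auto simp flip: poly_to_ac_mult)

lemma ac_add_self: "y + y = (0 :: bit alg_closure)"
proof -
  have "to_ac (1 + 1) * y = (0 :: bit alg_closure)"
    by (simp only: bit_add_self to_ac_0 mult_zero_left)
  then show ?thesis by (simp only: to_ac_add to_ac_1 distrib_right mult_1)
qed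

lemma gen_field_uminus: "y \<in> gen_field \<beta> \<Longrightarrow> - y \<in> gen_field \<beta>"
  using ac_add_self by (metis eq_neg_iff_add_eq_0)

context
  fixes \<beta> :: "bit alg_closure" and T :: "'l::finite itself"
  assumes root_of_unity: "\<beta> ^ CARD('l) = 1"
begin

text \<open>The modulus vanishes at an \<open>l\<close>-th root of unity, so evaluation does not
  depend on the representative; this is what makes \<open>cyc_eval\<close> multiplicative.\<close>

lemma cyc_eval_abs_cyc: "cyc_eval \<beta> (abs_cyc p :: 'l cyc) = poly (map_poly to_ac p) \<beta>"
proof -
  have "poly (map_poly to_ac (cyc_modulus TYPE('l))) \<beta> = 0"
    by (simp add: cyc_modulus_def poly_to_ac_add poly_to_ac_monom root_of_unity ac_add_self)
  then show ?thesis
    using poly_to_ac_add[of "p div cyc_modulus TYPE('l) * cyc_modulus TYPE('l)"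
        "p mod cyc_modulus TYPE('l)" \<beta>]
    by (simp only: cyc_eval_def cyc_rep_abs_cyc poly_to_ac_mult div_mult_mod_eq mult_zero_right add_0)
qed

lemma cyc_eval_mult: "cyc_eval \<beta> (f * g :: 'l cyc) = cyc_eval \<beta> f * cyc_eval \<beta> g"
proof -
  have "cyc_eval \<beta> (abs_cyc (cyc_rep f) * abs_cyc (cyc_rep g) :: 'l cyc) =
      cyc_eval \<beta> (abs_cyc (cyc_rep f) :: 'l cyc) * cyc_eval \<beta> (abs_cyc (cyc_rep g) :: 'l cyc)"
    by (simp only: times_cyc.abs_eq cyc_eval_abs_cyc poly_to_ac_mult)
  then show ?thesis by (simp only: abs_cyc_cyc_rep)
qed

lemma cyc_eval_1: "cyc_eval \<beta> (1 :: 'l cyc) = 1"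
  by (simp add: one_cyc.abs_eq cyc_eval_abs_cyc)

lemma cyc_eval_x: "cyc_eval \<beta> (cyc_x :: 'l cyc) = \<beta>"
  by (simp add: cyc_x.abs_eq cyc_eval_abs_cyc poly_to_ac_monom del: One_nat_def)

lemma range_cyc_eval: "range (cyc_eval \<beta> :: 'l cyc \<Rightarrow> _) = gen_field \<beta>"
proof
  show "range (cyc_eval \<beta> :: 'l cyc \<Rightarrow> _) \<subseteq> gen_field \<beta>"
    by (auto simp: cyc_eval_def gen_field_def)
  show "gen_field \<beta> \<subseteq> range (cyc_eval \<beta> :: 'l cyc \<Rightarrow> _)"
    unfolding gen_field_def by (auto simp flip: cyc_eval_abs_cyc)
qed

lemma finite_gen_field: "finite (gen_field \<beta>)"
  using finite_imageI[OF finite_UNIV_cyc, of "cyc_eval \<beta> :: 'l cyc \<Rightarrow> _"]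
  by (simp only: range_cyc_eval)

end

lemma cyc_eval_add: "cyc_eval \<beta> (f + g) = cyc_eval \<beta> f + cyc_eval \<beta> g"
  by (simp add: cyc_eval_def cyc_rep_add poly_to_ac_add)

lemma cyc_eval_0 [simp]: "cyc_eval \<beta> 0 = 0"
  by (simp add: cyc_eval_def cyc_rep_0)

lemma cyc_eval_sum: "cyc_eval \<beta> (\<Sum>x\<in>S. f x) = (\<Sum>x\<in>S. cyc_eval \<beta> (f x))"
  by (induction S rule: infinite_finite_induct) (simp_all add: cyc_eval_add)

lemma cyc_eval_gen_field: "cyc_eval \<beta> f \<in> gen_field \<beta>"
  by (simp add: cyc_eval_def gen_field_def)

text \<open>The combinations of \<open>p\<close> and \<open>q\<close> form an ideal, and a nonzero
  element \<open>d\<close> of least degree in it divides both. Irreducibility makes \<open>d\<close>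
  a unit, since an associate of \<open>p\<close> cannot divide \<open>q\<close>.\<close>

lemma irreducible_bezout:
  fixes p q :: "'a::field poly"
  assumes p: "irreducible p" and q: "\<not> p dvd q"
  shows "\<exists>u v. u * p + v * q = 1"
proof -
  let ?S = "{u * p + v * q | u v. True}"
  have S: "r * x \<in> ?S" "x - y \<in> ?S" if xy: "x \<in> ?S" "y \<in> ?S" for r x y
  proof -
    obtain u v u' v' where eqs: "x = u * p + v * q" "y = u' * p + v' * q"
      using xy by auto
    have "r * x = (r * u) * p + (r * v) * q" "x - y = (u - u') * p + (v - v') * q"
      by (simp_all add: eqs algebra_simps)
    then show "r * x \<in> ?S" "x - y \<in> ?S" by blast+
  qed
  have "1 * p + 0 * q \<in> ?S" "0 * p + 1 * q \<in> ?S" by blast+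
  then have pq: "p \<in> ?S" "q \<in> ?S" by simp_all
  have "p \<noteq> 0" using p by (simp add: irreducible_def)
  with pq obtain d where d: "d \<in> ?S" "d \<noteq> 0"
    and min: "\<And>x. x \<in> ?S \<Longrightarrow> x \<noteq> 0 \<Longrightarrow> degree d \<le> degree x"
    using ex_has_least_nat[of "\<lambda>x. x \<in> ?S \<and> x \<noteq> 0" p degree] by blast
  have dvd: "d dvd x" if "x \<in> ?S" for x
  proof (rule ccontr)
    assume "\<not> d dvd x"
    then have "x mod d \<noteq> 0" "degree (x mod d) < degree d"
      using degree_mod_less[OF d(2), of x] by (auto simp: mod_eq_0_iff_dvd)
    moreover have "x mod d = x - (x div d) * d" by (simp add: minus_div_mult_eq_mod)
    then have "x mod d \<in> ?S" using S(2)[OF that S(1)[OF d(1) d(1), of "x div d"]] by (simp only:)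
    ultimately show False using min by fastforce
  qed
  obtain e where e: "p = d * e" using dvd[OF pq(1)] ..
  have "\<not> is_unit e"
  proof
    assume "is_unit e"
    then have "p dvd d" by (simp add: e)
    then show False using dvd[OF pq(2)] q dvd_trans by blast
  qed
  then have "is_unit d" using p e by (auto simp: irreducible_def)
  then obtain f where "1 = d * f" ..
  then have "1 \<in> ?S" using S(1)[OF d(1) d(1), of f] by (simp add: mult.commute)
  then show ?thesis by force
qed

section \<open>Splitting of the ring into its component fields\<close>

locale cyc_components =
  fixes t :: nat and b :: "nat \<Rightarrow> bit poly" and \<beta> :: "nat \<Rightarrow> bit alg_closure"
    and c :: "nat \<Rightarrow> ('l::finite) cyc"
  assumes factorization: "monom 1 CARD('l) + 1 = (\<Prod>i<t. b i)"
    and b_irreducible: "\<And>i. i < t \<Longrightarrow> irreducible (b i)"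
    and b_distinct: "inj_on b {..<t}"
    and root: "\<And>i. i < t \<Longrightarrow> poly (map_poly to_ac (b i)) (\<beta> i) = 0"
    and idempotent: "\<And>i. i < t \<Longrightarrow> c i * c i = c i"
    and idempotent_1: "\<And>i. i < t \<Longrightarrow> [cyc_rep (c i) = 1] (mod b i)"
    and idempotent_0: "\<And>i j. i < t \<Longrightarrow> j < t \<Longrightarrow> j \<noteq> i \<Longrightarrow> [cyc_rep (c i) = 0] (mod b j)"
begin

lemma bezout_if_not_dvd:
  assumes "i < t" "\<not> b i dvd p"
  obtains u v where "u * b i + v * p = 1"
  using irreducible_bezout[OF b_irreducible] assms by blast

text \<open>\<open>b i\<close> acts as the minimal polynomial of its root: if it did not divide
  \<open>p\<close>, a Bezout identity evaluated at the common root would read 0 = 1.\<close>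

lemma poly_root_eq_0_iff:
  assumes "i < t"
  shows "poly (map_poly to_ac p) (\<beta> i) = 0 \<longleftrightarrow> b i dvd p"
proof
  assume "b i dvd p"
  then show "poly (map_poly to_ac p) (\<beta> i) = 0"
    using root[OF assms] by (auto simp: poly_to_ac_mult elim!: dvdE)
next
  assume p: "poly (map_poly to_ac p) (\<beta> i) = 0"
  show "b i dvd p"
  proof (rule ccontr)
    assume "\<not> b i dvd p"
    with assms obtain u v where "u * b i + v * p = 1" by (rule bezout_if_not_dvd)
    then have "poly (map_poly to_ac (u * b i + v * p)) (\<beta> i) = 1" by simp
    then show False using p root[OF assms] by (simp add: poly_to_ac_add poly_to_ac_mult)
  qed
qed

text \<open>In a Bezout identity against \<open>b i\<close>, the cofactor of a polynomial
  representing \<open>y\<close> represents the inverse of \<open>y\<close>.\<close>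

lemma gen_field_inverse:
  assumes "i < t" and y: "y \<in> gen_field (\<beta> i)"
  shows "inverse y \<in> gen_field (\<beta> i)"
proof (cases "y = 0")
  case False
  obtain p where p: "y = poly (map_poly to_ac p) (\<beta> i)"
    using y by (auto simp: gen_field_def)
  with False assms(1) have "\<not> b i dvd p" by (auto simp: poly_root_eq_0_iff)
  with assms(1) obtain u v where "u * b i + v * p = 1" by (rule bezout_if_not_dvd)
  then have "poly (map_poly to_ac (u * b i + v * p)) (\<beta> i) = 1" by simp
  then have "poly (map_poly to_ac v) (\<beta> i) * y = 1"
    using p root[OF assms(1)] by (simp add: poly_to_ac_add poly_to_ac_mult)
  then have "inverse y = poly (map_poly to_ac v) (\<beta> i)"
    using inverse_unique[of y "poly (map_poly to_ac v) (\<beta> i)"] by (simp add: mult.commute)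
  then show ?thesis by (simp add: gen_field_def)
qed (simp add: gen_field_0)

lemma root_of_unity:
  assumes "i < t"
  shows "\<beta> i ^ CARD('l) = 1"
proof -
  have "b i dvd monom 1 CARD('l) + 1"
    using assms by (simp add: factorization dvd_prodI)
  then have "poly (map_poly to_ac (monom 1 CARD('l) + 1)) (\<beta> i) = 0"
    using assms by (simp only: poly_root_eq_0_iff)
  \<comment> \<open>Both sides are 0 in characteristic two, so cancelling the summand 1 gives the
    claim.\<close>
  then have "\<beta> i ^ CARD('l) + 1 = 1 + 1"
    by (simp add: poly_to_ac_add poly_to_ac_monom ac_add_self)
  then show ?thesis by (simp only: add_right_cancel)
qed

lemmas eval_mult = cyc_eval_mult[OF root_of_unity]
  and eval_1 = cyc_eval_1[OF root_of_unity]
  and eval_x = cyc_eval_x[OF root_of_unity]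
  and range_eval = range_cyc_eval[OF root_of_unity]
  and finite_component = finite_gen_field[OF root_of_unity]

text \<open>Over the two-element field 1 is the only nonzero constant, so associated irreducible
  factors are equal and distinctness already makes the factors coprime.\<close>

lemma b_not_dvd:
  assumes "i < t" "j < t" "i \<noteq> j"
  shows "\<not> b i dvd b j"
proof
  assume "b i dvd b j"
  then obtain u where u: "b j = b i * u" ..
  with assms b_irreducible have "is_unit u"
    by (metis irreducible_def)
  then obtain a where "u = [:a:]" "a \<noteq> 0" by (auto simp: is_unit_poly_iff dvd_field_iff)
  then have "b j = b i" using u by (cases a) (simp_all flip: one_pCons)
  with assms b_distinct show False by (auto dest: inj_onD)
qed

text \<open>A product of other factors does not vanish at \<open>\<beta> i\<close>, hence is coprime
  to \<open>b i\<close>, and divisibility by coprime factors combines through a Bezout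
  identity.\<close>

lemma prod_b_dvd:
  assumes "\<And>i. i < t \<Longrightarrow> b i dvd p"
  shows "(\<Prod>i<t. b i) dvd p"
proof -
  have "(\<Prod>i\<in>I. b i) dvd p" if "I \<subseteq> {..<t}" for I
    using finite_subset[OF that finite_lessThan] that
  proof (induction I rule: finite_induct)
    case (insert i I)
    let ?Q = "\<Prod>j\<in>I. b j"
    have "poly (map_poly to_ac ?Q) (\<beta> i) = (\<Prod>j\<in>I. poly (map_poly to_ac (b j)) (\<beta> i))"
      using insert.hyps(1) by (induction I rule: finite_induct) (simp_all add: poly_to_ac_mult)
    also have "\<dots> \<noteq> 0"
      using insert.hyps insert.prems b_not_dvd[of i] by (auto simp: poly_root_eq_0_iff)
    finally have "\<not> b i dvd ?Q" using insert.prems by (simp add: poly_root_eq_0_iff)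
    then obtain u v where uv: "u * b i + v * ?Q = 1"
      using insert.prems bezout_if_not_dvd[of i ?Q] by blast
    \<comment> \<open>Each summand contains one of the factors \<open>b i\<close> and
      \<open>?Q\<close> explicitly and the other one inside \<open>p\<close>.\<close>
    have "b i * ?Q dvd u * (b i * p) + v * (p * ?Q)"
      using insert assms by (intro dvd_add dvd_mult mult_dvd_mono) auto
    also have "u * (b i * p) + v * (p * ?Q) = (u * b i + v * ?Q) * p"
      by (simp add: algebra_simps)
    finally show ?case using insert.hyps by (simp add: uv)
  qed simp
  then show ?thesis by blast
qed

text \<open>The injectivity half of the Chinese remainder theorem. In characteristic two
  \<open>f + g\<close> is the difference, and vanishing at all roots makes its representative
  divisible by every \<open>b i\<close>, hence by the modulus.\<close>

lemma cyc_eqI: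
  fixes f g :: "'l cyc"
  assumes "\<And>i. i < t \<Longrightarrow> cyc_eval (\<beta> i) f = cyc_eval (\<beta> i) g"
  shows "f = g"
proof -
  have "b i dvd cyc_rep (f + g)" if "i < t" for i
    using assms[OF that] that
    by (simp add: cyc_eval_def cyc_rep_add poly_to_ac_add ac_add_self flip: poly_root_eq_0_iff)
  then have "(\<Prod>i<t. b i) dvd cyc_rep (f + g)"
    by (rule prod_b_dvd)
  then have "abs_cyc (cyc_rep (f + g)) = (0 :: 'l cyc)"
    unfolding factorization[symmetric] zero_cyc.abs_eq cyc.abs_eq_iff
    by (simp add: cyc_rel_def cyc_modulus_def)
  then have "f + g = g + g" by (simp only: abs_cyc_cyc_rep cyc_add_self)
  then show ?thesis by simp
qed

lemma eval_idempotent: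
  assumes "i < t" "j < t"
  shows "cyc_eval (\<beta> j) (c i) = (if i = j then 1 else 0)"
proof (cases "i = j")
  case True
  then have "b i dvd cyc_rep (c i) - 1"
    using idempotent_1[OF assms(1)] by (simp add: cong_iff_dvd_diff)
  then have "poly (map_poly to_ac (cyc_rep (c i) - 1)) (\<beta> i) = 0"
    using assms by (simp only: poly_root_eq_0_iff)
  moreover have "poly (map_poly to_ac (cyc_rep (c i) - 1 + 1)) (\<beta> i) = 
      poly (map_poly to_ac (cyc_rep (c i) - 1)) (\<beta> i) + poly (map_poly to_ac 1) (\<beta> i)"
    by (rule poly_to_ac_add)
  ultimately show ?thesis using True by (simp add: cyc_eval_def)
next
  case False
  then show ?thesis
    using idempotent_0[OF assms(1,2)] assms(2) by (simp add: cyc_eval_def poly_root_eq_0_iff cong_0_iff)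
qed

lemma idempotent_orthogonal: "i < t \<Longrightarrow> j < t \<Longrightarrow> i \<noteq> j \<Longrightarrow> c i * c j = 0"
  by (rule cyc_eqI) (simp add: eval_mult eval_idempotent)

text \<open>\<open>cyc_lift\<close> inverts evaluation only on the ideal \<open>c i R\<close>, so
  \<open>y\<close> must be attained there. Multiplying an arbitrary preimage by \<open>c i\<close>
  achieves this without changing its value at \<open>\<beta> i\<close>.\<close>

lemma
  assumes i: "i < t" and y: "y \<in> gen_field (\<beta> i)"
  shows idempotent_mult_lift: "c i * cyc_lift (c i) (\<beta> i) y = cyc_lift (c i) (\<beta> i) y"
    and eval_lift: "j < t \<Longrightarrow> cyc_eval (\<beta> j) (cyc_lift (c i) (\<beta> i) y) = (if j = i then y else 0)"
proof -
  obtain f :: "'l cyc" where "y = cyc_eval (\<beta> i) f"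
    using y unfolding range_eval[OF i, symmetric] by (rule imageE)
  then have "y = cyc_eval (\<beta> i) (c i * f)"
    using i by (simp add: eval_mult eval_idempotent)
  then have y: "y \<in> cyc_eval (\<beta> i) ` range ((*) (c i))" by (rule image_eqI) (rule rangeI)
  obtain g where g: "cyc_lift (c i) (\<beta> i) y = c i * g"
    using inv_into_into[OF y] by (auto simp: cyc_lift_def)
  show lift: "c i * cyc_lift (c i) (\<beta> i) y = cyc_lift (c i) (\<beta> i) y"
    using i by (simp add: g idempotent flip: mult.assoc)
  show "cyc_eval (\<beta> j) (cyc_lift (c i) (\<beta> i) y) = (if j = i then y else 0)" if "j < t"
  proof (cases "j = i")
    case True
    then show ?thesis using f_inv_into_f[OF y] unfolding cyc_lift_def by simp
  next
    case False
    then show ?thesis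
      using that i by (simp add: g eval_mult eval_idempotent)
  qed
qed

lemma lift_0: "i < t \<Longrightarrow> cyc_lift (c i) (\<beta> i) 0 = 0"
  by (rule cyc_eqI) (simp add: eval_lift gen_field_0)

end

section \<open>Information sets\<close>

lemma gen_field_sum: "(\<And>j. j \<in> I \<Longrightarrow> f j \<in> gen_field \<beta>) \<Longrightarrow> (\<Sum>j\<in>I. f j) \<in> gen_field \<beta>"
  by (induction I rule: infinite_finite_induct) (simp_all add: gen_field_0 gen_field_add)

context
  fixes \<beta> :: "bit alg_closure"
  assumes inverse_closed: "\<And>y. y \<in> gen_field \<beta> \<Longrightarrow> inverse y \<in> gen_field \<beta>"
begin

lemma ex1_unique: "\<exists>!x. P x \<Longrightarrow> P x \<Longrightarrow> P y \<Longrightarrow> x = y"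
  by blast

lemma field_gen_field: "field (class_ring\<lparr>carrier := gen_field \<beta>\<rparr>)" (is "field ?K")
proof (rule cring.cring_fieldI2)
  show "cring ?K"
  proof (rule cringI)
    show "abelian_group ?K"
    proof (rule abelian_groupI)
      fix y assume "y \<in> carrier ?K"
      then show "\<exists>z \<in> carrier ?K. z \<oplus>\<^bsub>?K\<^esub> y = \<zero>\<^bsub>?K\<^esub>"
        by (intro bexI[of _ "- y"]) (simp_all add: gen_field_uminus)
    qed (simp_all add: gen_field_0 gen_field_add)
    show "comm_monoid ?K"
      by (rule comm_monoidI) (simp_all add: gen_field_1 gen_field_mult)
  qed (simp add: distrib_right)
  show "\<exists>z \<in> carrier ?K. y \<otimes>\<^bsub>?K\<^esub> z = \<one>\<^bsub>?K\<^esub>" if "y \<in> carrier ?K" "y \<noteq> \<zero>\<^bsub>?K\<^esub>" for y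
    using that inverse_closed by (intro bexI[of _ "inverse y"]) simp_all
qed simp

lemma vectorspace_kernel_code:
  assumes M: "M \<in> carrier_mat m n"
  shows "vectorspace (class_ring\<lparr>carrier := gen_field \<beta>\<rparr>)
    (module_vec TYPE(bit alg_closure) n\<lparr>carrier := kernel_code \<beta> M\<rparr>)"
    (is "vectorspace ?K ?V")
proof -
  have V: "v \<in> kernel_code \<beta> M \<longleftrightarrow>
      v \<in> carrier_vec n \<and> M *\<^sub>v v = 0\<^sub>v m \<and> (\<forall>k<n. v $ k \<in> gen_field \<beta>)" for v
    using M by (auto simp: kernel_code_def mat_kernel_def vec_set_def image_subset_iff)
  interpret K: field ?K by (rule field_gen_field)
  have neg: "M *\<^sub>v (- v) = - (M *\<^sub>v v)" if "v \<in> carrier_vec n" for v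
    using that M by (intro eq_vecI) auto
  have scale: "M *\<^sub>v (a \<cdot>\<^sub>v v) = a \<cdot>\<^sub>v (M *\<^sub>v v)" if "v \<in> carrier_vec n" for a v
    using that M by (intro eq_vecI) auto
  have "abelian_group ?V"
  proof (rule abelian_groupI)
    fix u v w assume "u \<in> carrier ?V" "v \<in> carrier ?V" "w \<in> carrier ?V"
    then show "u \<oplus>\<^bsub>?V\<^esub> v \<oplus>\<^bsub>?V\<^esub> w = u \<oplus>\<^bsub>?V\<^esub> (v \<oplus>\<^bsub>?V\<^esub> w)"
      by (auto simp: module_vec_def V)
  next
    fix u v assume "u \<in> carrier ?V" "v \<in> carrier ?V"
    then show "u \<oplus>\<^bsub>?V\<^esub> v = v \<oplus>\<^bsub>?V\<^esub> u" "u \<oplus>\<^bsub>?V\<^esub> v \<in> carrier ?V"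
      using M by (auto simp: module_vec_def V comm_add_vec gen_field_add mult_add_distrib_mat_vec)
    show "\<exists>v\<in>carrier ?V. v \<oplus>\<^bsub>?V\<^esub> u = \<zero>\<^bsub>?V\<^esub>"
      using \<open>u \<in> carrier ?V\<close>
      by (intro bexI[of _ "- u"]) (auto simp: module_vec_def V neg gen_field_uminus)
  qed (use M in \<open>auto simp: module_vec_def V gen_field_0\<close>)
  then have "module ?K ?V"
    by (rule moduleI[OF K.is_cring])
      (auto simp: module_vec_def V gen_field_mult scale add_smult_distrib_vec smult_add_distrib_vec
        smult_smult_assoc)
  then show ?thesis by (intro vectorspace.intro field_gen_field)
qed

text \<open>Restriction to an information set is an injection between two sets of the same finite
  cardinality, hence onto.\<close>

lemma information_set_interpolation:
  assumes M: "M \<in> carrier_mat m n" and fin: "finite (gen_field \<beta>)"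
    and info: "information_set \<beta> n (kernel_code \<beta> M) I"
    and a: "\<And>k. k \<in> I \<Longrightarrow> a k \<in> gen_field \<beta>"
  shows "\<exists>v\<in>kernel_code \<beta> M. \<forall>k\<in>I. v $ k = a k"
proof -
  let ?K = "class_ring\<lparr>carrier := gen_field \<beta>\<rparr>"
  let ?V = "module_vec TYPE(bit alg_closure) n\<lparr>carrier := kernel_code \<beta> M\<rparr>"
  interpret V: vectorspace ?K ?V by (rule vectorspace_kernel_code[OF M])
  have I: "I \<subseteq> {..<n}" "finite I" "card I = V.dim" "inj_on (\<lambda>v. restrict (\<lambda>k. v $ k) I) (kernel_code \<beta> M)"
    using info by (auto simp: information_set_def code_dim_def intro: finite_subset)
  have code: "v \<in> carrier_vec n" "k < n \<Longrightarrow> v $ k \<in> gen_field \<beta>" if "v \<in> kernel_code \<beta> M" for v k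
    using that M by (auto simp: kernel_code_def mat_kernel_def vec_set_def image_subset_iff)
  have fin_V: "finite (kernel_code \<beta> M)"
  proof (rule finite_subset)
    show "kernel_code \<beta> M \<subseteq> vec_of_list ` {ys. set ys \<subseteq> gen_field \<beta> \<and> length ys = n}"
    proof
      fix v assume "v \<in> kernel_code \<beta> M"
      then show "v \<in> vec_of_list ` {ys. set ys \<subseteq> gen_field \<beta> \<and> length ys = n}"
        using code(1)[of v]
        by (intro image_eqI[of _ _ "list_of_vec v"]) (auto simp: vec_list kernel_code_def set_list_of_vec)
    qed
  qed (intro finite_imageI finite_lists_length_eq fin)
  have "V.fin_dim"
    unfolding V.fin_dim_def
  proof (intro exI conjI)
    show "V.gen_set (carrier ?V)"
      using V.in_own_span[of "carrier ?V"] V.span_is_subset2[of "carrier ?V"] by simp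
  qed (use fin_V in simp_all)
  then obtain Bs where Bs: "finite Bs" "V.basis Bs" using V.finite_basis_exists by blast
  then have card: "card Bs = card I" using V.dim_basis I by simp
  have "Bs \<subseteq> carrier ?V" using Bs(2) unfolding V.basis_def by blast
  then have uniq: "\<exists>!a. a \<in> Bs \<rightarrow>\<^sub>E carrier ?K \<and> V.lincomb a Bs = v" if "v \<in> carrier ?V" for v
    using Bs V.basis_criterion[OF Bs(1)] that by blast
  have closed: "V.lincomb a Bs \<in> carrier ?V" if "a \<in> Bs \<rightarrow>\<^sub>E carrier ?K" for a
    using \<open>Bs \<subseteq> carrier ?V\<close> that by (intro V.lincomb_closed) (auto simp: PiE_def)
  \<comment> \<open>Coordinates with respect to a basis identify the code with tuples of field
    elements, which converts the dimension in \<open>code_dim\<close> into a number of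
    codewords.\<close>
  have "bij_betw (\<lambda>a. V.lincomb a Bs) (Bs \<rightarrow>\<^sub>E carrier ?K) (carrier ?V)"
    unfolding bij_betw_def
  proof
    show "inj_on (\<lambda>a. V.lincomb a Bs) (Bs \<rightarrow>\<^sub>E carrier ?K)"
    proof (rule inj_onI)
      fix a a' assume a: "a \<in> Bs \<rightarrow>\<^sub>E carrier ?K" "a' \<in> Bs \<rightarrow>\<^sub>E carrier ?K"
        and "V.lincomb a Bs = V.lincomb a' Bs"
      then show "a = a'" by (intro ex1_unique[OF uniq[OF closed[OF a(2)]]] conjI) simp_all
    qed
    show "(\<lambda>a. V.lincomb a Bs) ` (Bs \<rightarrow>\<^sub>E carrier ?K) = carrier ?V"
    proof
      show "(\<lambda>a. V.lincomb a Bs) ` (Bs \<rightarrow>\<^sub>E carrier ?K) \<subseteq> carrier ?V"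
        by (intro image_subsetI closed)
      show "carrier ?V \<subseteq> (\<lambda>a. V.lincomb a Bs) ` (Bs \<rightarrow>\<^sub>E carrier ?K)"
      proof
        fix v assume "v \<in> carrier ?V"
        then obtain a where "a \<in> Bs \<rightarrow>\<^sub>E carrier ?K" "V.lincomb a Bs = v"
          using uniq by blast
        then show "v \<in> (\<lambda>a. V.lincomb a Bs) ` (Bs \<rightarrow>\<^sub>E carrier ?K)"
          by (intro image_eqI[of _ _ a]) simp_all
      qed
    qed
  qed
  then have "card (kernel_code \<beta> M) = card (Bs \<rightarrow>\<^sub>E gen_field \<beta>)"
    by (auto dest: bij_betw_same_card)
  also have "\<dots> = card (I \<rightarrow>\<^sub>E gen_field \<beta>)"
    using Bs(1) I(2) card by (simp add: card_PiE)
  finally have "card (kernel_code \<beta> M) = card (I \<rightarrow>\<^sub>E gen_field \<beta>)" .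
  moreover have "(\<lambda>v. restrict (\<lambda>k. v $ k) I) ` kernel_code \<beta> M \<subseteq> I \<rightarrow>\<^sub>E gen_field \<beta>"
    using code I(1) by auto
  ultimately have "(\<lambda>v. restrict (\<lambda>k. v $ k) I) ` kernel_code \<beta> M = I \<rightarrow>\<^sub>E gen_field \<beta>"
    using I by (intro card_subset_eq) (auto simp: card_image fin intro: finite_PiE)
  moreover have "restrict a I \<in> I \<rightarrow>\<^sub>E gen_field \<beta>" using a by simp
  ultimately have "restrict a I \<in> (\<lambda>v. restrict (\<lambda>k. v $ k) I) ` kernel_code \<beta> M" by simp
  then obtain v where v: "v \<in> kernel_code \<beta> M" "restrict a I = restrict (\<lambda>k. v $ k) I"
    by (rule imageE)
  have "v $ k = a k" if "k \<in> I" for k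
    using fun_cong[OF v(2), of k] that by simp
  with v(1) show ?thesis by blast
qed

text \<open>Interpolation gives existence and injectivity on the information set gives uniqueness,
  so the \<open>THE\<close> in \<open>systematic_row\<close> is well defined.\<close>

lemma
  assumes M: "M \<in> carrier_mat m n" and fin: "finite (gen_field \<beta>)"
    and info: "information_set \<beta> n (kernel_code \<beta> M) I"
  shows systematic_row_in_code: "systematic_row (kernel_code \<beta> M) I j \<in> kernel_code \<beta> M"
    and systematic_row_index: "k \<in> I \<Longrightarrow> systematic_row (kernel_code \<beta> M) I j $ k = (if k = j then 1 else 0)"
proof -
  let ?P = "\<lambda>g. g \<in> kernel_code \<beta> M \<and> (\<forall>k\<in>I. g $ k = (if k = j then 1 else 0))"
  have inj: "inj_on (\<lambda>v. restrict (\<lambda>k. v $ k) I) (kernel_code \<beta> M)"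
    using info by (simp add: information_set_def)
  have "\<exists>v\<in>kernel_code \<beta> M. \<forall>k\<in>I. v $ k = (if k = j then 1 else 0)"
    by (rule information_set_interpolation[OF M fin info]) (simp add: gen_field_0 gen_field_1)
  then have "\<exists>g. ?P g" by blast
  moreover have "g = g'" if "?P g" "?P g'" for g g'
    using that by (intro inj_onD[OF inj]) (auto simp: restrict_def)
  ultimately have "?P (systematic_row (kernel_code \<beta> M) I j)"
    unfolding systematic_row_def by (rule theI'[OF ex_ex1I])
  then show "systematic_row (kernel_code \<beta> M) I j \<in> kernel_code \<beta> M"
    and "k \<in> I \<Longrightarrow> systematic_row (kernel_code \<beta> M) I j $ k = (if k = j then 1 else 0)" by auto
qed

text \<open>The combination on the right is again a codeword and agrees with \<open>v\<close> on
  \<open>I\<close>, where restriction is injective.\<close>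

lemma systematic_expansion:
  assumes M: "M \<in> carrier_mat m n" and fin: "finite (gen_field \<beta>)"
    and info: "information_set \<beta> n (kernel_code \<beta> M) I"
    and v: "v \<in> kernel_code \<beta> M" and r: "r < n"
  shows "v $ r = (\<Sum>j\<in>I. v $ j * systematic_row (kernel_code \<beta> M) I j $ r)"
proof -
  let ?g = "systematic_row (kernel_code \<beta> M) I"
  have I: "I \<subseteq> {..<n}" "finite I" "inj_on (\<lambda>v. restrict (\<lambda>k. v $ k) I) (kernel_code \<beta> M)"
    using info by (auto simp: information_set_def intro: finite_subset)
  have V: "v \<in> kernel_code \<beta> M \<longleftrightarrow> v \<in> carrier_vec n \<and>
      (\<forall>s<m. (\<Sum>k<n. M $$ (s, k) * v $ k) = 0) \<and> (\<forall>k<n. v $ k \<in> gen_field \<beta>)" for v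
    using M by (auto simp: kernel_code_def mat_kernel_def vec_set_def image_subset_iff vec_eq_iff
        scalar_prod_def atLeast0LessThan)
  note g = systematic_row_in_code[OF M fin info] systematic_row_index[OF M fin info]
  define w where "w = vec n (\<lambda>r. \<Sum>j\<in>I. v $ j * ?g j $ r)"
  have "w \<in> kernel_code \<beta> M"
    unfolding V
  proof (intro conjI allI impI)
    show "w \<in> carrier_vec n" by (simp add: w_def)
    show "w $ k \<in> gen_field \<beta>" if "k < n" for k
    proof -
      have "v $ j * ?g j $ k \<in> gen_field \<beta>" if "j \<in> I" for j
        using v g(1)[of j] that \<open>k < n\<close> I(1) by (auto simp: V intro!: gen_field_mult)
      then have "(\<Sum>j\<in>I. v $ j * ?g j $ k) \<in> gen_field \<beta>"
        by (intro gen_field_sum)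
      then show ?thesis using that by (simp add: w_def)
    qed
    fix s assume "s < m"
    have "(\<Sum>k<n. M $$ (s, k) * w $ k) = (\<Sum>k<n. \<Sum>j\<in>I. v $ j * (M $$ (s, k) * ?g j $ k))"
      by (simp add: w_def sum_distrib_left mult_ac)
    also have "\<dots> = (\<Sum>j\<in>I. v $ j * (\<Sum>k<n. M $$ (s, k) * ?g j $ k))"
      by (subst sum.swap) (simp add: sum_distrib_left)
    also have "\<dots> = 0" using g(1) \<open>s < m\<close> by (simp add: V)
    finally show "(\<Sum>k<n. M $$ (s, k) * w $ k) = 0" .
  qed
  moreover have "w $ k = v $ k" if "k \<in> I" for k
  proof -
    have "(\<Sum>j\<in>I. v $ j * ?g j $ k) = (\<Sum>j\<in>I. if k = j then v $ j else 0)"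
      using that by (intro sum.cong) (auto simp: g(2))
    then show ?thesis using that I by (auto simp: w_def)
  qed
  ultimately have "w = v"
    using v by (intro inj_onD[OF I(3)]) (auto simp: restrict_def)
  then have "v $ r = w $ r" by simp
  then show ?thesis using r by (simp add: w_def)
qed

end

section \<open>Double annihilators\<close>

text \<open>The powers \<open>x^k\<close> with \<open>k < l\<close> and their conjugates are dual
  bases for the Frobenius form, so \<open>w\<close> is the sum of the \<open>x^(-k)\<close> for
  which \<open>\<psi>\<close> is 1 at \<open>x^k\<close>.\<close>

lemma cyc_functional_representation:
  fixes \<psi> :: "('l::finite) cyc \<Rightarrow> bit"
  assumes add: "\<And>f g. \<psi> (f + g) = \<psi> f + \<psi> g"
  obtains w where "\<And>f. cyc_coeff (f * w) 0 = \<psi> f"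
proof
  let ?w = "\<Sum>k<CARD('l). if \<psi> (cyc_x ^ k) = 1 then cyc_conj (cyc_x ^ k) else 0 :: 'l cyc"
  have "\<psi> 0 + \<psi> 0 = \<psi> 0" using add[of 0 0] by simp
  then have zero: "\<psi> 0 = 0" by (simp only: add_cancel_left_left)
  show "cyc_coeff (f * ?w) 0 = \<psi> f" for f
  proof (induction f rule: cyc_additive_induct)
    case (power j)
    let ?j = "j mod CARD('l)"
    have j: "?j < CARD('l)" by simp
    have "cyc_coeff (cyc_x ^ ?j * ?w) 0 =
        (\<Sum>k<CARD('l). if \<psi> (cyc_x ^ k) = 1 then cyc_coeff (cyc_x ^ ?j * cyc_conj (cyc_x ^ k) :: 'l cyc) 0 else 0)"
      unfolding sum_distrib_left cyc_coeff_sum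
      by (intro sum.cong refl) (simp add: cyc_coeff_0)
    also have "\<dots> = (\<Sum>k<CARD('l). if k = ?j then \<psi> (cyc_x ^ k) else 0)"
    proof (intro sum.cong refl)
      fix k assume "k \<in> {..<CARD('l)}"
      then show "(if \<psi> (cyc_x ^ k) = 1 then cyc_coeff (cyc_x ^ ?j * cyc_conj (cyc_x ^ k) :: 'l cyc) 0 else 0) =
          (if k = ?j then \<psi> (cyc_x ^ k) else 0)"
        by (cases "\<psi> (cyc_x ^ k)") (auto simp: cyc_coeff_mult_conj_x_power cyc_coeff_x_power)
    qed
    also have "\<dots> = \<psi> (cyc_x ^ ?j)" using j by simp
    finally show ?case by (simp only: cyc_x_power_mod[of j])
  qed (simp_all add: zero add cyc_coeff_0 cyc_coeff_add distrib_right)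
qed

text \<open>Entry \<open>r\<close> of \<open>w\<close> represents the functional restricted to
  multiples of the unit vector \<open>r\<close>.\<close>

lemma cyc_vec_functional_representation:
  fixes \<phi> :: "('l::finite) cyc vec \<Rightarrow> bit"
  assumes add: "\<And>u v. u \<in> carrier_vec m \<Longrightarrow> v \<in> carrier_vec m \<Longrightarrow> \<phi> (u + v) = \<phi> u + \<phi> v"
  obtains w where "w \<in> carrier_vec m" "\<And>u. u \<in> carrier_vec m \<Longrightarrow> cyc_coeff (u \<bullet> w) 0 = \<phi> u"
proof -
  have "\<exists>w. \<forall>f. cyc_coeff (f * w) 0 = \<phi> (f \<cdot>\<^sub>v unit_vec m r)" for r
  proof -
    have "\<phi> ((f + g) \<cdot>\<^sub>v unit_vec m r) = \<phi> (f \<cdot>\<^sub>v unit_vec m r) + \<phi> (g \<cdot>\<^sub>v unit_vec m r)" for f g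
      by (simp add: add_smult_distrib_vec add)
    then show ?thesis
      using cyc_functional_representation[of "\<lambda>f. \<phi> (f \<cdot>\<^sub>v unit_vec m r)"] by metis
  qed
  then obtain w where w: "\<And>r f. cyc_coeff (f * w r) 0 = \<phi> (f \<cdot>\<^sub>v unit_vec m r)" by metis
  have "cyc_coeff (u \<bullet> vec m w) 0 = \<phi> u" if u: "u \<in> carrier_vec m" for u
  proof -
    have "\<phi> (0\<^sub>v m) + \<phi> (0\<^sub>v m) = \<phi> (0\<^sub>v m)" using add[of "0\<^sub>v m" "0\<^sub>v m"] by simp
    then have zero: "\<phi> (0\<^sub>v m) = 0" by (simp only: add_cancel_left_left)
    \<comment> \<open>Induction over the truncations of \<open>u\<close> to its first
      \<open>k\<close> entries takes the place of expanding \<open>u\<close> into unit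
      vectors.\<close>
    have "\<phi> (vec m (\<lambda>r. if r < k then u $ r else 0)) = (\<Sum>r<k. cyc_coeff (u $ r * w r) 0)"
      if "k \<le> m" for k
      using that
    proof (induction k)
      case 0
      have "vec m (\<lambda>r. if r < 0 then u $ r else 0) = 0\<^sub>v m" by (intro eq_vecI) auto
      then show ?case by (simp only: zero lessThan_0 sum.empty)
    next
      case (Suc k)
      have "vec m (\<lambda>r. if r < Suc k then u $ r else 0) =
          vec m (\<lambda>r. if r < k then u $ r else 0) + u $ k \<cdot>\<^sub>v unit_vec m k"
        using Suc.prems by (intro eq_vecI) (auto simp: less_Suc_eq)
      then show ?case using Suc by (simp add: add w)
    qed
    from this[of m] have "\<phi> (vec m (\<lambda>r. if r < m then u $ r else 0)) = cyc_coeff (u \<bullet> vec m w) 0"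
      by (simp add: scalar_prod_def atLeast0LessThan cyc_coeff_sum)
    moreover have "vec m (\<lambda>r. if r < m then u $ r else 0) = u"
      using u by (intro eq_vecI) auto
    ultimately show ?thesis by simp
  qed
  then show thesis using that[of "vec m w"] by simp
qed

lemma mult_mat_vec_index:
  assumes "C \<in> carrier_mat m n" "v \<in> carrier_vec n" "s < m"
  shows "(C *\<^sub>v v) $ s = (\<Sum>r<n. C $$ (s, r) * v $ r)"
  using assms by (auto simp: scalar_prod_def atLeast0LessThan)

lemma vec_cyc_add_self: "u + u = 0\<^sub>v m" if "u \<in> carrier_vec m" for u :: "('l::finite) cyc vec"
  using that by (intro eq_vecI) (auto simp: cyc_add_self)

lemma vec_cyc_cancel:
  assumes "u \<in> carrier_vec m" "v \<in> carrier_vec m"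
  shows "u + (u + v) = (v :: ('l::finite) cyc vec)"
  using assms by (simp add: vec_cyc_add_self flip: assoc_add_vec)

text \<open>An additive subgroup that is maximal among those avoiding \<open>y\<close> has index two, so it is the
  kernel of an additive functional.\<close>

lemma separating_functional:
  fixes N :: "('l::finite) cyc vec set"
  assumes N: "N \<subseteq> carrier_vec m" "0\<^sub>v m \<in> N" "\<And>u v. u \<in> N \<Longrightarrow> v \<in> N \<Longrightarrow> u + v \<in> N"
    and y: "y \<in> carrier_vec m" "y \<notin> N"
  obtains w where "w \<in> carrier_vec m" "\<And>u. u \<in> N \<Longrightarrow> cyc_coeff (u \<bullet> w) 0 = 0" "cyc_coeff (y \<bullet> w) 0 = 1"
proof -
  define P where "P = {S. N \<subseteq> S \<and> S \<subseteq> carrier_vec m \<and> y \<notin> S \<and> (\<forall>u\<in>S. \<forall>v\<in>S. u + v \<in> S)}"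
  have "finite P"
    unfolding P_def
    by (rule finite_subset[of _ "Pow (carrier_vec m)"]) (auto simp: finite_carrier_vec_cyc)
  moreover have "N \<in> P" using N y by (auto simp: P_def)
  ultimately obtain S where "S \<in> P" and max: "\<And>S'. S' \<in> P \<Longrightarrow> S \<subseteq> S' \<Longrightarrow> S = S'"
    using finite_has_maximal2[of P N] by metis
  then have S: "N \<subseteq> S" "S \<subseteq> carrier_vec m" "y \<notin> S" "\<forall>u\<in>S. \<forall>v\<in>S. u + v \<in> S"
    by (auto simp: P_def)
  have carrier: "u \<in> carrier_vec m" if "u \<in> S" for u using S that by blast
  have closed: "u + v \<in> S" if "u \<in> S" "v \<in> S" for u v using S that by blast
  have 0: "0\<^sub>v m \<in> S" using S N by blast
  have y_S: "y + x \<in> S" if x: "x \<in> carrier_vec m" "x \<notin> S" for x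
  proof -
    \<comment> \<open>Two cosets make up the subgroup generated by \<open>S\<close> and
      \<open>x\<close>, because \<open>x + x\<close> is zero. It is strictly larger than
      \<open>S\<close>, so by maximality it contains \<open>y\<close>.\<close>
    let ?S = "S \<union> (\<lambda>s. x + s) ` S"
    have "u + v \<in> ?S" if uv: "u \<in> ?S" "v \<in> ?S" for u v
    proof -
      have 1: "(x + s) + s' = x + (s + s')" "s + (x + s') = x + (s + s')"
        "(x + s) + (x + s') = s + s'" if "s \<in> S" "s' \<in> S" for s s'
      proof -
        note [simp] = x(1) carrier[OF that(1)] carrier[OF that(2)]
        show "(x + s) + s' = x + (s + s')" by (simp add: assoc_add_vec[of _ m])
        show 2: "s + (x + s') = x + (s + s')"
          by (metis \<open>(x + s) + s' = x + (s + s')\<close> assoc_add_vec carrier comm_add_vec that x(1))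
        have "(x + s) + (x + s') = x + (s + (x + s'))" by (simp add: assoc_add_vec[of _ m])
        also have "\<dots> = s + s'" by (simp add: 2 vec_cyc_cancel[of _ m])
        finally show "(x + s) + (x + s') = s + s'" .
      qed
      show ?thesis using uv by (auto simp: 1 closed)
    qed
    moreover have "N \<subseteq> ?S" "?S \<subseteq> carrier_vec m" using S x carrier by auto
    moreover have "x + 0\<^sub>v m \<in> ?S" using 0 by blast
    then have "S \<noteq> ?S" using x by auto
    then have "?S \<notin> P" using max[of ?S] by blast
    ultimately have "y \<in> ?S" by (auto simp only: P_def mem_Collect_eq)
    then obtain s where "s \<in> S" "y = x + s" using S by blast
    then show ?thesis
      using x carrier by (simp add: comm_add_vec[of s m x] vec_cyc_cancel[of _ m])
  qed
  \<comment> \<open>The indicator of the complement of \<open>S\<close> is additive: two vectors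
    outside \<open>S\<close> both become elements of \<open>S\<close> after adding \<open>y\<close>,
    so their sum lies in \<open>S\<close>.\<close>
  have "(if u + v \<in> S then 0 else 1) = (if u \<in> S then 0 else 1) + (if v \<in> S then 0 else 1 :: bit)"
    if uv: "u \<in> carrier_vec m" "v \<in> carrier_vec m" for u v
  proof -
    have 1: "(u + v \<in> S) = (v \<in> S)" if "u \<in> S"
      using closed[OF that, of v] closed[OF that, of "u + v"] uv by (auto simp: vec_cyc_cancel)
    have 2: "(u + v \<in> S) = (u \<in> S)" if "v \<in> S"
      using closed[OF that, of u] closed[OF that, of "v + u"] uv
      by (auto simp: vec_cyc_cancel comm_add_vec[of u m v])
    have 3: "u + v \<in> S" if "u \<notin> S" "v \<notin> S"
    proof -
      have "(u + y) + (y + v) \<in> S"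
        using closed[OF y_S y_S] uv that y(1) by (simp add: comm_add_vec[of u m y])
      moreover have "(u + y) + (y + v) = u + v"
        using uv y(1) by (simp add: assoc_add_vec[of _ m] vec_cyc_cancel)
      ultimately show ?thesis by simp
    qed
    show ?thesis using 1 2 3 by auto
  qed
  then obtain w where "w \<in> carrier_vec m"
    and w: "\<And>u. u \<in> carrier_vec m \<Longrightarrow> cyc_coeff (u \<bullet> w) 0 = (if u \<in> S then 0 else 1)"
    using cyc_vec_functional_representation[of m "\<lambda>u. if u \<in> S then 0 else 1"] by blast
  then show thesis
    using that[of w] S N y by (auto simp: subset_iff)
qed

text \<open>If \<open>y\<close> were outside the image, some \<open>v\<close> would have constant
  coefficient 0 against the image and 1 against \<open>y\<close>. The image is stable under scalars
  from \<open>R\<close>, so nondegeneracy puts \<open>v\<close> into the kernel of the transpose,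
  contradicting \<open>ann\<close>.\<close>

lemma double_annihilator:
  fixes C :: "('l::finite) cyc mat"
  assumes C: "C \<in> carrier_mat m n" and y: "y \<in> carrier_vec m"
    and ann: "\<And>v. v \<in> carrier_vec m \<Longrightarrow> transpose_mat C *\<^sub>v v = 0\<^sub>v n \<Longrightarrow> y \<bullet> v = 0"
  shows "\<exists>w\<in>carrier_vec n. C *\<^sub>v w = y"
proof (rule ccontr)
  let ?N = "(\<lambda>w. C *\<^sub>v w) ` carrier_vec n"
  assume "\<not> ?thesis"
  then have "y \<notin> ?N" by blast
  moreover have "?N \<subseteq> carrier_vec m" using C by auto
  moreover have "0\<^sub>v m \<in> ?N" using C by (intro image_eqI[of _ _ "0\<^sub>v n"]) auto
  moreover have "u + v \<in> ?N" if "u \<in> ?N" "v \<in> ?N" for u v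
  proof -
    obtain u' v' where "u' \<in> carrier_vec n" "v' \<in> carrier_vec n" "u = C *\<^sub>v u'" "v = C *\<^sub>v v'"
      using \<open>u \<in> ?N\<close> \<open>v \<in> ?N\<close> by blast
    then show ?thesis
      using C by (intro image_eqI[of _ _ "u' + v'"]) (auto simp: mult_add_distrib_mat_vec)
  qed
  ultimately obtain v where v: "v \<in> carrier_vec m"
    and N: "\<And>u. u \<in> ?N \<Longrightarrow> cyc_coeff (u \<bullet> v) 0 = 0" and yv: "cyc_coeff (y \<bullet> v) 0 = 1"
    using y by (elim separating_functional[of ?N m y, rotated -1]) assumption+
  have "transpose_mat C *\<^sub>v v = 0\<^sub>v n"
  proof (rule eq_vecI)
    fix s assume "s < dim_vec (0\<^sub>v n :: 'l cyc vec)"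
    then have s: "s < n" by simp
    \<comment> \<open>Each scaled unit vector yields one bit of information; letting the scalar
      \<open>f\<close> vary determines the entry as an element of \<open>R\<close>.\<close>
    have "cyc_coeff ((transpose_mat C *\<^sub>v v) $ s * f) 0 = 0" for f
    proof -
      have "(C *\<^sub>v (f \<cdot>\<^sub>v unit_vec n s)) \<bullet> v = v \<bullet> (C *\<^sub>v (f \<cdot>\<^sub>v unit_vec n s))"
        using C v by (intro comm_scalar_prod[of _ m]) auto
      also have "\<dots> = (transpose_mat C *\<^sub>v v) \<bullet> (f \<cdot>\<^sub>v unit_vec n s)"
        using C v by (intro transpose_vec_mult_scalar[symmetric]) auto
      also have "\<dots> = (transpose_mat C *\<^sub>v v) $ s * f"
        using C s v scalar_prod_right_unit[of s n "transpose_mat C *\<^sub>v v"]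
        by (simp add: mult.commute del: scalar_prod_right_unit)
      finally show ?thesis using N[of "C *\<^sub>v (f \<cdot>\<^sub>v unit_vec n s)"] by simp
    qed
    then show "(transpose_mat C *\<^sub>v v) $ s = 0\<^sub>v n $ s"
      using s cyc_eq_0I[of "(transpose_mat C *\<^sub>v v) $ s"] by simp
  qed (use C in simp)
  with v have "y \<bullet> v = 0" by (rule ann)
  with yv show False by (simp add: cyc_coeff_0)
qed

lemma mat_cyc_add_self: "M + M = 0\<^sub>m m n" if "M \<in> carrier_mat m n" for M :: "('l::finite) cyc mat"
  using that by (intro eq_matI) (auto simp: cyc_add_self)

lemma mat_solve_cols:
  fixes C :: "'a::comm_ring_1 mat"
  assumes C: "C \<in> carrier_mat m n" and Y: "Y \<in> carrier_mat m k"
    and solve: "\<And>j. j < k \<Longrightarrow> \<exists>w\<in>carrier_vec n. C *\<^sub>v w = col Y j"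
  obtains Z where "Z \<in> carrier_mat n k" "C * Z = Y"
proof -
  obtain w where w: "\<And>j. j < k \<Longrightarrow> w j \<in> carrier_vec n" "\<And>j. j < k \<Longrightarrow> C *\<^sub>v w j = col Y j"
    using solve by metis
  let ?Z = "mat n k (\<lambda>(i, j). w j $ i)"
  have "C * ?Z = Y"
  proof (rule eq_matI)
    fix i j assume "i < dim_row Y" "j < dim_col Y"
    then have i: "i < m" and j: "j < k" using Y by auto
    have "col ?Z j = w j" using w(1)[OF j] j by (intro eq_vecI) auto
    then have "(C * ?Z) $$ (i, j) = (C *\<^sub>v w j) $ i" using i j C by simp
    then show "(C * ?Z) $$ (i, j) = Y $$ (i, j)" using w(2)[OF j] i j Y by simp
  qed (use C Y in auto)
  then show thesis using that[of ?Z] by simp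
qed

text \<open>Applied to \<open>v\<close>, this matrix sums \<open>v $ s \<cdot>\<^sub>v a i s\<close>
  over all \<open>i\<close> and \<open>s \<in> I i\<close>. A position may belong to several
  \<open>I i\<close>, hence the sum in each column. The family \<open>a\<close> is kept abstract so
  that conjugated vectors can be inserted later.\<close>

definition select_cols ::
  "nat \<Rightarrow> nat \<Rightarrow> (nat \<Rightarrow> nat \<Rightarrow> 'a::comm_monoid_add vec) \<Rightarrow> (nat \<Rightarrow> nat set) \<Rightarrow> 'a mat" where
  "select_cols t n a I = mat n n (\<lambda>(r, s). \<Sum>i<t. if s \<in> I i then a i s $ r else 0)"

section \<open>Contraction of a matrix onto its kernel and cokernel\<close>

context cyc_components
begin

context
  fixes C :: "'l cyc mat" and m n :: nat and I :: "nat \<Rightarrow> nat set"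
  assumes C: "C \<in> carrier_mat m n"
    and info: "\<And>i. i < t \<Longrightarrow>
      information_set (\<beta> i) n (kernel_code (\<beta> i) (map_mat (cyc_eval (\<beta> i)) C)) (I i)"
begin

lemma information_subset: "i < t \<Longrightarrow> I i \<subseteq> {..<n}"
  using info by (simp add: information_set_def)

lemma information_finite: "i < t \<Longrightarrow> finite (I i)"
  using information_subset finite_subset by blast

private abbreviation (input) "C' i \<equiv> map_mat (cyc_eval (\<beta> i)) C"
private abbreviation (input) "g i \<equiv> systematic_row (kernel_code (\<beta> i) (C' i)) (I i)"

private lemma C': "C' i \<in> carrier_mat m n"
  using C by simp

private lemmas g_code = systematic_row_in_code[OF gen_field_inverse C' finite_component info]
  and g_index = systematic_row_index[OF gen_field_inverse C' finite_component info]
  and g_expansion = systematic_expansion[OF gen_field_inverse C' finite_component info]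

private lemma code_iff:
  "v \<in> kernel_code (\<beta> i) (C' i) \<longleftrightarrow> v \<in> carrier_vec n \<and>
    (\<forall>s<m. (\<Sum>r<n. cyc_eval (\<beta> i) (C $$ (s, r)) * v $ r) = 0) \<and> (\<forall>r<n. v $ r \<in> gen_field (\<beta> i))"
  for v :: "bit alg_closure vec"
  using C by (auto simp: kernel_code_def mat_kernel_def vec_set_def image_subset_iff vec_eq_iff
      scalar_prod_def atLeast0LessThan)

lemma zeta_carrier: "i < t \<Longrightarrow> zeta (c i) (\<beta> i) C (I i) j \<in> carrier_vec n"
  using g_code[of i j] by (simp add: zeta_def code_iff)

lemma eval_zeta:
  assumes "i < t" "k < t" "r < n"
  shows "cyc_eval (\<beta> k) (zeta (c i) (\<beta> i) C (I i) j $ r) = (if k = i then g i j $ r else 0)"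
  using g_code[of i j] assms by (auto simp: zeta_def code_iff eval_lift)

lemma idempotent_mult_zeta:
  assumes "i < t" "r < n"
  shows "c i * zeta (c i) (\<beta> i) C (I i) j $ r = zeta (c i) (\<beta> i) C (I i) j $ r"
  using g_code[of i j] assms by (auto simp: zeta_def code_iff idempotent_mult_lift)

text \<open>The identity block of the systematic basis lifts to \<open>c i\<close> rather than 1,
  since \<open>zeta\<close> vanishes at all other roots. These entries are what the pairing of two
  logical operators sees.\<close>

lemma zeta_index:
  assumes "i < t" "r \<in> I i"
  shows "zeta (c i) (\<beta> i) C (I i) j $ r = (if r = j then c i else 0)"
proof (rule cyc_eqI)
  fix k assume "k < t"
  then show "cyc_eval (\<beta> k) (zeta (c i) (\<beta> i) C (I i) j $ r) = cyc_eval (\<beta> k) (if r = j then c i else 0)"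
    using assms information_subset[OF assms(1)]
    by (auto simp: eval_zeta g_index eval_idempotent)
qed

text \<open>At \<open>\<beta> i\<close> this is the parity check of the systematic row; at every
  other root the vector itself vanishes.\<close>

lemma mult_zeta:
  assumes "i < t"
  shows "C *\<^sub>v zeta (c i) (\<beta> i) C (I i) j = 0\<^sub>v m"
proof (rule eq_vecI)
  fix s assume "s < dim_vec (0\<^sub>v m :: 'l cyc vec)"
  then have s: "s < m" by simp
  have "(\<Sum>r<n. C $$ (s, r) * zeta (c i) (\<beta> i) C (I i) j $ r) = 0"
  proof (rule cyc_eqI)
    fix k assume k: "k < t"
    have "cyc_eval (\<beta> k) (\<Sum>r<n. C $$ (s, r) * zeta (c i) (\<beta> i) C (I i) j $ r) =
        (\<Sum>r<n. cyc_eval (\<beta> k) (C $$ (s, r)) * (if k = i then g i j $ r else 0))"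
      using assms k by (simp add: cyc_eval_sum eval_mult eval_zeta)
    also have "\<dots> = 0" using g_code[of i j] assms s by (cases "k = i") (simp_all add: code_iff)
    finally show "cyc_eval (\<beta> k) (\<Sum>r<n. C $$ (s, r) * zeta (c i) (\<beta> i) C (I i) j $ r) = cyc_eval (\<beta> k) (0 :: 'l cyc)"
      by simp
  qed
  then show "(C *\<^sub>v zeta (c i) (\<beta> i) C (I i) j) $ s = 0\<^sub>v m $ s"
    using s by (simp only: mult_mat_vec_index[OF C zeta_carrier[OF assms] s] index_zero_vec)
qed (use C in simp)

text \<open>At \<open>\<beta> k\<close> only the summand \<open>i = k\<close> survives, and there
  the identity is the systematic expansion of the evaluated vector.\<close>

lemma kernel_expansion:
  assumes v: "v \<in> carrier_vec n" "C *\<^sub>v v = 0\<^sub>v m" and r: "r < n"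
  shows "v $ r = (\<Sum>i<t. \<Sum>j\<in>I i. v $ j * zeta (c i) (\<beta> i) C (I i) j $ r)"
proof (rule cyc_eqI)
  fix k assume k: "k < t"
  have "map_vec (cyc_eval (\<beta> k)) v \<in> kernel_code (\<beta> k) (C' k)"
    unfolding code_iff
  proof (intro conjI allI impI)
    fix s assume s: "s < m"
    have "(\<Sum>r<n. cyc_eval (\<beta> k) (C $$ (s, r)) * map_vec (cyc_eval (\<beta> k)) v $ r) =
        cyc_eval (\<beta> k) ((C *\<^sub>v v) $ s)"
      using v(1) k by (simp add: mult_mat_vec_index[OF C v(1) s] cyc_eval_sum eval_mult)
    then show "(\<Sum>r<n. cyc_eval (\<beta> k) (C $$ (s, r)) * map_vec (cyc_eval (\<beta> k)) v $ r) = 0"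
      using s v(2) by simp
  qed (use v in \<open>auto simp: cyc_eval_gen_field\<close>)
  then have "map_vec (cyc_eval (\<beta> k)) v $ r = (\<Sum>j\<in>I k. map_vec (cyc_eval (\<beta> k)) v $ j * g k j $ r)"
    by (intro g_expansion) (simp_all add: k r)
  then have "cyc_eval (\<beta> k) (v $ r) = (\<Sum>j\<in>I k. map_vec (cyc_eval (\<beta> k)) v $ j * g k j $ r)"
    using v(1) r by simp
  also have "\<dots> = (\<Sum>j\<in>I k. cyc_eval (\<beta> k) (v $ j) * g k j $ r)"
    using v(1) information_subset[OF k] by (intro sum.cong) auto
  also have "\<dots> = (\<Sum>i<t. if i = k then \<Sum>j\<in>I i. cyc_eval (\<beta> k) (v $ j) * g i j $ r else 0)"
    using k by simp
  also have "\<dots> = cyc_eval (\<beta> k) (\<Sum>i<t. \<Sum>j\<in>I i. v $ j * zeta (c i) (\<beta> i) C (I i) j $ r)"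
    unfolding cyc_eval_sum
    by (intro sum.cong refl) (auto simp: eval_mult[OF k] eval_zeta[OF _ k r] intro!: sum.cong)
  finally show "cyc_eval (\<beta> k) (v $ r) =
      cyc_eval (\<beta> k) (\<Sum>i<t. \<Sum>j\<in>I i. v $ j * zeta (c i) (\<beta> i) C (I i) j $ r)" .
qed

end

text \<open>Reads the information coordinates of each component and re-encodes them into the
  kernel.\<close>

definition kernel_projection :: "'l cyc mat \<Rightarrow> (nat \<Rightarrow> nat set) \<Rightarrow> 'l cyc mat" where
  "kernel_projection C I = select_cols t (dim_col C) (\<lambda>i. zeta (c i) (\<beta> i) C (I i)) I"

lemma kernel_projection_carrier [simp]:
  "C \<in> carrier_mat m n \<Longrightarrow> kernel_projection C I \<in> carrier_mat n n"
  by (auto simp: kernel_projection_def select_cols_def)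

lemma kernel_projection_mult_vec_index:
  assumes C: "C \<in> carrier_mat m n"
    and info: "\<And>i. i < t \<Longrightarrow>
      information_set (\<beta> i) n (kernel_code (\<beta> i) (map_mat (cyc_eval (\<beta> i)) C)) (I i)"
    and v: "v \<in> carrier_vec n" and r: "r < n"
  shows "(kernel_projection C I *\<^sub>v v) $ r =
    (\<Sum>i<t. \<Sum>j\<in>I i. v $ j * zeta (c i) (\<beta> i) C (I i) j $ r)"
proof -
  have "(kernel_projection C I *\<^sub>v v) $ r =
      (\<Sum>s<n. \<Sum>i<t. (if s \<in> I i then v $ s * zeta (c i) (\<beta> i) C (I i) s $ r else 0))"
    using C v r by (simp add: kernel_projection_def select_cols_def scalar_prod_def atLeast0LessThan
        sum_distrib_left mult.commute[of _ "v $ _"]) (auto intro!: sum.cong)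
  also have "\<dots> = (\<Sum>i<t. \<Sum>s<n. (if s \<in> I i then v $ s * zeta (c i) (\<beta> i) C (I i) s $ r else 0))"
    by (rule sum.swap)
  also have "\<dots> = (\<Sum>i<t. \<Sum>j\<in>I i. v $ j * zeta (c i) (\<beta> i) C (I i) j $ r)"
  proof (rule sum.cong[OF refl])
    fix i assume "i \<in> {..<t}"
    then have "{..<n} \<inter> I i = I i" using information_subset[OF C info] by auto
    then show "(\<Sum>s<n. (if s \<in> I i then v $ s * zeta (c i) (\<beta> i) C (I i) s $ r else 0)) =
        (\<Sum>j\<in>I i. v $ j * zeta (c i) (\<beta> i) C (I i) j $ r)"
      by (simp flip: sum.inter_restrict)
  qed
  finally show ?thesis .
qed

lemma mult_kernel_projection:
  assumes C: "C \<in> carrier_mat m n"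
    and info: "\<And>i. i < t \<Longrightarrow>
      information_set (\<beta> i) n (kernel_code (\<beta> i) (map_mat (cyc_eval (\<beta> i)) C)) (I i)"
  shows "C * kernel_projection C I = 0\<^sub>m m n"
proof (rule eq_matI)
  fix s j assume "s < dim_row (0\<^sub>m m n :: 'l cyc mat)" "j < dim_col (0\<^sub>m m n :: 'l cyc mat)"
  then have s: "s < m" and j: "j < n" by auto
  have "(C * kernel_projection C I) $$ (s, j) =
      (\<Sum>r<n. \<Sum>i<t. if j \<in> I i then C $$ (s, r) * zeta (c i) (\<beta> i) C (I i) j $ r else 0)"
    using C s j by (simp add: kernel_projection_def select_cols_def scalar_prod_def atLeast0LessThan
        sum_distrib_left if_distrib cong: if_cong)
  also have "\<dots> = (\<Sum>i<t. \<Sum>r<n. if j \<in> I i then C $$ (s, r) * zeta (c i) (\<beta> i) C (I i) j $ r else 0)"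
    by (rule sum.swap)
  also have "\<dots> = (\<Sum>i<t. if j \<in> I i then (C *\<^sub>v zeta (c i) (\<beta> i) C (I i) j) $ s else 0)"
    using s by (intro sum.cong refl) (simp add: mult_mat_vec_index[OF C zeta_carrier[OF C info]])
  also have "\<dots> = 0"
    using mult_zeta[OF C info] s by (intro sum.neutral) simp
  finally show "(C * kernel_projection C I) $$ (s, j) = 0\<^sub>m m n $$ (s, j)" using s j by simp
qed (use C in \<open>auto simp: kernel_projection_def select_cols_def\<close>)

lemma kernel_projection_fixes:
  assumes "C \<in> carrier_mat m n"
    and "\<And>i. i < t \<Longrightarrow>
      information_set (\<beta> i) n (kernel_code (\<beta> i) (map_mat (cyc_eval (\<beta> i)) C)) (I i)"
    and "v \<in> carrier_vec n" "C *\<^sub>v v = 0\<^sub>v m"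
  shows "kernel_projection C I *\<^sub>v v = v"
proof (rule eq_vecI)
  fix r assume "r < dim_vec v"
  then show "(kernel_projection C I *\<^sub>v v) $ r = v $ r"
    using assms kernel_projection_mult_vec_index[OF assms(1-3)] kernel_expansion[OF assms] by simp
qed (use assms in \<open>auto simp: kernel_projection_def select_cols_def\<close>)

text \<open>With \<open>P\<close> the projection for the transpose, column \<open>j\<close> of
  \<open>1 + P^T\<close> paired with \<open>v\<close> gives \<open>v $ j + (P v) $ j\<close>. This
  is zero on the kernel of the transpose, which \<open>P\<close> fixes, so every column is solvable
  by \<open>double_annihilator\<close>.\<close>

lemma right_inverse_modulo_cokernel:
  assumes C: "C \<in> carrier_mat m n"
    and info: "\<And>i. i < t \<Longrightarrow>
      information_set (\<beta> i) m (kernel_code (\<beta> i) (map_mat (cyc_eval (\<beta> i)) (transpose_mat C))) (Is i)"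
  obtains Z where "Z \<in> carrier_mat n m"
    "C * Z = 1\<^sub>m m + transpose_mat (kernel_projection (transpose_mat C) Is)"
proof -
  let ?P = "kernel_projection (transpose_mat C) Is"
  let ?Y = "1\<^sub>m m + transpose_mat ?P"
  have CT: "transpose_mat C \<in> carrier_mat n m" using C by simp
  have P: "?P \<in> carrier_mat m m" using CT by simp
  have "\<exists>w\<in>carrier_vec n. C *\<^sub>v w = col ?Y j" if j: "j < m" for j
  proof (rule double_annihilator[OF C])
    show "col ?Y j \<in> carrier_vec m" using P j by simp
    fix v assume v: "v \<in> carrier_vec m" "transpose_mat C *\<^sub>v v = 0\<^sub>v n"
    have "col ?Y j = col (1\<^sub>m m) j + row ?P j"
      using P j by (intro eq_vecI) auto
    then have "col ?Y j \<bullet> v = v $ j + (?P *\<^sub>v v) $ j"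
      using P j v(1) by (simp add: add_scalar_prod_distrib[of _ m])
    also have "\<dots> = 0"
      using kernel_projection_fixes[OF CT info v] by (simp add: cyc_add_self)
    finally show "col ?Y j \<bullet> v = 0" .
  qed
  moreover have "?Y \<in> carrier_mat m m" using P by simp
  ultimately show thesis using mat_solve_cols[OF C, of ?Y m] that by blast
qed

text \<open>The two sides are first solved separately: \<open>C * Z1 = 1 + F\<close> directly and
  \<open>Z2 * C = 1 + G\<close> by transposition. Since \<open>F * C = 0\<close> and
  \<open>C * G = 0\<close>, both \<open>C * Z1 * C\<close> and \<open>C * Z2 * C\<close> equal
  \<open>C\<close>, so \<open>Z2 * C * Z1\<close> satisfies both identities.\<close>

lemma contraction:
  assumes C: "C \<in> carrier_mat m n"
    and info: "\<And>i. i < t \<Longrightarrow>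
      information_set (\<beta> i) n (kernel_code (\<beta> i) (map_mat (cyc_eval (\<beta> i)) C)) (I i)"
    and info_star: "\<And>i. i < t \<Longrightarrow>
      information_set (\<beta> i) m (kernel_code (\<beta> i) (map_mat (cyc_eval (\<beta> i)) (transpose_mat C))) (Is i)"
  obtains Z where "Z \<in> carrier_mat n m"
    "Z * C = 1\<^sub>m n + kernel_projection C I"
    "C * Z = 1\<^sub>m m + transpose_mat (kernel_projection (transpose_mat C) Is)"
proof -
  let ?G = "kernel_projection C I"
  let ?F = "transpose_mat (kernel_projection (transpose_mat C) Is)"
  have CT: "transpose_mat C \<in> carrier_mat n m" using C by simp
  have carrier: "?G \<in> carrier_mat n n" "?F \<in> carrier_mat m m" using C CT by simp_all
  obtain Z1 where Z1: "Z1 \<in> carrier_mat n m" "C * Z1 = 1\<^sub>m m + ?F"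
    using right_inverse_modulo_cokernel[OF C info_star] by blast
  obtain Z2' where Z2': "Z2' \<in> carrier_mat m n" "transpose_mat C * Z2' = 1\<^sub>m n + transpose_mat ?G"
    using right_inverse_modulo_cokernel[OF CT, of I] info by auto
  define Z2 where "Z2 = transpose_mat Z2'"
  have Z2: "Z2 \<in> carrier_mat n m" using Z2' by (simp add: Z2_def)
  have "transpose_mat (transpose_mat C * Z2') = Z2 * C"
    unfolding Z2_def by (subst transpose_mult[OF CT Z2'(1)]) simp
  then have Z2C: "Z2 * C = 1\<^sub>m n + ?G"
    unfolding Z2'(2) by (subst (asm) transpose_add[of _ n n]) (use carrier in simp_all)
  have CG: "C * ?G = 0\<^sub>m m n" by (rule mult_kernel_projection[OF C info])
  have "transpose_mat (transpose_mat C * kernel_projection (transpose_mat C) Is) = ?F * C"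
    using CT by (subst transpose_mult[of _ n m _ m]) auto
  then have FC: "?F * C = 0\<^sub>m m n"
    using mult_kernel_projection[OF CT info_star] by simp
  show thesis
  proof (rule that[of "Z2 * C * Z1"])
    show "Z2 * C * Z1 \<in> carrier_mat n m" using Z1 Z2 C by simp
    have "Z2 * C * Z1 * C = Z2 * (C * Z1 * C)"
      using Z1 Z2 C by (simp add: assoc_mult_mat[of _ n m _ n _ m] assoc_mult_mat[of _ n m _ n _ n]
        assoc_mult_mat[of _ n m _ m _ n] assoc_mult_mat[of _ m n _ m _ n] assoc_mult_mat[of _ n n _ m _ n])
    also have "C * Z1 * C = C"
      using C carrier by (simp add: Z1(2) add_mult_distrib_mat[of _ m m] FC)
    finally show "Z2 * C * Z1 * C = 1\<^sub>m n + ?G" by (simp add: Z2C)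
    have "C * (Z2 * C * Z1) = (C * (Z2 * C)) * Z1"
      using Z1 Z2 C by (subst assoc_mult_mat[of C m n "Z2 * C" n Z1 m]) auto
    also have "C * (Z2 * C) = C"
      using C carrier by (simp add: Z2C mult_add_distrib_mat[of C m n _ n] CG)
    finally show "C * (Z2 * C * Z1) = 1\<^sub>m m + ?F" by (simp add: Z1(2))
  qed
qed

end

section \<open>Conjugate transposes and the pairing\<close>

lemma conj_transpose_carrier [simp]:
  "C \<in> carrier_mat m n \<Longrightarrow> conj_transpose C \<in> carrier_mat n m"
  by (auto simp: conj_transpose_def)

lemma conj_transpose_conj_transpose [simp]: "conj_transpose (conj_transpose C) = C"
  by (intro eq_matI) (auto simp: conj_transpose_def)

lemma conj_transpose_one [simp]: "conj_transpose (1\<^sub>m n) = 1\<^sub>m n"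
  by (intro eq_matI) (auto simp: conj_transpose_def)

lemma conj_transpose_zero [simp]: "conj_transpose (0\<^sub>m m n) = 0\<^sub>m n m"
  by (intro eq_matI) (auto simp: conj_transpose_def)

lemma conj_transpose_add:
  assumes "C \<in> carrier_mat m n" "D \<in> carrier_mat m n"
  shows "conj_transpose (C + D) = conj_transpose C + conj_transpose D"
  using assms by (intro eq_matI) (auto simp: conj_transpose_def cyc_conj_add)

lemma conj_transpose_mult:
  assumes "C \<in> carrier_mat m n" "D \<in> carrier_mat n k"
  shows "conj_transpose (C * D) = conj_transpose D * conj_transpose C"
  using assms
  by (intro eq_matI)
    (auto simp: conj_transpose_def scalar_prod_def cyc_conj_sum cyc_conj_mult mult.commute)

lemma pairing_eq_scalar_prod:
  "dim_vec u = dim_vec v \<Longrightarrow> pairing u v = cyc_coeff (u \<bullet> map_vec cyc_conj v) 0"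
  by (simp add: pairing_def scalar_prod_def cyc_coeff_sum atLeast0LessThan)

lemma pairing_commute:
  assumes "dim_vec u = dim_vec v"
  shows "pairing u v = pairing v u"
proof -
  have "cyc_coeff (u $ k * cyc_conj (v $ k)) 0 = cyc_coeff (v $ k * cyc_conj (u $ k)) 0" for k
    by (subst cyc_coeff_conj[symmetric]) (simp add: cyc_conj_mult mult.commute)
  then show ?thesis using assms by (simp add: pairing_def)
qed

text \<open>Boundaries therefore pair to zero with cocycles, and coboundaries with cycles, which
  lets the pairing descend to classes.\<close>

lemma pairing_adjoint:
  assumes D: "D \<in> carrier_mat m n" and w: "w \<in> carrier_vec n" and v: "v \<in> carrier_vec m"
  shows "pairing (D *\<^sub>v w) v = pairing w (conj_transpose D *\<^sub>v v)"
proof -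
  have "map_vec cyc_conj (conj_transpose D *\<^sub>v v) = transpose_mat D *\<^sub>v map_vec cyc_conj v"
    using D v
    by (intro eq_vecI) (auto simp: conj_transpose_def scalar_prod_def cyc_conj_sum cyc_conj_mult)
  moreover have "(D *\<^sub>v w) \<bullet> map_vec cyc_conj v = w \<bullet> (transpose_mat D *\<^sub>v map_vec cyc_conj v)"
  proof -
    have "(D *\<^sub>v w) \<bullet> map_vec cyc_conj v = map_vec cyc_conj v \<bullet> (D *\<^sub>v w)"
      using D w v by (intro comm_scalar_prod[of _ m]) auto
    also have "\<dots> = (transpose_mat D *\<^sub>v map_vec cyc_conj v) \<bullet> w"
      using D w v by (intro transpose_vec_mult_scalar[symmetric]) auto
    also have "\<dots> = w \<bullet> (transpose_mat D *\<^sub>v map_vec cyc_conj v)"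
      using D w v by (intro comm_scalar_prod[of _ n]) auto
    finally show ?thesis .
  qed
  ultimately show ?thesis
    using D w v by (subst (1 2) pairing_eq_scalar_prod) (auto simp: conj_transpose_def)
qed

lemma pairing_add_left:
  assumes "u \<in> carrier_vec n" "v \<in> carrier_vec n"
  shows "pairing (u + v) w = pairing u w + pairing v w"
proof -
  have "pairing (u + v) w =
      (\<Sum>k<dim_vec v. cyc_coeff (u $ k * cyc_conj (w $ k)) 0 + cyc_coeff (v $ k * cyc_conj (w $ k)) 0)"
    unfolding pairing_def index_add_vec
    by (intro sum.cong refl) (simp only: lessThan_iff index_add_vec distrib_right cyc_coeff_add)
  then show ?thesis using assms by (simp only: sum.distrib pairing_def carrier_vecD)
qed

lemma pairing_zero_left [simp]: "pairing (0\<^sub>v n) w = 0"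
  by (simp add: pairing_def cyc_coeff_0)


section \<open>The homotopy on the lifted product complex\<close>

lemma append_rows_mult_append_cols:
  fixes P1 :: "'a::comm_ring_1 mat"
  assumes "P1 \<in> carrier_mat m1 k" "P2 \<in> carrier_mat m2 k"
    and "Q1 \<in> carrier_mat k n1" "Q2 \<in> carrier_mat k n2"
  shows "(P1 @\<^sub>r P2) * append_cols Q1 Q2 = four_block_mat (P1 * Q1) (P1 * Q2) (P2 * Q1) (P2 * Q2)"
  unfolding append_rows_def append_cols_def using assms
  by (subst mult_four_block_mat[where ?nr1.0 = m1 and ?nr2.0 = m2 and ?n1.0 = k and ?n2.0 = 0
        and ?nc1.0 = n1 and ?nc2.0 = n2]) auto

lemma append_cols_carrier:
  "C \<in> carrier_mat m n1 \<Longrightarrow> D \<in> carrier_mat m n2 \<Longrightarrow> append_cols C D \<in> carrier_mat m (n1 + n2)"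
  by (auto simp: append_cols_def)

lemma kron_index:
  "r < dim_row C * dim_row D \<Longrightarrow> s < dim_col C * dim_col D \<Longrightarrow>
    kron_mat C D $$ (r, s) = C $$ (r div dim_row D, s div dim_col D) * D $$ (r mod dim_row D, s mod dim_col D)"
  by (simp add: kron_mat_def)

lemma div_mod_less_mult:
  fixes r :: nat
  assumes "r < m * n"
  shows "r div n < m" "r mod n < n"
  using assms by (auto simp: less_mult_imp_div_less intro!: mod_less_divisor gr0I)

lemma kron_mat_add_left:
  fixes C :: "'a::comm_ring_1 mat"
  assumes "C \<in> carrier_mat m n" "C' \<in> carrier_mat m n"
  shows "kron_mat (C + C') D = kron_mat C D + kron_mat C' D"
  using assms by (intro eq_matI) (auto simp: kron_index div_mod_less_mult distrib_right)

lemma kron_mat_add_right: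
  fixes D :: "'a::comm_ring_1 mat"
  assumes "D \<in> carrier_mat m n" "D' \<in> carrier_mat m n"
  shows "kron_mat C (D + D') = kron_mat C D + kron_mat C D'"
  using assms by (intro eq_matI) (auto simp: kron_index div_mod_less_mult distrib_left)

lemma kron_mat_one: "kron_mat (1\<^sub>m m) (1\<^sub>m n) = (1\<^sub>m (m * n) :: 'a::comm_ring_1 mat)"
proof (rule eq_matI)
  fix r s assume "r < dim_row (1\<^sub>m (m * n) :: 'a mat)" "s < dim_col (1\<^sub>m (m * n) :: 'a mat)"
  then have rs: "r < m * n" "s < m * n" by auto
  have "r = s" if "r div n = s div n" "r mod n = s mod n"
    using that by (metis div_mult_mod_eq)
  then show "kron_mat (1\<^sub>m m) (1\<^sub>m n) $$ (r, s) = (1\<^sub>m (m * n) :: 'a mat) $$ (r, s)"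
    using rs by (auto simp: kron_index div_mod_less_mult)
qed auto

lemma kron_mat_zero_left:
  "D \<in> carrier_mat m' n' \<Longrightarrow> kron_mat (0\<^sub>m m n) D = (0\<^sub>m (m * m') (n * n') :: 'a::comm_ring_1 mat)"
  by (intro eq_matI) (auto simp: kron_index div_mod_less_mult)

lemma mat_cyc_cancel:
  fixes M :: "('l::finite) cyc mat"
  assumes "M \<in> carrier_mat m n" "N \<in> carrier_mat m n" "P \<in> carrier_mat m n"
  shows "(M + N) + (P + M) = P + N"
proof (rule eq_matI)
  fix r s assume "r < dim_row (P + N)" "s < dim_col (P + N)"
  moreover have "(a + b) + (d + a) = d + b" for a b d :: "'l cyc"
  proof -
    have "(a + b) + (d + a) = (a + a) + (d + b)" by (simp only: ac_simps)
    then show ?thesis by (simp only: cyc_add_self add_0)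
  qed
  ultimately show "((M + N) + (P + M)) $$ (r, s) = (P + N) $$ (r, s)" using assms by simp
qed (use assms in auto)

text \<open>With \<open>ZA\<close> and \<open>ZB\<close> contracting \<open>A\<close> and \<open>B\<close> onto the projections \<open>GA\<close>, \<open>FA\<close>, \<open>GB\<close>, \<open>FB\<close>, this
  is the usual homotopy \<open>ZA \<otimes> 1 + \<pi>A \<otimes> ZB\<close> on the tensor product of two complexes; no signs
  appear in characteristic two.\<close>

lemma lp_homotopy:
  fixes A B :: "('l::finite) cyc mat"
  assumes A: "A \<in> carrier_mat mA nA" and B: "B \<in> carrier_mat mB nB"
    and ZA: "ZA \<in> carrier_mat nA mA" "ZA * A = 1\<^sub>m nA + GA" "A * ZA = 1\<^sub>m mA + FA"
    and ZB: "ZB \<in> carrier_mat nB mB" "ZB * B = 1\<^sub>m nB + GB" "B * ZB = 1\<^sub>m mB + FB"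
    and GA: "GA \<in> carrier_mat nA nA" "A * GA = 0\<^sub>m mA nA"
    and FA: "FA \<in> carrier_mat mA mA" "FA * A = 0\<^sub>m mA nA"
    and GB: "GB \<in> carrier_mat nB nB" and FB: "FB \<in> carrier_mat mB mB"
  obtains H1 H2 where "H1 \<in> carrier_mat (nA * mB + mA * nB) (mA * mB)"
    "H2 \<in> carrier_mat (nA * nB) (nA * mB + mA * nB)"
    "lp_boundary2 A B * H2 + H1 * lp_boundary1 A B = 1\<^sub>m (nA * mB + mA * nB) +
      four_block_mat (kron_mat GA FB) (0\<^sub>m (nA * mB) (mA * nB)) (0\<^sub>m (mA * nB) (nA * mB)) (kron_mat FA GB)"
proof
  \<comment> \<open>Here \<open>\<pi>A\<close> is \<open>FA\<close> in degree zero and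
    \<open>GA\<close> in degree one.\<close>
  let ?H1 = "kron_mat ZA (1\<^sub>m mB) @\<^sub>r kron_mat FA ZB"
  let ?H2 = "append_cols (kron_mat GA ZB) (kron_mat ZA (1\<^sub>m nB))"
  have [simp]: "dim_row A = mA" "dim_col A = nA" "dim_row B = mB" "dim_col B = nB" using A B by auto
  note carriers = A B ZA(1) ZB(1) GA(1) FA(1) GB FB
  show "?H1 \<in> carrier_mat (nA * mB + mA * nB) (mA * mB)" "?H2 \<in> carrier_mat (nA * nB) (nA * mB + mA * nB)"
    using carriers by (auto intro!: append_cols_carrier carrier_append_rows)
  have D2H2: "lp_boundary2 A B * ?H2 =
      four_block_mat (kron_mat GA (1\<^sub>m mB) + kron_mat GA FB) (kron_mat ZA B)
        (0\<^sub>m (mA * nB) (nA * mB)) (kron_mat (1\<^sub>m mA) (1\<^sub>m nB) + kron_mat FA (1\<^sub>m nB))"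
  proof -
    have "kron_mat (1\<^sub>m nA) B * kron_mat GA ZB = kron_mat GA (1\<^sub>m mB) + kron_mat GA FB"
      unfolding kron_mat_mult[OF one_carrier_mat B GA(1) ZB(1)]
        by (simp only: ZB(3) left_mult_one_mat[OF GA(1)] kron_mat_add_right[OF one_carrier_mat FB])
    moreover have "kron_mat (1\<^sub>m nA) B * kron_mat ZA (1\<^sub>m nB) = kron_mat ZA B"
      unfolding kron_mat_mult[OF one_carrier_mat B ZA(1) one_carrier_mat]
        by (simp only: left_mult_one_mat[OF ZA(1)] right_mult_one_mat[OF B])
    moreover have "kron_mat A (1\<^sub>m nB) * kron_mat GA ZB = 0\<^sub>m (mA * nB) (nA * mB)"
      unfolding kron_mat_mult[OF A one_carrier_mat GA(1) ZB(1)]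
        by (simp only: GA(2) left_mult_one_mat[OF ZB(1)] kron_mat_zero_left[OF ZB(1)])
    moreover have "kron_mat A (1\<^sub>m nB) * kron_mat ZA (1\<^sub>m nB) = kron_mat (1\<^sub>m mA) (1\<^sub>m nB) + kron_mat FA (1\<^sub>m nB)"
      unfolding kron_mat_mult[OF A one_carrier_mat ZA(1) one_carrier_mat]
        by (simp only: ZA(3) left_mult_one_mat[OF one_carrier_mat] kron_mat_add_left[OF one_carrier_mat FA(1)])
    ultimately show ?thesis
      unfolding lp_boundary2_def using carriers
      by (subst append_rows_mult_append_cols[of _ "nA * mB" "nA * nB" _ "mA * nB" _ "nA * mB" _ "mA * nB"]) simp_all
  qed
  have H1D1: "?H1 * lp_boundary1 A B =
      four_block_mat (kron_mat (1\<^sub>m nA) (1\<^sub>m mB) + kron_mat GA (1\<^sub>m mB)) (kron_mat ZA B)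
        (0\<^sub>m (mA * nB) (nA * mB)) (kron_mat FA (1\<^sub>m nB) + kron_mat FA GB)"
  proof -
    have "kron_mat ZA (1\<^sub>m mB) * kron_mat A (1\<^sub>m mB) = kron_mat (1\<^sub>m nA) (1\<^sub>m mB) + kron_mat GA (1\<^sub>m mB)"
      unfolding kron_mat_mult[OF ZA(1) one_carrier_mat A one_carrier_mat]
        by (simp only: ZA(2) left_mult_one_mat[OF one_carrier_mat] kron_mat_add_left[OF one_carrier_mat GA(1)])
    moreover have "kron_mat ZA (1\<^sub>m mB) * kron_mat (1\<^sub>m mA) B = kron_mat ZA B"
      unfolding kron_mat_mult[OF ZA(1) one_carrier_mat one_carrier_mat B]
        by (simp only: left_mult_one_mat[OF B] right_mult_one_mat[OF ZA(1)])
    moreover have "kron_mat FA ZB * kron_mat A (1\<^sub>m mB) = 0\<^sub>m (mA * nB) (nA * mB)"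
      unfolding kron_mat_mult[OF FA(1) ZB(1) A one_carrier_mat]
        by (simp only: FA(2) right_mult_one_mat[OF ZB(1)] kron_mat_zero_left[OF ZB(1)])
    moreover have "kron_mat FA ZB * kron_mat (1\<^sub>m mA) B = kron_mat FA (1\<^sub>m nB) + kron_mat FA GB"
      unfolding kron_mat_mult[OF FA(1) ZB(1) one_carrier_mat B]
        by (simp only: ZB(2) right_mult_one_mat[OF FA(1)] kron_mat_add_right[OF one_carrier_mat GB])
    ultimately show ?thesis
      unfolding lp_boundary1_def using carriers
      by (subst append_rows_mult_append_cols[of _ "nA * mB" "mA * mB" _ "mA * nB" _ "nA * mB" _ "mA * nB"]) simp_all
  qed
  \<comment> \<open>In both diagonal blocks, the projection of \<open>A\<close> tensored with an
    identity occurs in each of the two products and cancels.\<close>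
  have LL: "kron_mat GA (1\<^sub>m mB) + kron_mat GA FB + (kron_mat (1\<^sub>m nA) (1\<^sub>m mB) + kron_mat GA (1\<^sub>m mB)) =
      1\<^sub>m (nA * mB) + kron_mat GA FB"
    using carriers by (subst mat_cyc_cancel[of _ "nA * mB" "nA * mB"]) (auto simp: kron_mat_one)
  have RR: "kron_mat (1\<^sub>m mA) (1\<^sub>m nB) + kron_mat FA (1\<^sub>m nB) + (kron_mat FA (1\<^sub>m nB) + kron_mat FA GB) =
      1\<^sub>m (mA * nB) + kron_mat FA GB"
  proof -
    have "kron_mat (1\<^sub>m mA) (1\<^sub>m nB) + kron_mat FA (1\<^sub>m nB) + (kron_mat FA (1\<^sub>m nB) + kron_mat FA GB) =
        (kron_mat FA (1\<^sub>m nB) + kron_mat (1\<^sub>m mA) (1\<^sub>m nB)) + (kron_mat FA GB + kron_mat FA (1\<^sub>m nB))"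
      using carriers by (simp add: comm_add_mat[of _ "mA * nB" "mA * nB"])
    also have "\<dots> = kron_mat FA GB + kron_mat (1\<^sub>m mA) (1\<^sub>m nB)"
      using carriers by (intro mat_cyc_cancel[of _ "mA * nB" "mA * nB"]) auto
    finally show ?thesis
      using carriers by (simp add: kron_mat_one comm_add_mat[of _ "mA * nB" "mA * nB"])
  qed
  \<comment> \<open>The upper off-diagonal block occurs in both products and cancels; the lower one
    is already zero through \<open>A * GA = 0\<close> and \<open>FA * A = 0\<close>.\<close>
  have "kron_mat ZA B + kron_mat ZA B = 0\<^sub>m (nA * mB) (mA * nB)"
    using carriers by (intro mat_cyc_add_self) simp
  then have "lp_boundary2 A B * ?H2 + ?H1 * lp_boundary1 A B =
      four_block_mat (1\<^sub>m (nA * mB) + kron_mat GA FB) (0\<^sub>m (nA * mB) (mA * nB))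
        (0\<^sub>m (mA * nB) (nA * mB)) (1\<^sub>m (mA * nB) + kron_mat FA GB)"
    unfolding D2H2 H1D1 using carriers
    by (subst add_four_block_mat[of _ "nA * mB" "nA * mB" _ "mA * nB" _ "mA * nB"])
      (auto simp: LL RR)
  also have "\<dots> = four_block_mat (1\<^sub>m (nA * mB)) (0\<^sub>m (nA * mB) (mA * nB)) (0\<^sub>m (mA * nB) (nA * mB)) (1\<^sub>m (mA * nB)) +
      four_block_mat (kron_mat GA FB) (0\<^sub>m (nA * mB) (mA * nB)) (0\<^sub>m (mA * nB) (nA * mB)) (kron_mat FA GB)"
    using carriers by (subst add_four_block_mat[of _ "nA * mB" "nA * mB" _ "mA * nB" _ "mA * nB"]) auto
  finally show "lp_boundary2 A B * ?H2 + ?H1 * lp_boundary1 A B = 1\<^sub>m (nA * mB + mA * nB) +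
      four_block_mat (kron_mat GA FB) (0\<^sub>m (nA * mB) (mA * nB)) (0\<^sub>m (mA * nB) (nA * mB)) (kron_mat FA GB)"
    by simp
qed

(* Otherwise the simplifier turns the operations of class_ring over bit into bitwise ones. *)
declare add_bit_eq_xor [simp del] mult_bit_eq_and [simp del]

section \<open>Components over the two-element field\<close>

lemma vectorspace_gen_field: "vectorspace class_ring (gen_field_module \<beta>)"
proof -
  let ?V = "gen_field_module \<beta>"
  have "abelian_group ?V"
  proof (rule abelian_groupI)
    fix y assume "y \<in> carrier ?V"
    then show "\<exists>z \<in> carrier ?V. z \<oplus>\<^bsub>?V\<^esub> y = \<zero>\<^bsub>?V\<^esub>"
      by (intro bexI[of _ "- y"]) (simp_all add: gen_field_module_def gen_field_uminus)
  qed (simp_all add: gen_field_module_def gen_field_0 gen_field_add add_ac)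
  then have "module class_ring ?V"
  proof (rule moduleI[OF class_cring.is_cring])
    show "(a \<oplus>\<^bsub>class_ring\<^esub> b) \<odot>\<^bsub>?V\<^esub> y = a \<odot>\<^bsub>?V\<^esub> y \<oplus>\<^bsub>?V\<^esub> b \<odot>\<^bsub>?V\<^esub> y" for a b y
      by (simp only: gen_field_module_def module.simps ring.simps to_ac_add distrib_right)
    show "(a \<otimes>\<^bsub>class_ring\<^esub> b) \<odot>\<^bsub>?V\<^esub> y = a \<odot>\<^bsub>?V\<^esub> (b \<odot>\<^bsub>?V\<^esub> y)" for a b y
      by (simp only: gen_field_module_def module.simps monoid.simps to_ac_mult mult.assoc)
  qed (simp_all add: gen_field_module_def gen_field_mult gen_field_to_ac distrib_left)
  then show ?thesis by (intro vectorspace.intro class_field)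
qed

text \<open>With only the scalars 0 and 1, closure under addition is the same as being a subspace
  over the two-element field.\<close>

definition additive_closed :: "('l::finite) cyc set \<Rightarrow> bool" where
  "additive_closed S \<longleftrightarrow> 0 \<in> S \<and> (\<forall>f\<in>S. \<forall>g\<in>S. f + g \<in> S)"

lemma additive_closed_sum:
  assumes "additive_closed S" "\<And>j. j \<in> J \<Longrightarrow> f j \<in> S"
  shows "(\<Sum>j\<in>J. f j) \<in> S"
  using assms(2) by (induction J rule: infinite_finite_induct) (use assms(1) in \<open>auto simp: additive_closed_def\<close>)

locale cyc_component_bases = cyc_components t b \<beta> c
  for t b \<beta> and c :: "nat \<Rightarrow> ('l::finite) cyc" +
  fixes e :: "nat \<Rightarrow> nat \<Rightarrow> nat" and h :: "nat \<Rightarrow> nat \<Rightarrow> 'l cyc"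
  assumes exponent_range: "\<And>i k. i < t \<Longrightarrow> k < degree (b i) \<Longrightarrow> e i k < CARD('l)"
    and exponent_distinct: "\<And>i. i < t \<Longrightarrow> inj_on (e i) {..<degree (b i)}"
    and exponent_basis: "\<And>i. i < t \<Longrightarrow>
      family_basis class_ring (gen_field_module (\<beta> i)) {..<degree (b i)} (\<lambda>k. inverse (\<beta> i) ^ e i k)"
    and dual: "\<And>i j k. i < t \<Longrightarrow> j < degree (b i) \<Longrightarrow> k < degree (b i) \<Longrightarrow>
      cyc_coeff (c i * h i (e i k)) (e i j) = (if j = k then 1 else 0)"
begin

lemma eval_conj_x_power:
  assumes "i < t"
  shows "cyc_eval (\<beta> i) (cyc_conj (cyc_x ^ m) :: 'l cyc) = inverse (\<beta> i) ^ m"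
proof (induction m)
  case 0
  show ?case using assms by (simp add: eval_1)
next
  case (Suc m)
  have "cyc_eval (\<beta> i) (cyc_conj cyc_x :: 'l cyc) * \<beta> i = 1"
    using assms eval_mult[of i "cyc_conj cyc_x" cyc_x] by (simp add: cyc_conj_x_mult eval_1 eval_x)
  then have "cyc_eval (\<beta> i) (cyc_conj cyc_x :: 'l cyc) = inverse (\<beta> i)"
    by (metis inverse_unique mult.commute)
  with Suc show ?case using assms by (simp add: cyc_conj_mult eval_mult)
qed

text \<open>Lifting is additive and carries \<open>inverse (\<beta> i) ^ m\<close> to
  \<open>c i * cyc_conj (cyc_x ^ m)\<close>, so \<open>exponent_basis\<close> transfers from the
  field to the ideal \<open>c i R\<close>. Stating this for an arbitrary subgroup \<open>S\<close>
  instead of a span lets later arguments choose \<open>S\<close> freely, for instance as an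
  orthogonal complement.\<close>

lemma component_spanned_by_conj_x:
  assumes i: "i < t" and S: "additive_closed S"
    and gen: "\<And>k. k < degree (b i) \<Longrightarrow> c i * cyc_conj (cyc_x ^ e i k) \<in> S"
  shows "c i * f \<in> S"
proof -
  interpret V: vectorspace class_ring "gen_field_module (\<beta> i)" by (rule vectorspace_gen_field)
  let ?B = "(\<lambda>k. inverse (\<beta> i) ^ e i k) ` {..<degree (b i)}"
  let ?N = "{y \<in> gen_field (\<beta> i). cyc_lift (c i) (\<beta> i) y \<in> S}"
  have lift_eval: "cyc_lift (c i) (\<beta> i) (cyc_eval (\<beta> i) f) = c i * f" for f
    using i by (intro cyc_eqI) (simp add: eval_lift cyc_eval_gen_field eval_mult eval_idempotent)
  have lift_add: "cyc_lift (c i) (\<beta> i) (y + z) = cyc_lift (c i) (\<beta> i) y + cyc_lift (c i) (\<beta> i) z"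
    if "y \<in> gen_field (\<beta> i)" "z \<in> gen_field (\<beta> i)" for y z
    using i that by (intro cyc_eqI) (simp add: eval_lift gen_field_add cyc_eval_add)
  have "LinearCombinations.submodule class_ring ?N (gen_field_module (\<beta> i))"
  proof (rule LinearCombinations.submodule.intro)
    show "a \<odot>\<^bsub>gen_field_module (\<beta> i)\<^esub> y \<in> ?N" if "y \<in> ?N" for a y
      using that i S by (cases a) (auto simp: gen_field_module_def gen_field_0 lift_0 additive_closed_def)
    show "Module.module class_ring (gen_field_module (\<beta> i))" by (rule V.module_axioms)
  qed (use i S in \<open>auto simp: gen_field_module_def gen_field_0 gen_field_add lift_0 lift_add additive_closed_def\<close>)
  moreover have "?B \<subseteq> ?N"
  proof
    fix y assume "y \<in> ?B"
    then obtain k where k: "k < degree (b i)" "y = inverse (\<beta> i) ^ e i k" by blast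
    then have "y = cyc_eval (\<beta> i) (cyc_conj (cyc_x ^ e i k) :: 'l cyc)"
      using i by (simp add: eval_conj_x_power)
    then show "y \<in> ?N" using gen[OF k(1)] by (simp add: lift_eval cyc_eval_gen_field)
  qed
  ultimately have "V.span ?B \<subseteq> ?N" by (intro V.span_is_subset)
  moreover have "V.basis ?B" using exponent_basis[OF i] by (simp add: family_basis_def)
  then have "V.span ?B = gen_field (\<beta> i)" unfolding V.basis_def by (simp add: gen_field_module_def)
  ultimately have "cyc_eval (\<beta> i) f \<in> ?N" using cyc_eval_gen_field by blast
  then show ?thesis by (simp add: lift_eval)
qed

text \<open>The coefficient functionals at the exponents detect the component, because the conjugate powers
  \<open>x^(-m)\<close> span it.\<close>

lemma component_spanned_by_dual:
  assumes i: "i < t" and S: "additive_closed S"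
    and gen: "\<And>k. k < degree (b i) \<Longrightarrow> c i * h i (e i k) \<in> S"
  shows "c i * f \<in> S"
proof -
  let ?a = "\<lambda>k. cyc_coeff (c i * f) (e i k)"
  \<comment> \<open>The candidate for \<open>c i * f\<close>: dual elements weighted by the
    coefficients of \<open>c i * f\<close> at the exponents.\<close>
  define g where "g = (\<Sum>k<degree (b i). if ?a k = 1 then c i * h i (e i k) else 0)"
  have "g \<in> S"
    unfolding g_def using gen S by (intro additive_closed_sum) (auto simp: additive_closed_def)
  have "c i * g = g"
    unfolding g_def sum_distrib_left using idempotent[OF i]
    by (intro sum.cong refl) (simp flip: mult.assoc)
  then have d: "c i * (c i * f + g) = c i * f + g"
    using idempotent[OF i] by (simp add: distrib_left flip: mult.assoc)
  have absorb: "(c i * f + g) * (c i * y) = (c i * f + g) * y" for y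
  proof -
    have "(c i * f + g) * (c i * y) = (c i * (c i * f + g)) * y"
      by (simp only: mult.assoc mult.commute mult.left_commute)
    then show ?thesis by (simp only: d)
  qed
  have coeff_g: "cyc_coeff g (e i j) = ?a j" if j: "j < degree (b i)" for j
  proof -
    have "cyc_coeff g (e i j) = (\<Sum>k<degree (b i). if k = j then ?a j else 0)"
      unfolding g_def cyc_coeff_sum
    proof (intro sum.cong refl)
      fix k assume k: "k \<in> {..<degree (b i)}"
      show "cyc_coeff (if ?a k = 1 then c i * h i (e i k) else 0) (e i j) = (if k = j then ?a j else 0)"
        using dual[OF i j, of k] k by (cases "?a k") (auto simp: cyc_coeff_0)
    qed
    then show ?thesis using j by simp
  qed
  have "c i * f + g = 0"
  proof (rule cyc_eq_0I)
    fix f'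
    \<comment> \<open>The orthogonal complement of \<open>c i * f + g\<close>. It contains the
      generators because both terms agree at the exponents, hence all of \<open>c i R\<close>, and
      by \<open>absorb\<close> then all of \<open>R\<close>.\<close>
    let ?S = "{y. cyc_coeff ((c i * f + g) * y) 0 = 0}"
    have "additive_closed ?S"
      by (simp add: additive_closed_def cyc_coeff_0 distrib_left cyc_coeff_add)
    moreover have "c i * cyc_conj (cyc_x ^ e i k) \<in> ?S" if k: "k < degree (b i)" for k
    proof -
      have "cyc_coeff (c i * f + g) (e i k) = 0"
        by (simp only: cyc_coeff_add coeff_g[OF k] bit_add_self)
      then show ?thesis
        using exponent_range[OF i k] by (simp add: absorb cyc_coeff_mult_conj_x_power)
    qed
    ultimately have "c i * f' \<in> ?S" by (rule component_spanned_by_conj_x[OF i])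
    then show "cyc_coeff ((c i * f + g) * f') 0 = 0" by (simp add: absorb)
  qed
  then have "c i * f + g = g + g" by (simp only: cyc_add_self)
  then have "c i * f = g" by (simp only: add_right_cancel)
  with \<open>g \<in> S\<close> show ?thesis by simp
qed

end


section \<open>Homology bases from a dual family\<close>

definition vec_additive_closed :: "nat \<Rightarrow> ('l::finite) cyc vec set \<Rightarrow> bool" where
  "vec_additive_closed n N \<longleftrightarrow> N \<subseteq> carrier_vec n \<and> 0\<^sub>v n \<in> N \<and> (\<forall>u\<in>N. \<forall>v\<in>N. u + v \<in> N)"

lemma cyc_const_0: "cyc_const 0 = 0"
  by transfer (simp add: cyc_rel_def)

lemma carrier_binary_module: "carrier (binary_module n) = carrier_vec n"
  by (simp add: binary_module_def)

lemma submodule_binary_module_iff: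
  "LinearCombinations.submodule class_ring N (binary_module n) \<longleftrightarrow> vec_additive_closed n N"
proof
  assume "LinearCombinations.submodule class_ring N (binary_module n)"
  then interpret LinearCombinations.submodule class_ring N "binary_module n" .
  show "vec_additive_closed n N"
    using subset m_closed zero_closed by (auto simp: vec_additive_closed_def binary_module_def)
next
  assume N: "vec_additive_closed n N"
  have "cyc_const a \<cdot>\<^sub>v v \<in> N" if "v \<in> N" for a v
  proof -
    have "v \<in> carrier_vec n" using that N by (auto simp: vec_additive_closed_def)
    then have "cyc_const 0 \<cdot>\<^sub>v v = 0\<^sub>v n" by (auto simp: cyc_const_0)
    then show ?thesis
      using that N by (cases a) (auto simp: cyc_const_1 vec_additive_closed_def)
  qed
  then show "LinearCombinations.submodule class_ring N (binary_module n)"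
    using N by (intro LinearCombinations.submodule.intro module_binary_module)
      (auto simp: vec_additive_closed_def binary_module_def)
qed

abbreviation binary_span :: "nat \<Rightarrow> ('l::finite) cyc vec set \<Rightarrow> 'l cyc vec set" where
  "binary_span n \<equiv> module.span class_ring (binary_module n)"

lemma binary_span_subset:
  assumes "S \<subseteq> N" "vec_additive_closed n N"
  shows "binary_span n S \<subseteq> N"
  using module.span_is_subset[OF module_binary_module assms(1)] assms(2)
  by (simp add: submodule_binary_module_iff)

lemma binary_span_closed:
  assumes "S \<subseteq> carrier_vec n"
  shows "vec_additive_closed n (binary_span n S)"
  using module.span_is_submodule[OF module_binary_module, of S n] assms
  by (simp add: submodule_binary_module_iff carrier_binary_module)

lemma binary_span_superset:
  assumes "S \<subseteq> carrier_vec n"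
  shows "S \<subseteq> binary_span n S"
  using module.in_own_span[OF module_binary_module, of S n] assms
  by (simp add: carrier_binary_module)

context
  fixes D1 D2 :: "('l::finite) cyc mat" and m n k :: nat
  assumes D1: "D1 \<in> carrier_mat m n" and D2: "D2 \<in> carrier_mat n k" and D12: "D1 * D2 = 0\<^sub>m m k"
begin

private abbreviation (input) "H \<equiv> homology D1 D2"
private abbreviation (input) "cls \<equiv> homology_class D1 D2"

private lemma boundaries_closed: "vec_additive_closed n (boundaries D2)"
  unfolding vec_additive_closed_def
proof (intro conjI ballI)
  show "boundaries D2 \<subseteq> carrier_vec n" using D2 by (auto simp: boundaries_def)
  show "0\<^sub>v n \<in> boundaries D2"
    using D2 unfolding boundaries_def by (intro image_eqI[of _ _ "0\<^sub>v k"]) auto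
  fix u v assume "u \<in> boundaries D2" "v \<in> boundaries D2"
  then obtain u' v' where "u' \<in> carrier_vec k" "v' \<in> carrier_vec k" "u = D2 *\<^sub>v u'" "v = D2 *\<^sub>v v'"
    using D2 by (auto simp: boundaries_def)
  then show "u + v \<in> boundaries D2"
    using D2 unfolding boundaries_def
    by (intro image_eqI[of _ _ "u' + v'"]) (auto simp: mult_add_distrib_mat_vec)
qed

private lemma boundaryD: "w \<in> boundaries D2 \<Longrightarrow> w \<in> carrier_vec n"
  using boundaries_closed by (auto simp: vec_additive_closed_def)

private lemma kernel_closed: "vec_additive_closed n (mat_kernel D1)"
  using D1 by (auto simp: vec_additive_closed_def mat_kernel_def mult_add_distrib_mat_vec)

private lemma kernelD: "v \<in> mat_kernel D1 \<Longrightarrow> v \<in> carrier_vec n"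
  using D1 by (auto simp: mat_kernel_def)

private lemma cls_eq: "cls v = {w + v | w. w \<in> boundaries D2}"
  by (auto simp: homology_class_def a_r_coset_def' binary_module_def)

private lemma carrier_H: "carrier H = cls ` mat_kernel D1"
  using D1 by (auto simp: homology_def quotient_module_def A_RCOSETS_def' homology_class_def
      a_r_coset_def' binary_module_def)

private lemma zero_H: "\<zero>\<^bsub>H\<^esub> = boundaries D2"
  by (simp add: homology_def quotient_module_def)

private lemma add_H: "S \<oplus>\<^bsub>H\<^esub> T = {u + v | u v. u \<in> S \<and> v \<in> T}"
  by (auto simp: homology_def quotient_module_def set_add_def' binary_module_def)

private lemma smult_H: "a \<odot>\<^bsub>H\<^esub> S = {w + cyc_const a \<cdot>\<^sub>v v | w v. w \<in> boundaries D2 \<and> v \<in> S}"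
  by (auto simp: homology_def quotient_module_def a_r_coset_def' binary_module_def)

private lemma cls_zero: "cls (0\<^sub>v n) = \<zero>\<^bsub>H\<^esub>"
  using boundaryD by (force simp: cls_eq zero_H)

private lemma cls_add:
  assumes "u \<in> carrier_vec n" "v \<in> carrier_vec n"
  shows "cls u \<oplus>\<^bsub>H\<^esub> cls v = cls (u + v)"
proof -
  have swap: "(w + u) + (w' + v) = (w + w') + (u + v)" if "w \<in> carrier_vec n" "w' \<in> carrier_vec n" for w w'
    using assms that by (intro eq_vecI) auto
  show ?thesis
  proof (intro Set.set_eqI iffI)
    fix x assume "x \<in> cls u \<oplus>\<^bsub>H\<^esub> cls v"
    then obtain w w' where "w \<in> boundaries D2" "w' \<in> boundaries D2" "x = (w + u) + (w' + v)"
      by (auto simp: add_H cls_eq)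
    then show "x \<in> cls (u + v)"
      using boundaries_closed by (auto simp: cls_eq swap boundaryD vec_additive_closed_def)
  next
    fix x assume "x \<in> cls (u + v)"
    then obtain w where w: "w \<in> boundaries D2" "x = w + (u + v)" by (auto simp: cls_eq)
    have "0\<^sub>v n \<in> boundaries D2" using boundaries_closed by (simp add: vec_additive_closed_def)
    moreover have "x = (w + u) + (0\<^sub>v n + v)"
      using w boundaryD[OF w(1)] assms by simp
    ultimately show "x \<in> cls u \<oplus>\<^bsub>H\<^esub> cls v" using w by (auto simp: add_H cls_eq)
  qed
qed

private lemma cls_add_boundary:
  assumes "u \<in> carrier_vec n" "w \<in> boundaries D2"
  shows "cls (u + w) = cls u"
proof -
  have "cls w = cls (0\<^sub>v n)"
  proof (intro Set.set_eqI iffI)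
    fix x assume "x \<in> cls w"
    then have x: "x \<in> boundaries D2"
      using assms(2) boundaries_closed by (auto simp: cls_eq vec_additive_closed_def)
    then have "x = x + 0\<^sub>v n" using boundaryD by simp
    then show "x \<in> cls (0\<^sub>v n)" using x unfolding cls_eq by blast
  next
    fix x assume "x \<in> cls (0\<^sub>v n)"
    then have x: "x \<in> boundaries D2" using boundaryD by (auto simp: cls_eq)
    then have "x = (x + w) + w"
      using assms(2) boundaryD by (simp add: assoc_add_vec[of _ n] vec_cyc_add_self[of _ n])
    then show "x \<in> cls w"
      using x assms(2) boundaries_closed unfolding cls_eq vec_additive_closed_def by blast
  qed
  then show ?thesis
    using assms boundaryD[OF assms(2)] by (metis cls_add right_zero_vec zero_carrier_vec)
qed

text \<open>By \<open>X\<close>, pairing with \<open>Xf j\<close> is constant on classes, so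
  \<open>dual\<close> separates the classes and makes them independent; generation comes from
  \<open>span\<close>. The second claim allows a larger \<open>S\<close> because the generator
  matrices may also have zero rows.\<close>

lemma homology_basis_by_duality:
  fixes Zf Xf :: "'j \<Rightarrow> 'l cyc vec"
  assumes finite: "finite J"
    and Z: "\<And>j. j \<in> J \<Longrightarrow> Zf j \<in> mat_kernel D1"
    and X: "\<And>j w. j \<in> J \<Longrightarrow> w \<in> carrier_vec k \<Longrightarrow> pairing (D2 *\<^sub>v w) (Xf j) = 0"
    and dual: "\<And>i j. i \<in> J \<Longrightarrow> j \<in> J \<Longrightarrow> pairing (Zf i) (Xf j) = (if i = j then 1 else 0)"
    and span: "\<And>v. v \<in> mat_kernel D1 \<Longrightarrow>
      \<exists>s w. s \<in> binary_span n (Zf ` J) \<and> w \<in> carrier_vec k \<and> v = s + D2 *\<^sub>v w"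
  shows "family_basis class_ring H J (\<lambda>j. cls (Zf j))"
    and "Zf ` J \<subseteq> S \<Longrightarrow> S \<subseteq> mat_kernel D1 \<Longrightarrow> generates_homology D1 D2 S"
proof -
  interpret H: vectorspace class_ring H by (rule vectorspace_homology[OF D1 D2 D12])
  have ZK: "Zf ` J \<subseteq> mat_kernel D1" using Z by blast
  then have Zn: "Zf ` J \<subseteq> carrier_vec n" using kernelD by blast
  have span_kernel: "binary_span n (Zf ` J) \<subseteq> mat_kernel D1"
    by (rule binary_span_subset[OF ZK kernel_closed])
  have X0: "pairing w (Xf j) = 0" if "j \<in> J" "w \<in> boundaries D2" for j w
    using X[OF that(1)] that(2) D2 by (auto simp: boundaries_def)
  have pairing_cls: "pairing x (Xf j) = pairing (Zf i) (Xf j)" if "i \<in> J" "j \<in> J" "x \<in> cls (Zf i)" for i j x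
    using that X0[OF \<open>j \<in> J\<close>] Zn boundaryD by (auto simp: cls_eq pairing_add_left[of _ n])
  have self: "Zf j \<in> cls (Zf j)" if "j \<in> J" for j
    using that Zn boundaries_closed
    by (auto simp: cls_eq vec_additive_closed_def intro!: exI[of _ "0\<^sub>v n"])
  have inj: "inj_on (\<lambda>j. cls (Zf j)) J"
  proof (rule inj_onI)
    fix i j assume ij: "i \<in> J" "j \<in> J" "cls (Zf i) = cls (Zf j)"
    then have "pairing (Zf i) (Xf j) = pairing (Zf j) (Xf j)"
      using self[OF ij(1)] pairing_cls[OF ij(2,2)] by simp
    then show "i = j" using ij by (simp add: dual split: if_splits)
  qed
  let ?B = "(\<lambda>j. cls (Zf j)) ` J"
  have B: "?B \<subseteq> carrier H" using Z by (auto simp: carrier_H)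
  have "H.span ?B = carrier H"
  proof
    show "H.span ?B \<subseteq> carrier H" using B by (rule H.span_is_subset2)
    have sub: "LinearCombinations.submodule class_ring (H.span ?B) H" using B by (rule H.span_is_submodule)
    \<comment> \<open>Pulling the span of the classes back to cycles transfers generation from
      vectors to classes.\<close>
    let ?N = "{v \<in> mat_kernel D1. cls v \<in> H.span ?B}"
    have "vec_additive_closed n ?N"
      using kernel_closed kernelD LinearCombinations.submodule.m_closed[OF sub]
        LinearCombinations.submodule.zero_closed[OF sub]
      by (auto simp: vec_additive_closed_def cls_zero cls_add[symmetric])
    moreover have "Zf ` J \<subseteq> ?N"
      using ZK H.in_own_span[OF B] by auto
    ultimately have "binary_span n (Zf ` J) \<subseteq> ?N" by (intro binary_span_subset)
    moreover have "\<exists>s\<in>binary_span n (Zf ` J). cls v = cls s" if v: "v \<in> mat_kernel D1" for v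
    proof -
      obtain s w where sw: "s \<in> binary_span n (Zf ` J)" "w \<in> carrier_vec k" "v = s + D2 *\<^sub>v w"
        using span[OF v] by blast
      then have "D2 *\<^sub>v w \<in> boundaries D2" using D2 by (auto simp: boundaries_def)
      then show ?thesis
        using sw span_kernel kernelD by (intro bexI[of _ s]) (auto simp: cls_add_boundary)
    qed
    ultimately show "carrier H \<subseteq> H.span ?B" by (fastforce simp: carrier_H)
  qed
  moreover have "H.lin_indpt ?B"
  proof
    assume "H.lin_dep ?B"
    then obtain j where j: "j \<in> J" "cls (Zf j) \<in> H.span (?B - {cls (Zf j)})"
      using H.lindep_span[OF B] finite by auto
    \<comment> \<open>The classes annihilated by \<open>Xf j\<close> form a subspace containing
      every basis class except the one of \<open>Zf j\<close>, which pairs to 1.\<close>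
    let ?N = "{T \<in> carrier H. \<forall>x\<in>T. x \<in> carrier_vec n \<and> pairing x (Xf j) = 0}"
    have "LinearCombinations.submodule class_ring ?N H"
    proof (rule LinearCombinations.submodule.intro)
      show "S \<oplus>\<^bsub>H\<^esub> T \<in> ?N" if "S \<in> ?N" "T \<in> ?N" for S T
        using that H.a_closed[of S T] by (auto simp: add_H pairing_add_left[of _ n])
      show "\<zero>\<^bsub>H\<^esub> \<in> ?N"
        using H.zero_closed X0[OF j(1)] boundaryD by (auto simp: zero_H)
      show "a \<odot>\<^bsub>H\<^esub> S \<in> ?N" if "S \<in> ?N" for a S
      proof -
        have "pairing (w + cyc_const a \<cdot>\<^sub>v v) (Xf j) = 0" if "w \<in> boundaries D2" "v \<in> S" for w v
        proof -
          have v: "v \<in> carrier_vec n" "pairing v (Xf j) = 0" using \<open>S \<in> ?N\<close> that by auto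
          then have "pairing (cyc_const a \<cdot>\<^sub>v v) (Xf j) = 0"
            by (cases a) (simp_all add: cyc_const_0 cyc_const_1 pairing_def cyc_coeff_0)
          then show ?thesis
            using v that X0[OF j(1)] boundaryD by (simp add: pairing_add_left[of _ n])
        qed
        then show ?thesis
          using that H.smult_closed[of a S] boundaryD by (auto simp: smult_H)
      qed
    qed (auto simp: H.module_axioms)
    moreover have "?B - {cls (Zf j)} \<subseteq> ?N"
    proof
      fix T assume "T \<in> ?B - {cls (Zf j)}"
      then obtain i where i: "i \<in> J" "i \<noteq> j" "T = cls (Zf i)" by auto
      then have "x \<in> carrier_vec n" if "x \<in> T" for x
        using that boundaryD Zn by (auto simp: cls_eq)
      then show "T \<in> ?N"
        using i pairing_cls[OF i(1) j(1)] dual[OF i(1) j(1)] Z[OF i(1)] by (auto simp: carrier_H)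
    qed
    ultimately have "cls (Zf j) \<in> ?N" using j(2) H.span_is_subset by blast
    then show False using self[OF j(1)] dual[OF j(1) j(1)] by auto
  qed
  ultimately show "family_basis class_ring H J (\<lambda>j. cls (Zf j))"
    using inj B by (simp add: family_basis_def H.basis_def)
  assume S: "Zf ` J \<subseteq> S" "S \<subseteq> mat_kernel D1"
  then have Sn: "S \<subseteq> carrier_vec n" using kernelD by blast
  have ZS: "binary_span n (Zf ` J) \<subseteq> binary_span n S"
    using S(1) binary_span_superset[OF Sn] by (intro binary_span_subset binary_span_closed Sn) blast
  have "cls ` binary_span n S = carrier H"
  proof
    show "cls ` binary_span n S \<subseteq> carrier H"
      unfolding carrier_H by (intro image_mono binary_span_subset S(2) kernel_closed)
    show "carrier H \<subseteq> cls ` binary_span n S"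
    proof
      fix T assume "T \<in> carrier H"
      then obtain v where v: "v \<in> mat_kernel D1" "T = cls v" by (auto simp: carrier_H)
      then obtain s w where sw: "s \<in> binary_span n (Zf ` J)" "w \<in> carrier_vec k" "v = s + D2 *\<^sub>v w"
        using span by blast
      then have "D2 *\<^sub>v w \<in> boundaries D2" using D2 by (auto simp: boundaries_def)
      then have "T = cls s"
        using sw v span_kernel kernelD by (auto simp: cls_add_boundary)
      then show "T \<in> cls ` binary_span n S" using sw(1) ZS by blast
    qed
  qed
  then show "generates_homology D1 D2 S"
    using S(2) D1 by (simp add: generates_homology_def)
qed

end

section \<open>Kronecker products of vectors\<close>

lemma sum_div_mod:
  fixes f :: "nat \<Rightarrow> nat \<Rightarrow> 'a::comm_monoid_add"
  shows "(\<Sum>s<n1 * n2. f (s div n2) (s mod n2)) = (\<Sum>p<n1. \<Sum>q<n2. f p q)"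
proof (cases "n2 = 0")
  case False
  have bound: "p * n2 + q < n1 * n2" if "p < n1" "q < n2" for p q
    using mult_le_mono1[of "Suc p" n1 n2] that by simp
  show ?thesis
    unfolding sum.cartesian_product
    by (rule sum.reindex_bij_witness[of _ "\<lambda>(p, q). p * n2 + q" "\<lambda>r. (r div n2, r mod n2)"])
      (use False bound in \<open>auto simp: less_mult_imp_div_less\<close>)
qed simp

lemma kron_vec_dim [simp]: "dim_vec (kron_vec u v) = dim_vec u * dim_vec v"
  by (simp add: kron_vec_def)

lemma kron_vec_carrier [simp]:
  "u \<in> carrier_vec m \<Longrightarrow> v \<in> carrier_vec n \<Longrightarrow> kron_vec u v \<in> carrier_vec (m * n)"
  by (intro carrier_vecI) simp

lemma kron_vec_index:
  "r < dim_vec u * dim_vec v \<Longrightarrow> kron_vec u v $ r = u $ (r div dim_vec v) * v $ (r mod dim_vec v)"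
  by (simp add: kron_vec_def)

lemma kron_vec_smult_left: "kron_vec (f \<cdot>\<^sub>v u) v = f \<cdot>\<^sub>v kron_vec u (v :: 'a::comm_ring_1 vec)"
  by (intro eq_vecI) (auto simp: kron_vec_index div_mod_less_mult mult.assoc)

lemma kron_vec_smult_right: "kron_vec u (f \<cdot>\<^sub>v v) = f \<cdot>\<^sub>v kron_vec u (v :: 'a::comm_ring_1 vec)"
  by (intro eq_vecI) (auto simp: kron_vec_index div_mod_less_mult mult.left_commute)

lemma kron_vec_zero_left: "kron_vec (0\<^sub>v m) v = (0\<^sub>v (m * dim_vec v) :: 'a::comm_ring_1 vec)"
  by (intro eq_vecI) (auto simp: kron_vec_index div_mod_less_mult)

lemma kron_vec_zero_right: "kron_vec u (0\<^sub>v m) = (0\<^sub>v (dim_vec u * m) :: 'a::comm_ring_1 vec)"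
  by (intro eq_vecI) (auto simp: kron_vec_index div_mod_less_mult)

lemma kron_mat_mult_kron_vec:
  fixes C D :: "'a::comm_ring_1 mat"
  assumes C: "C \<in> carrier_mat m1 n1" and D: "D \<in> carrier_mat m2 n2"
    and u: "u \<in> carrier_vec n1" and v: "v \<in> carrier_vec n2"
  shows "kron_mat C D *\<^sub>v kron_vec u v = kron_vec (C *\<^sub>v u) (D *\<^sub>v v)"
proof (rule eq_vecI)
  fix r assume "r < dim_vec (kron_vec (C *\<^sub>v u) (D *\<^sub>v v))"
  then have r: "r < m1 * m2" using C D by simp
  note r' = div_mod_less_mult[OF r]
  have "(kron_mat C D *\<^sub>v kron_vec u v) $ r =
      (\<Sum>s<n1 * n2. (C $$ (r div m2, s div n2) * u $ (s div n2)) * (D $$ (r mod m2, s mod n2) * v $ (s mod n2)))"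
    unfolding mult_mat_vec_index[OF kron_mat_carrier[OF C D] kron_vec_carrier[OF u v] r]
    using C D u v r by (intro sum.cong refl) (simp add: kron_index kron_vec_index mult_ac)
  also have "\<dots> = (\<Sum>p<n1. \<Sum>q<n2. (C $$ (r div m2, p) * u $ p) * (D $$ (r mod m2, q) * v $ q))"
    by (rule sum_div_mod)
  also have "\<dots> = (C *\<^sub>v u) $ (r div m2) * (D *\<^sub>v v) $ (r mod m2)"
    by (simp only: sum_product mult_mat_vec_index[OF C u r'(1)] mult_mat_vec_index[OF D v r'(2)])
  also have "\<dots> = kron_vec (C *\<^sub>v u) (D *\<^sub>v v) $ r"
    using C D r by (simp add: kron_vec_index)
  finally show "(kron_mat C D *\<^sub>v kron_vec u v) $ r = kron_vec (C *\<^sub>v u) (D *\<^sub>v v) $ r" .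
qed (use C D in simp)

lemma kron_vec_scalar_prod:
  fixes u v :: "'a::comm_ring_1 vec"
  assumes "u \<in> carrier_vec m" "u' \<in> carrier_vec m" "v \<in> carrier_vec n" "v' \<in> carrier_vec n"
  shows "kron_vec u v \<bullet> kron_vec u' v' = (u \<bullet> u') * (v \<bullet> v')"
proof -
  have "kron_vec u v \<bullet> kron_vec u' v' =
      (\<Sum>s<m * n. (u $ (s div n) * u' $ (s div n)) * (v $ (s mod n) * v' $ (s mod n)))"
    using assms unfolding scalar_prod_def
    by (intro sum.cong) (auto simp: kron_vec_index mult_ac)
  also have "\<dots> = (\<Sum>p<m. \<Sum>q<n. (u $ p * u' $ p) * (v $ q * v' $ q))"
    by (rule sum_div_mod)
  also have "\<dots> = (u \<bullet> u') * (v \<bullet> v')"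
    using assms by (simp add: sum_product scalar_prod_def atLeast0LessThan)
  finally show ?thesis .
qed

lemma map_vec_conj_kron_vec:
  "map_vec cyc_conj (kron_vec u v) = kron_vec (map_vec cyc_conj u) (map_vec cyc_conj v)"
  by (intro eq_vecI) (auto simp: kron_vec_index div_mod_less_mult cyc_conj_mult)

lemma map_vec_append: "map_vec f (u @\<^sub>v v) = map_vec f u @\<^sub>v map_vec f v"
  by (intro eq_vecI) auto

lemma pairing_append:
  assumes "u \<in> carrier_vec m" "u' \<in> carrier_vec m" "v \<in> carrier_vec n" "v' \<in> carrier_vec n"
  shows "pairing (u @\<^sub>v v) (u' @\<^sub>v v') = pairing u u' + pairing v v'"
  using assms
  by (simp add: pairing_eq_scalar_prod map_vec_append scalar_prod_append[of _ m _ n] cyc_coeff_add)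

lemma pairing_zero_right: "u \<in> carrier_vec n \<Longrightarrow> pairing u (0\<^sub>v n) = 0"
  by (simp add: pairing_def cyc_coeff_0)

lemma append_cols_mult_vec:
  fixes C D :: "'a::comm_ring_1 mat"
  assumes "C \<in> carrier_mat m n1" "D \<in> carrier_mat m n2" "u \<in> carrier_vec n1" "v \<in> carrier_vec n2"
  shows "append_cols C D *\<^sub>v (u @\<^sub>v v) = C *\<^sub>v u + D *\<^sub>v v"
  unfolding append_cols_def using assms
  by (subst four_block_mat_mult_vec[of _ m n1 _ n2 _ 0]) (auto intro!: eq_vecI)

lemma conj_transpose_kron_mat:
  "conj_transpose (kron_mat C D) = kron_mat (conj_transpose C) (conj_transpose D)"
  by (intro eq_matI) (auto simp: conj_transpose_def kron_index div_mod_less_mult cyc_conj_mult)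

lemma conj_transpose_append_rows:
  assumes "C \<in> carrier_mat m1 n" "D \<in> carrier_mat m2 n"
  shows "conj_transpose (C @\<^sub>r D) = append_cols (conj_transpose C) (conj_transpose D)"
  using assms
  by (intro eq_matI) (auto simp: conj_transpose_def append_rows_def append_cols_def)

lemma conj_transpose_mult_conj_vec:
  assumes "C \<in> carrier_mat m n" "v \<in> carrier_vec m"
  shows "conj_transpose C *\<^sub>v map_vec cyc_conj v = map_vec cyc_conj (transpose_mat C *\<^sub>v v)"
  using assms
  by (intro eq_vecI) (auto simp: conj_transpose_def scalar_prod_def cyc_conj_sum cyc_conj_mult)


section \<open>Ranges of Kronecker products of projections\<close>

text \<open>Sums of vectors are written entrywise, so that the empty sum still has dimension
  \<open>N\<close>.\<close>

lemma vec_sum_closed: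
  assumes T: "vec_additive_closed N T" and f: "\<And>j. j \<in> J \<Longrightarrow> f j \<in> T"
  shows "vec N (\<lambda>r. \<Sum>j\<in>J. f j $ r) \<in> T"
  using f
proof (induction J rule: infinite_finite_induct)
  case (insert j J)
  have "f j \<in> carrier_vec N" using T insert.prems by (auto simp: vec_additive_closed_def)
  then have "vec N (\<lambda>r. \<Sum>j\<in>insert j J. f j $ r) = f j + vec N (\<lambda>r. \<Sum>j\<in>J. f j $ r)"
    using insert.hyps by (intro eq_vecI) auto
  then show ?case using insert T by (auto simp: vec_additive_closed_def)
qed (use T in \<open>auto simp: vec_additive_closed_def zero_vec_def\<close>)

lemma sum_product_orthogonal:
  fixes x y :: "nat \<Rightarrow> 'a::comm_ring_1"
  assumes "\<And>i j. i < t \<Longrightarrow> j < t \<Longrightarrow> i \<noteq> j \<Longrightarrow> x i * y j = 0"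
  shows "(\<Sum>i<t. x i) * (\<Sum>j<t. y j) = (\<Sum>i<t. x i * y i)"
proof -
  have "(\<Sum>j<t. x i * y j) = x i * y i" if i: "i < t" for i
  proof -
    have "(\<Sum>j<t. x i * y j) = (\<Sum>j<t. if j = i then x i * y i else 0)"
      using assms i by (intro sum.cong) auto
    then show ?thesis using i by simp
  qed
  then show ?thesis by (simp add: sum_product)
qed

lemma select_cols_carrier [simp]: "select_cols t n a I \<in> carrier_mat n n"
  by (simp add: select_cols_def)

lemma conj_transpose_select_cols:
  assumes "\<And>i j. i < t \<Longrightarrow> a i j \<in> carrier_vec n"
  shows "conj_transpose (select_cols t n a I) =
    transpose_mat (select_cols t n (\<lambda>i j. map_vec cyc_conj (a i j)) I)"
  using assms
  by (intro eq_matI)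
    (auto simp: conj_transpose_def select_cols_def cyc_conj_sum carrier_vecD[OF assms] intro!: sum.cong)

lemma conj_transpose_transpose_select_cols:
  assumes "\<And>i j. i < t \<Longrightarrow> a i j \<in> carrier_vec n"
  shows "conj_transpose (transpose_mat (select_cols t n a I)) =
    select_cols t n (\<lambda>i j. map_vec cyc_conj (a i j)) I"
  using assms
  by (intro eq_matI)
    (auto simp: conj_transpose_def select_cols_def cyc_conj_sum carrier_vecD[OF assms] intro!: sum.cong)

context
  fixes t N1 N2 :: nat and T :: "('l::finite) cyc vec set" and a d :: "nat \<Rightarrow> nat \<Rightarrow> 'l cyc vec"
    and I K :: "nat \<Rightarrow> nat set" and z :: "'l cyc vec"
  assumes T: "vec_additive_closed (N1 * N2) T" and z: "z \<in> carrier_vec (N1 * N2)"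
    and K: "\<And>i. i < t \<Longrightarrow> finite (K i)"
begin

text \<open>In component \<open>i\<close>, column \<open>s\<close> of the product is
  \<open>a i (s div N2)\<close> tensored with the entries \<open>d i q $ (s mod N2)\<close> at the
  positions \<open>q \<in> K i\<close>. Products of different components vanish by
  \<open>orth\<close>, so the image is generated over \<open>R\<close> by tensors with a common
  \<open>i\<close>; hence the arbitrary scalar \<open>f\<close> in \<open>gen\<close>.\<close>

lemma kron_select_cols_rows_mem:
  assumes a: "\<And>i j. i < t \<Longrightarrow> a i j \<in> carrier_vec N1"
    and orth: "\<And>i j p q r s. i < t \<Longrightarrow> j < t \<Longrightarrow> i \<noteq> j \<Longrightarrow> r < N1 \<Longrightarrow> s < N2 \<Longrightarrow> a i p $ r * d j q $ s = 0"
    and gen: "\<And>i p q f. i < t \<Longrightarrow> p \<in> I i \<Longrightarrow> q \<in> K i \<Longrightarrow> f \<cdot>\<^sub>v kron_vec (a i p) (unit_vec N2 q) \<in> T"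
  shows "kron_mat (select_cols t N1 a I) (transpose_mat (select_cols t N2 d K)) *\<^sub>v z \<in> T"
proof -
  let ?M = "kron_mat (select_cols t N1 a I) (transpose_mat (select_cols t N2 d K))"
  \<comment> \<open>The contribution of input entry \<open>s\<close>, through component
    \<open>i\<close>, to output position \<open>q\<close> of the second factor.\<close>
  define F where "F s i q = (if s div N2 \<in> I i
    then (d i q $ (s mod N2) * z $ s) \<cdot>\<^sub>v kron_vec (a i (s div N2)) (unit_vec N2 q) else 0\<^sub>v (N1 * N2))" for s i q
  define F1 where "F1 s i = vec (N1 * N2) (\<lambda>r. \<Sum>q\<in>K i. F s i q $ r)" for s i
  define F2 where "F2 s = vec (N1 * N2) (\<lambda>r. \<Sum>i<t. F1 s i $ r)" for s
  have "F s i q \<in> T" if "i < t" "q \<in> K i" for s i q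
    using T gen[OF that(1) _ that(2)] by (auto simp: F_def vec_additive_closed_def)
  then have "F1 s i \<in> T" if "i < t" for s i
    unfolding F1_def using that by (intro vec_sum_closed[OF T])
  then have "F2 s \<in> T" for s
    unfolding F2_def by (intro vec_sum_closed[OF T]) simp
  then have "vec (N1 * N2) (\<lambda>r. \<Sum>s<N1 * N2. F2 s $ r) \<in> T"
    by (intro vec_sum_closed[OF T])
  moreover have "vec (N1 * N2) (\<lambda>r. \<Sum>s<N1 * N2. F2 s $ r) = ?M *\<^sub>v z"
  proof (rule eq_vecI)
    fix r assume "r < dim_vec (?M *\<^sub>v z)"
    then have r: "r < N1 * N2" by (simp add: select_cols_def)
    note r' = div_mod_less_mult[OF r]
    have "F2 s $ r = ?M $$ (r, s) * z $ s" if s: "s < N1 * N2" for s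
    proof -
      note s' = div_mod_less_mult[OF s]
      let ?x = "\<lambda>i. if s div N2 \<in> I i then a i (s div N2) $ (r div N2) else 0"
      let ?y = "\<lambda>i. if r mod N2 \<in> K i then d i (r mod N2) $ (s mod N2) else 0"
      have "F1 s i $ r = ?x i * ?y i * z $ s" if i: "i < t" for i
      proof -
        have "F1 s i $ r = (\<Sum>q\<in>K i. if q = r mod N2 then ?x i * d i q $ (s mod N2) * z $ s else 0)"
          unfolding F1_def using r r' carrier_vecD[OF a[OF i]]
          by (auto simp: F_def kron_vec_index unit_vec_def mult_ac intro!: sum.cong)
        then show ?thesis using K[OF i] by simp
      qed
      then have "F2 s $ r = (\<Sum>i<t. ?x i * ?y i) * z $ s"
        using r by (simp add: F2_def sum_distrib_right)
      also have "(\<Sum>i<t. ?x i * ?y i) = (\<Sum>i<t. ?x i) * (\<Sum>i<t. ?y i)"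
        using orth r' s' by (intro sum_product_orthogonal[symmetric]) auto
      also have "\<dots> = ?M $$ (r, s)"
        using r s r' s' by (simp add: kron_index select_cols_def)
      finally show ?thesis .
    qed
    then show "vec (N1 * N2) (\<lambda>r. \<Sum>s<N1 * N2. F2 s $ r) $ r = (?M *\<^sub>v z) $ r"
      using r z by (subst mult_mat_vec_index[of _ "N1 * N2" "N1 * N2"]) simp_all
  qed (simp add: select_cols_def)
  ultimately show ?thesis by simp
qed

text \<open>The mirror image, with the tensor factors exchanged.\<close>

lemma kron_select_rows_cols_mem:
  assumes a: "\<And>i j. i < t \<Longrightarrow> a i j \<in> carrier_vec N2"
    and orth: "\<And>i j p q r s. i < t \<Longrightarrow> j < t \<Longrightarrow> i \<noteq> j \<Longrightarrow> r < N2 \<Longrightarrow> s < N1 \<Longrightarrow> a i p $ r * d j q $ s = 0"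
    and gen: "\<And>i p q f. i < t \<Longrightarrow> p \<in> I i \<Longrightarrow> q \<in> K i \<Longrightarrow> f \<cdot>\<^sub>v kron_vec (unit_vec N1 q) (a i p) \<in> T"
  shows "kron_mat (transpose_mat (select_cols t N1 d K)) (select_cols t N2 a I) *\<^sub>v z \<in> T"
proof -
  let ?M = "kron_mat (transpose_mat (select_cols t N1 d K)) (select_cols t N2 a I)"
  define F where "F s i q = (if s mod N2 \<in> I i
    then (d i q $ (s div N2) * z $ s) \<cdot>\<^sub>v kron_vec (unit_vec N1 q) (a i (s mod N2)) else 0\<^sub>v (N1 * N2))" for s i q
  define F1 where "F1 s i = vec (N1 * N2) (\<lambda>r. \<Sum>q\<in>K i. F s i q $ r)" for s i
  define F2 where "F2 s = vec (N1 * N2) (\<lambda>r. \<Sum>i<t. F1 s i $ r)" for s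
  have "F s i q \<in> T" if "i < t" "q \<in> K i" for s i q
    using T gen[OF that(1) _ that(2)] by (auto simp: F_def vec_additive_closed_def)
  then have "F1 s i \<in> T" if "i < t" for s i
    unfolding F1_def using that by (intro vec_sum_closed[OF T])
  then have "F2 s \<in> T" for s
    unfolding F2_def by (intro vec_sum_closed[OF T]) simp
  then have "vec (N1 * N2) (\<lambda>r. \<Sum>s<N1 * N2. F2 s $ r) \<in> T"
    by (intro vec_sum_closed[OF T])
  moreover have "vec (N1 * N2) (\<lambda>r. \<Sum>s<N1 * N2. F2 s $ r) = ?M *\<^sub>v z"
  proof (rule eq_vecI)
    fix r assume "r < dim_vec (?M *\<^sub>v z)"
    then have r: "r < N1 * N2" by (simp add: select_cols_def)
    note r' = div_mod_less_mult[OF r]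
    have "F2 s $ r = ?M $$ (r, s) * z $ s" if s: "s < N1 * N2" for s
    proof -
      note s' = div_mod_less_mult[OF s]
      let ?x = "\<lambda>i. if s mod N2 \<in> I i then a i (s mod N2) $ (r mod N2) else 0"
      let ?y = "\<lambda>i. if r div N2 \<in> K i then d i (r div N2) $ (s div N2) else 0"
      have "F1 s i $ r = ?x i * ?y i * z $ s" if i: "i < t" for i
      proof -
        have "F1 s i $ r = (\<Sum>q\<in>K i. if q = r div N2 then ?x i * d i q $ (s div N2) * z $ s else 0)"
          unfolding F1_def using r r' carrier_vecD[OF a[OF i]]
          by (auto simp: F_def kron_vec_index unit_vec_def mult_ac intro!: sum.cong)
        then show ?thesis using K[OF i] by simp
      qed
      then have "F2 s $ r = (\<Sum>i<t. ?x i * ?y i) * z $ s"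
        using r by (simp add: F2_def sum_distrib_right)
      also have "(\<Sum>i<t. ?x i * ?y i) = (\<Sum>i<t. ?x i) * (\<Sum>i<t. ?y i)"
        using orth r' s' by (intro sum_product_orthogonal[symmetric]) auto
      also have "\<dots> = ?M $$ (r, s)"
        using r s r' s' by (simp add: kron_index select_cols_def mult.commute)
      finally show ?thesis .
    qed
    then show "vec (N1 * N2) (\<lambda>r. \<Sum>s<N1 * N2. F2 s $ r) $ r = (?M *\<^sub>v z) $ r"
      using r z by (subst mult_mat_vec_index[of _ "N1 * N2" "N1 * N2"]) simp_all
  qed (simp add: select_cols_def)
  ultimately show ?thesis by simp
qed

end

text \<open>Pulling a subgroup back along the inclusion of a sector lets membership in a span of the
  whole middle term be checked sector by sector.\<close>

lemma vec_additive_closed_left_sector: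
  assumes "vec_additive_closed (m + n) T"
  shows "vec_additive_closed m {u \<in> carrier_vec m. u @\<^sub>v 0\<^sub>v n \<in> T}"
proof -
  have "(u + v) @\<^sub>v 0\<^sub>v n = (u @\<^sub>v 0\<^sub>v n) + (v @\<^sub>v 0\<^sub>v n)" if "u \<in> carrier_vec m" "v \<in> carrier_vec m" for u v :: "'a cyc vec"
    using that by (intro eq_vecI) auto
  moreover have "0\<^sub>v m @\<^sub>v 0\<^sub>v n = (0\<^sub>v (m + n) :: 'a cyc vec)" by (intro eq_vecI) auto
  ultimately show ?thesis using assms by (auto simp: vec_additive_closed_def)
qed

lemma vec_additive_closed_right_sector:
  assumes "vec_additive_closed (m + n) T"
  shows "vec_additive_closed n {u \<in> carrier_vec n. 0\<^sub>v m @\<^sub>v u \<in> T}"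
proof -
  have "0\<^sub>v m @\<^sub>v (u + v) = (0\<^sub>v m @\<^sub>v u) + (0\<^sub>v m @\<^sub>v v)" if "u \<in> carrier_vec n" "v \<in> carrier_vec n" for u v :: "'a cyc vec"
    using that by (intro eq_vecI) auto
  moreover have "0\<^sub>v m @\<^sub>v 0\<^sub>v n = (0\<^sub>v (m + n) :: 'a cyc vec)" by (intro eq_vecI) auto
  ultimately show ?thesis using assms by (auto simp: vec_additive_closed_def)
qed

text \<open>For fixed \<open>u\<close> this turns membership of multiples of \<open>u\<close> into a
  question about a subgroup of \<open>R\<close>, the form in which the spanning statements for
  \<open>c i R\<close> apply.\<close>

lemma smult_additive_closed:
  assumes "vec_additive_closed n T" "u \<in> carrier_vec n"
  shows "additive_closed {g. g \<cdot>\<^sub>v u \<in> T}"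
proof -
  have "0 \<cdot>\<^sub>v u = 0\<^sub>v n" using assms(2) by auto
  then show ?thesis
    using assms(1) by (auto simp: vec_additive_closed_def additive_closed_def add_smult_distrib_vec)
qed

lemma block_diagonal_mult_vec_mem:
  fixes M1 M2 :: "('l::finite) cyc mat"
  assumes T: "vec_additive_closed (m + n) T"
    and M: "M1 \<in> carrier_mat m m" "M2 \<in> carrier_mat n n"
    and L: "\<And>u. u \<in> carrier_vec m \<Longrightarrow> M1 *\<^sub>v u \<in> {u \<in> carrier_vec m. u @\<^sub>v 0\<^sub>v n \<in> T}"
    and R: "\<And>u. u \<in> carrier_vec n \<Longrightarrow> M2 *\<^sub>v u \<in> {u \<in> carrier_vec n. 0\<^sub>v m @\<^sub>v u \<in> T}"
    and z: "z \<in> carrier_vec (m + n)"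
  shows "four_block_mat M1 (0\<^sub>m m n) (0\<^sub>m n m) M2 *\<^sub>v z \<in> T"
proof -
  obtain u v where uv: "u \<in> carrier_vec m" "v \<in> carrier_vec n" "z = u @\<^sub>v v"
    using z by (metis vec_first_carrier vec_first_last_append vec_last_carrier)
  have "four_block_mat M1 (0\<^sub>m m n) (0\<^sub>m n m) M2 *\<^sub>v z = (M1 *\<^sub>v u) @\<^sub>v (M2 *\<^sub>v v)"
    unfolding uv(3) using M uv
    by (subst four_block_mat_mult_vec[of _ m m _ n _ n]) auto
  also have "\<dots> = ((M1 *\<^sub>v u) @\<^sub>v 0\<^sub>v n) + (0\<^sub>v m @\<^sub>v (M2 *\<^sub>v v))"
    using M uv by (intro eq_vecI) auto
  also have "\<dots> \<in> T" using T L[OF uv(1)] R[OF uv(2)] by (auto simp: vec_additive_closed_def)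
  finally show ?thesis .
qed

section \<open>Logical operators\<close>

lemma transpose_map_mat: "transpose_mat (map_mat f C) = map_mat f (transpose_mat C)"
  by (intro eq_matI) auto

text \<open>Reduces cokernel vectors to kernel vectors of the transposed matrix, so that the facts
  about \<open>zeta\<close> serve all four families.\<close>

lemma xi_bar_eq: "xi_bar c \<beta> C I j = map_vec cyc_conj (zeta c \<beta> (transpose_mat C) I j)"
  by (intro eq_vecI) (simp_all add: xi_bar_def zeta_def transpose_map_mat)

context cyc_component_bases
begin

lemma set_exponents: "set (exponents b e i) = e i ` {..<degree (b i)}"
  by (auto simp: exponents_def atLeast0LessThan)

text \<open>For \<open>i = i'\<close> the idempotents collapse to one, and the conjugate of
  \<open>x^m'\<close> reads off coefficient \<open>m'\<close> of \<open>c i * h i m\<close>, which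
  \<open>dual\<close> prescribes. For different components the idempotents annihilate each other
  whatever \<open>y\<close> and \<open>y'\<close> are. \<open>P\<close> and \<open>Q\<close> stand
  for the coincidence of position indices.\<close>

lemma coefficient_orthogonality:
  assumes i: "i < t" "i' < t" and m: "m \<in> set (exponents b e i)" "m' \<in> set (exponents b e i')"
    and y: "i = i' \<Longrightarrow> y = (if P then c i else 0)" "i = i' \<Longrightarrow> y' = (if Q then c i else 0)"
  shows "cyc_coeff ((c i * h i m) * (c i' * cyc_conj (cyc_x ^ m')) * (y * y')) 0 =
    (if i = i' \<and> m = m' \<and> P \<and> Q then 1 else 0)"
proof (cases "i = i'")
  case False
  have "(c i * h i m) * (c i' * cyc_conj (cyc_x ^ m')) * (y * y') =
      (c i * c i') * (h i m * cyc_conj (cyc_x ^ m') * (y * y'))"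
    by (simp only: mult_ac)
  then show ?thesis using False i by (simp add: idempotent_orthogonal cyc_coeff_0)
next
  case True
  obtain k k' where k: "k < degree (b i)" "m = e i k" "k' < degree (b i)" "m' = e i k'"
    using m True by (auto simp: set_exponents)
  have "(m = m') = (k' = k)"
    using exponent_distinct[OF i(1)] k by (auto dest: inj_onD)
  moreover have "(c i * h i m) * (c i * cyc_conj (cyc_x ^ m')) * (c i * c i) =
      (c i * c i) * (c i * c i) * (h i m * cyc_conj (cyc_x ^ m'))"
    by (simp only: mult_ac)
  then have "(c i * h i m) * (c i * cyc_conj (cyc_x ^ m')) * (c i * c i) =
      (c i * h i m) * cyc_conj (cyc_x ^ m')"
    by (simp only: idempotent[OF i(1)] mult.assoc)
  moreover have "cyc_coeff ((c i * h i m) * cyc_conj (cyc_x ^ m')) 0 = (if k' = k then 1 else 0)"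
    using dual[OF i(1) k(3) k(1)] exponent_range[OF i(1) k(3)] k
    by (simp add: cyc_coeff_mult_conj_x_power)
  ultimately show ?thesis
    using True y by (auto simp: cyc_coeff_0)
qed

end

locale lifted_product = cyc_component_bases t b \<beta> c e h
  for t b \<beta> e and c :: "nat \<Rightarrow> ('l::finite) cyc" and h +
  fixes A B :: "'l cyc mat" and mA nA mB nB :: nat and IA IAs IB IBs :: "nat \<Rightarrow> nat set"
  assumes A: "A \<in> carrier_mat mA nA" and B: "B \<in> carrier_mat mB nB"
    and info_A: "\<And>i. i < t \<Longrightarrow>
      information_set (\<beta> i) nA (kernel_code (\<beta> i) (map_mat (cyc_eval (\<beta> i)) A)) (IA i)"
    and info_A_star: "\<And>i. i < t \<Longrightarrow>
      information_set (\<beta> i) mA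
        (kernel_code (\<beta> i) (transpose_mat (map_mat (cyc_eval (\<beta> i)) A))) (IAs i)"
    and info_B: "\<And>i. i < t \<Longrightarrow>
      information_set (\<beta> i) nB (kernel_code (\<beta> i) (map_mat (cyc_eval (\<beta> i)) B)) (IB i)"
    and info_B_star: "\<And>i. i < t \<Longrightarrow>
      information_set (\<beta> i) mB
        (kernel_code (\<beta> i) (transpose_mat (map_mat (cyc_eval (\<beta> i)) B))) (IBs i)"
begin

lemma dims [simp]: "dim_row A = mA" "dim_col A = nA" "dim_row B = mB" "dim_col B = nB"
  using A B by auto

lemma AT: "transpose_mat A \<in> carrier_mat nA mA" and BT: "transpose_mat B \<in> carrier_mat nB mB"
  using A B by simp_all

lemmas info_AT = info_A_star[unfolded transpose_map_mat]
  and info_BT = info_B_star[unfolded transpose_map_mat]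

abbreviation "zA i \<equiv> zeta (c i) (\<beta> i) A (IA i)"
abbreviation "zB i \<equiv> zeta (c i) (\<beta> i) B (IB i)"
abbreviation "xA i \<equiv> zeta (c i) (\<beta> i) (transpose_mat A) (IAs i)"
abbreviation "xB i \<equiv> zeta (c i) (\<beta> i) (transpose_mat B) (IBs i)"
abbreviation "J \<equiv> logical_index t b e IA IAs IB IBs"
abbreviation "supZ \<equiv> supp_Z c \<beta> h A B IA IB"
abbreviation "supX \<equiv> supp_X c \<beta> A B IAs IBs"
abbreviation "N \<equiv> nA * mB + mA * nB"
abbreviation "D1 \<equiv> lp_boundary1 A B"
abbreviation "D2 \<equiv> lp_boundary2 A B"

lemmas z_carrier = zeta_carrier[OF A info_A] zeta_carrier[OF B info_B]
  zeta_carrier[OF AT info_AT] zeta_carrier[OF BT info_BT]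

lemmas z_dim = z_carrier[THEN carrier_vecD]

lemmas z_index = zeta_index[OF A info_A] zeta_index[OF B info_B]
  zeta_index[OF AT info_AT] zeta_index[OF BT info_BT]

lemma z_idempotent:
  "i < t \<Longrightarrow> r < nA \<Longrightarrow> c i * zA i j $ r = zA i j $ r"
  "i < t \<Longrightarrow> r < nB \<Longrightarrow> c i * zB i j $ r = zB i j $ r"
  "i < t \<Longrightarrow> r < mA \<Longrightarrow> c i * xA i j $ r = xA i j $ r"
  "i < t \<Longrightarrow> r < mB \<Longrightarrow> c i * xB i j $ r = xB i j $ r"
  by (simp_all add: idempotent_mult_zeta[OF A info_A] idempotent_mult_zeta[OF B info_B]
    idempotent_mult_zeta[OF AT info_AT] idempotent_mult_zeta[OF BT info_BT])

lemmas z_finite = information_finite[OF A info_A] information_finite[OF B info_B]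
  information_finite[OF AT info_AT] information_finite[OF BT info_BT]

lemma index_bounds:
  "i < t \<Longrightarrow> j \<in> IA i \<Longrightarrow> j < nA" "i < t \<Longrightarrow> j \<in> IB i \<Longrightarrow> j < nB"
  "i < t \<Longrightarrow> j \<in> IAs i \<Longrightarrow> j < mA" "i < t \<Longrightarrow> j \<in> IBs i \<Longrightarrow> j < mB"
  using info_A[of i] info_B[of i] info_A_star[of i] info_B_star[of i]
  by (auto simp: information_set_def)

lemma z_orthogonal:
  assumes "i < t" "j < t" "i \<noteq> j"
    and "c i * f = f" "c j * g = g"
  shows "f * g = 0"
proof -
  have "f * g = (c i * c j) * (f * g)" using assms(4,5) by (metis mult.assoc mult.left_commute)
  then show ?thesis using assms by (simp add: idempotent_orthogonal)
qed

definition "J_left = (SIGMA i:{..<t}. IA i \<times> IBs i \<times> set (exponents b e i))"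
definition "J_right = (SIGMA i:{..<t}. IAs i \<times> IB i \<times> set (exponents b e i))"

lemma J_eq: "J = Pair LeftSector ` J_left \<union> Pair RightSector ` J_right"
  by (auto simp: logical_index_def J_left_def J_right_def)

lemma finite_J_sectors: "finite J_left" "finite J_right"
  using z_finite by (auto simp: J_left_def J_right_def)

lemma finite_J: "finite J"
  using finite_J_sectors by (simp add: J_eq)

lemma J_cases:
  assumes "k \<in> J"
  obtains (Left) i p q m where "k = (LeftSector, i, p, q, m)" "i < t" "p \<in> IA i" "q \<in> IBs i" "m \<in> set (exponents b e i)"
  | (Right) i p q m where "k = (RightSector, i, p, q, m)" "i < t" "p \<in> IAs i" "q \<in> IB i" "m \<in> set (exponents b e i)"
  using assms by (auto simp: logical_index_def)

text \<open>Here and in the next three lemmas the scalar is pulled out of the tensor product,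
  leaving a fixed vector whose multiples can be studied as a subgroup of \<open>R\<close>.\<close>

lemma supZ_left:
  "supZ (LeftSector, i, p, q, m) = (c i * h i m) \<cdot>\<^sub>v kron_vec (zA i p) (unit_vec mB q) @\<^sub>v 0\<^sub>v (mA * nB)"
  by (simp add: kron_vec_smult_left)

lemma supZ_right:
  "supZ (RightSector, i, p, q, m) = 0\<^sub>v (nA * mB) @\<^sub>v (c i * h i m) \<cdot>\<^sub>v kron_vec (unit_vec mA p) (zB i q)"
  by (simp add: kron_vec_smult_left mult.commute)

lemma supX_left:
  "supX (LeftSector, i, p, q, m) =
    (cyc_conj (c i) * cyc_x ^ m) \<cdot>\<^sub>v kron_vec (unit_vec nA p) (map_vec cyc_conj (xB i q)) @\<^sub>v 0\<^sub>v (mA * nB)"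
  by (simp add: kron_vec_smult_left xi_bar_eq)

lemma supX_right:
  "supX (RightSector, i, p, q, m) = 0\<^sub>v (nA * mB) @\<^sub>v
    (cyc_conj (c i) * cyc_x ^ m) \<cdot>\<^sub>v kron_vec (map_vec cyc_conj (xA i p)) (unit_vec nB q)"
  by (simp add: kron_vec_smult_left xi_bar_eq mult.commute)

declare supp_Z.simps [simp del] supp_X.simps [simp del]

lemma supZ_carrier: "k \<in> J \<Longrightarrow> supZ k \<in> carrier_vec N"
  by (erule J_cases) (simp_all add: supZ_left supZ_right z_carrier)

lemma supX_carrier: "k \<in> J \<Longrightarrow> supX k \<in> carrier_vec N"
  by (erule J_cases) (simp_all add: supX_left supX_right z_carrier)

lemma boundary_carrier: "D1 \<in> carrier_mat (mA * mB) N" "D2 \<in> carrier_mat N (nA * nB)"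
  using A B unfolding lp_boundary1_def lp_boundary2_def
  by (auto intro!: append_cols_carrier carrier_append_rows)

lemma mult_mat_zero_vec: "C \<in> carrier_mat m n \<Longrightarrow> C *\<^sub>v 0\<^sub>v n = 0\<^sub>v m" for C :: "'l cyc mat"
  by (intro eq_vecI) auto

lemma mult_mat_smult_vec:
  "C \<in> carrier_mat m n \<Longrightarrow> u \<in> carrier_vec n \<Longrightarrow> C *\<^sub>v (f \<cdot>\<^sub>v u) = f \<cdot>\<^sub>v (C *\<^sub>v u)" for C :: "'l cyc mat"
  by (intro eq_vecI) auto

lemma append_cols_mult_left_zero:
  fixes C D :: "'l cyc mat"
  assumes "C \<in> carrier_mat m n1" "D \<in> carrier_mat m n2" "u \<in> carrier_vec n1" "C *\<^sub>v u = 0\<^sub>v m"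
  shows "append_cols C D *\<^sub>v (f \<cdot>\<^sub>v u @\<^sub>v 0\<^sub>v n2) = 0\<^sub>v m"
  using assms
  by (subst append_cols_mult_vec[of _ m n1 _ n2])
    (auto simp: mult_mat_smult_vec[of _ m n1] mult_mat_zero_vec[of _ m n2])

lemma append_cols_mult_right_zero:
  fixes C D :: "'l cyc mat"
  assumes "C \<in> carrier_mat m n1" "D \<in> carrier_mat m n2" "u \<in> carrier_vec n2" "D *\<^sub>v u = 0\<^sub>v m"
  shows "append_cols C D *\<^sub>v (0\<^sub>v n1 @\<^sub>v f \<cdot>\<^sub>v u) = 0\<^sub>v m"
  using assms
  by (subst append_cols_mult_vec[of _ m n1 _ n2])
    (auto simp: mult_mat_smult_vec[of _ m n2] mult_mat_zero_vec[of _ m n1])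

section \<open>The operators are cycles and cocycles\<close>

lemma supZ_cycle:
  assumes "k \<in> J"
  shows "D1 *\<^sub>v supZ k = 0\<^sub>v (mA * mB)"
  using assms
proof (cases rule: J_cases)
  case (Left i p q m)
  have "kron_mat A (1\<^sub>m mB) *\<^sub>v kron_vec (zA i p) (unit_vec mB q) = kron_vec (A *\<^sub>v zA i p) (1\<^sub>m mB *\<^sub>v unit_vec mB q)"
    using Left by (intro kron_mat_mult_kron_vec[OF A]) (auto simp: z_carrier)
  also have "\<dots> = 0\<^sub>v (mA * mB)"
    using mult_zeta[OF A info_A Left(2)] by (simp add: kron_vec_zero_left)
  finally show ?thesis
    unfolding Left(1) supZ_left lp_boundary1_def dims using A B Left
    by (intro append_cols_mult_left_zero[of _ _ "nA * mB"]) (simp_all add: z_carrier)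
next
  case (Right i p q m)
  have "kron_mat (1\<^sub>m mA) B *\<^sub>v kron_vec (unit_vec mA p) (zB i q) = kron_vec (1\<^sub>m mA *\<^sub>v unit_vec mA p) (B *\<^sub>v zB i q)"
    using Right by (intro kron_mat_mult_kron_vec[OF _ B]) (auto simp: z_carrier)
  also have "\<dots> = 0\<^sub>v (mA * mB)"
    using mult_zeta[OF B info_B Right(2)] by (simp add: kron_vec_zero_right)
  finally show ?thesis
    unfolding Right(1) supZ_right lp_boundary1_def dims using A B Right
    by (intro append_cols_mult_right_zero[of _ _ _ _ "mA * nB"]) (simp_all add: z_carrier)
qed

lemma conj_transpose_D2:
  "conj_transpose D2 = append_cols (kron_mat (1\<^sub>m nA) (conj_transpose B)) (kron_mat (conj_transpose A) (1\<^sub>m nB))"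
  unfolding lp_boundary2_def dims using A B
  by (subst conj_transpose_append_rows[of _ "nA * mB" "nA * nB" _ "mA * nB"])
    (auto simp: conj_transpose_kron_mat)

lemma map_vec_conj_zero: "map_vec cyc_conj (0\<^sub>v n) = 0\<^sub>v n"
  by (intro eq_vecI) auto

lemma supX_cocycle:
  assumes "k \<in> J"
  shows "conj_transpose D2 *\<^sub>v supX k = 0\<^sub>v (nA * nB)"
  using assms
proof (cases rule: J_cases)
  case (Left i p q m)
  have "kron_mat (1\<^sub>m nA) (conj_transpose B) *\<^sub>v kron_vec (unit_vec nA p) (map_vec cyc_conj (xB i q)) =
      kron_vec (1\<^sub>m nA *\<^sub>v unit_vec nA p) (conj_transpose B *\<^sub>v map_vec cyc_conj (xB i q))"
    using Left
    by (intro kron_mat_mult_kron_vec[OF one_carrier_mat conj_transpose_carrier[OF B]]) (auto simp: z_carrier)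
  also have "\<dots> = 0\<^sub>v (nA * nB)"
    using mult_zeta[OF BT info_BT Left(2)] Left
    by (subst conj_transpose_mult_conj_vec[OF B]) (simp_all add: z_carrier kron_vec_zero_right map_vec_conj_zero)
  finally show ?thesis
    unfolding Left(1) supX_left conj_transpose_D2 using A B Left
    by (intro append_cols_mult_left_zero[of _ _ "nA * mB"]) (simp_all add: z_carrier)
next
  case (Right i p q m)
  have "kron_mat (conj_transpose A) (1\<^sub>m nB) *\<^sub>v kron_vec (map_vec cyc_conj (xA i p)) (unit_vec nB q) =
      kron_vec (conj_transpose A *\<^sub>v map_vec cyc_conj (xA i p)) (1\<^sub>m nB *\<^sub>v unit_vec nB q)"
    using Right
    by (intro kron_mat_mult_kron_vec[OF conj_transpose_carrier[OF A] one_carrier_mat]) (auto simp: z_carrier)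
  also have "\<dots> = 0\<^sub>v (nA * nB)"
    using mult_zeta[OF AT info_AT Right(2)] Right
    by (subst conj_transpose_mult_conj_vec[OF A]) (simp_all add: z_carrier kron_vec_zero_left map_vec_conj_zero)
  finally show ?thesis
    unfolding Right(1) supX_right conj_transpose_D2 using A B Right
    by (intro append_cols_mult_right_zero[of _ _ _ _ "mA * nB"]) (simp_all add: z_carrier)
qed

lemma map_vec_conj_conj [simp]: "map_vec cyc_conj (map_vec cyc_conj v) = v"
  by (intro eq_vecI) auto

lemma map_vec_conj_unit_vec [simp]: "map_vec cyc_conj (unit_vec n i) = unit_vec n i"
  by (intro eq_vecI) (auto simp: unit_vec_def)

lemma map_vec_conj_smult: "map_vec cyc_conj (f \<cdot>\<^sub>v v) = cyc_conj f \<cdot>\<^sub>v map_vec cyc_conj v"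
  by (intro eq_vecI) (auto simp: cyc_conj_mult)

section \<open>Conjugacy of the two families\<close>

lemma pairing_smult_kron_vec:
  assumes "u \<in> carrier_vec m" "u' \<in> carrier_vec m" "v \<in> carrier_vec n" "v' \<in> carrier_vec n"
  shows "pairing (f \<cdot>\<^sub>v kron_vec u v) (f' \<cdot>\<^sub>v kron_vec u' v') =
    cyc_coeff (f * cyc_conj f' * ((u \<bullet> map_vec cyc_conj u') * (v \<bullet> map_vec cyc_conj v'))) 0"
  using assms
  by (simp add: pairing_eq_scalar_prod map_vec_conj_smult map_vec_conj_kron_vec
      kron_vec_scalar_prod[of _ m _ _ n] mult_ac)

text \<open>Within a sector, each unit vector picks one entry of the systematic vector opposite to
  it. If the components agree, that entry sits in an information set and is \<open>c i\<close> or 0.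
  Operators of different sectors have disjoint supports.\<close>

lemma pairing_supZ_supX:
  assumes "k \<in> J" "k' \<in> J"
  shows "pairing (supZ k) (supX k') = (if k = k' then 1 else 0)"
  using assms(1)
proof (cases rule: J_cases)
  case (Left i p q m)
  note k = this
  show ?thesis
    using assms(2)
  proof (cases rule: J_cases)
    case (Left i' p' q' m')
    note k' = this
    have p': "p' < nA" and q: "q < mB" using index_bounds k k' by simp_all
    have "pairing (supZ k) (supX k') =
        cyc_coeff ((c i * h i m) * (c i' * cyc_conj (cyc_x ^ m')) * (zA i p $ p' * xB i' q' $ q)) 0"
      unfolding k(1) k'(1) supZ_left supX_left using k k' p' q
      by (subst pairing_append[of _ "nA * mB" _ _ "mA * nB"])
        (simp_all add: z_carrier pairing_smult_kron_vec[of _ nA _ _ mB] cyc_conj_mult)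
    also have "\<dots> = (if i = i' \<and> m = m' \<and> p' = p \<and> q = q' then 1 else 0)"
      by (rule coefficient_orthogonality) (use k k' in \<open>auto simp: z_index\<close>)
    finally show ?thesis using k(1) k'(1) by auto
  next
    case (Right i' p' q' m')
    then show ?thesis
      unfolding k(1) Right(1) supZ_left supX_right using k Right
      by (subst pairing_append[of _ "nA * mB" _ _ "mA * nB"]) (auto simp: z_carrier z_dim pairing_def cyc_coeff_0)
  qed
next
  case (Right i p q m)
  note k = this
  show ?thesis
    using assms(2)
  proof (cases rule: J_cases)
    case (Left i' p' q' m')
    then show ?thesis
      unfolding k(1) Left(1) supZ_right supX_left using k Left
      by (subst pairing_append[of _ "nA * mB" _ _ "mA * nB"]) (auto simp: z_carrier z_dim pairing_def cyc_coeff_0)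
  next
    case (Right i' p' q' m')
    note k' = this
    have p: "p < mA" and q': "q' < nB" using index_bounds k k' by simp_all
    have "pairing (supZ k) (supX k') =
        cyc_coeff ((c i * h i m) * (c i' * cyc_conj (cyc_x ^ m')) * (xA i' p' $ p * zB i q $ q')) 0"
      unfolding k(1) k'(1) supZ_right supX_right using k k' p q'
      by (subst pairing_append[of _ "nA * mB" _ _ "mA * nB"])
        (simp_all add: z_carrier pairing_smult_kron_vec[of _ mA _ _ nB] cyc_conj_mult)
    also have "\<dots> = (if i = i' \<and> m = m' \<and> p = p' \<and> q' = q then 1 else 0)"
      by (rule coefficient_orthogonality) (use k k' in \<open>auto simp: z_index\<close>)
    finally show ?thesis using k(1) k'(1) by auto
  qed
qed

section \<open>The projection on the middle term and its range\<close>

abbreviation "GA \<equiv> kernel_projection A IA"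
abbreviation "GB \<equiv> kernel_projection B IB"
abbreviation "FA \<equiv> transpose_mat (kernel_projection (transpose_mat A) IAs)"
abbreviation "FB \<equiv> transpose_mat (kernel_projection (transpose_mat B) IBs)"

definition "Pi_mat = four_block_mat (kron_mat GA FB) (0\<^sub>m (nA * mB) (mA * nB))
  (0\<^sub>m (mA * nB) (nA * mB)) (kron_mat FA GB)"

lemma projection_carriers:
  "GA \<in> carrier_mat nA nA" "GB \<in> carrier_mat nB nB" "FA \<in> carrier_mat mA mA" "FB \<in> carrier_mat mB mB"
  using A B AT BT by simp_all

lemma Pi_carrier: "Pi_mat \<in> carrier_mat N N"
  unfolding Pi_mat_def using projection_carriers by (intro four_block_carrier_mat kron_mat_carrier)

lemma homotopy:
  obtains H1 H2 where "H1 \<in> carrier_mat N (mA * mB)" "H2 \<in> carrier_mat (nA * nB) N"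
    "D2 * H2 + H1 * D1 = 1\<^sub>m N + Pi_mat"
proof -
  obtain ZA where ZA: "ZA \<in> carrier_mat nA mA" "ZA * A = 1\<^sub>m nA + GA" "A * ZA = 1\<^sub>m mA + FA"
    using contraction[OF A info_A info_AT] by blast
  obtain ZB where ZB: "ZB \<in> carrier_mat nB mB" "ZB * B = 1\<^sub>m nB + GB" "B * ZB = 1\<^sub>m mB + FB"
    using contraction[OF B info_B info_BT] by blast
  have "FA * A = transpose_mat (transpose_mat A * kernel_projection (transpose_mat A) IAs)"
    using AT by (subst transpose_mult[of _ nA mA _ mA]) auto
  then have "FA * A = 0\<^sub>m mA nA"
    using mult_kernel_projection[OF AT info_AT] by simp
  then show thesis
    using lp_homotopy[OF A B ZA ZB projection_carriers(1) mult_kernel_projection[OF A info_A]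
        projection_carriers(3) _ projection_carriers(2,4)] that
    unfolding Pi_mat_def by blast
qed

text \<open>Scalars move across the tensor product, so \<open>g\<close> acts trivially as soon as it
  fixes one of the two factors.\<close>

lemma smult_kron_absorb:
  assumes "(\<forall>r<dim_vec u. g * u $ r = u $ r) \<or> (\<forall>r<dim_vec v. g * v $ r = v $ r)"
  shows "(g * f) \<cdot>\<^sub>v kron_vec u v = f \<cdot>\<^sub>v kron_vec u (v :: 'l cyc vec)"
proof (rule eq_vecI)
  fix r assume "r < dim_vec (f \<cdot>\<^sub>v kron_vec u v)"
  then have r: "r < dim_vec u * dim_vec v" by simp
  note r' = div_mod_less_mult[OF r]
  let ?x = "u $ (r div dim_vec v)" and ?y = "v $ (r mod dim_vec v)"
  have "(g * f) * (?x * ?y) = f * ((g * ?x) * ?y)" "(g * f) * (?x * ?y) = f * (?x * (g * ?y))"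
    by (simp_all only: mult_ac)
  moreover have "g * ?x = ?x \<or> g * ?y = ?y" using assms r' by blast
  ultimately have "(g * f) * (?x * ?y) = f * (?x * ?y)" by metis
  then show "((g * f) \<cdot>\<^sub>v kron_vec u v) $ r = (f \<cdot>\<^sub>v kron_vec u v) $ r"
    using r by (simp add: kron_vec_index)
qed simp

text \<open>The range is generated by all \<open>R\<close>-multiples of the tensors of a
  \<open>zeta\<close> with a unit vector. Because \<open>c i\<close> fixes \<open>zeta\<close>, only
  multiples from \<open>c i R\<close> occur, and the dual elements span these over the two-element
  field.\<close>

lemma Pi_mem_span_supZ:
  assumes z: "z \<in> carrier_vec N"
  shows "Pi_mat *\<^sub>v z \<in> binary_span N (supZ ` J)"
proof -
  let ?T = "binary_span N (supZ ` J)"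
  have sub: "supZ ` J \<subseteq> carrier_vec N" using supZ_carrier by blast
  have T: "vec_additive_closed N ?T" by (rule binary_span_closed[OF sub])
  let ?L = "{u \<in> carrier_vec (nA * mB). u @\<^sub>v 0\<^sub>v (mA * nB) \<in> ?T}"
  let ?R = "{u \<in> carrier_vec (mA * nB). 0\<^sub>v (nA * mB) @\<^sub>v u \<in> ?T}"
  have TL: "vec_additive_closed (nA * mB) ?L" and TR: "vec_additive_closed (mA * nB) ?R"
    using vec_additive_closed_left_sector[OF T] vec_additive_closed_right_sector[OF T] by simp_all
  have sup: "supZ k \<in> ?T" if "k \<in> J" for k using binary_span_superset[OF sub] that by blast
  have genL: "f \<cdot>\<^sub>v kron_vec (zA i p) (unit_vec mB q) \<in> ?L"
    if "i < t" "p \<in> IA i" "q \<in> IBs i" for i p q f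
  proof -
    let ?u = "kron_vec (zA i p) (unit_vec mB q)"
    have u: "?u \<in> carrier_vec (nA * mB)" using that by (simp add: z_carrier)
    have "c i * f \<in> {g. g \<cdot>\<^sub>v ?u \<in> ?L}"
    proof (rule component_spanned_by_dual[OF that(1)])
      show "additive_closed {g. g \<cdot>\<^sub>v ?u \<in> ?L}" by (rule smult_additive_closed[OF TL u])
      fix k assume "k < degree (b i)"
      then have "(LeftSector, i, p, q, e i k) \<in> J"
        using that by (auto simp: logical_index_def set_exponents)
      from sup[OF this] show "c i * h i (e i k) \<in> {g. g \<cdot>\<^sub>v ?u \<in> ?L}"
        using u by (simp add: supZ_left)
    qed
    moreover have "(c i * f) \<cdot>\<^sub>v ?u = f \<cdot>\<^sub>v ?u"
      using that
      by (intro smult_kron_absorb) (auto simp: z_idempotent z_dim)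
    ultimately show ?thesis by simp
  qed
  have genR: "f \<cdot>\<^sub>v kron_vec (unit_vec mA p) (zB i q) \<in> ?R"
    if "i < t" "q \<in> IB i" "p \<in> IAs i" for i p q f
  proof -
    let ?u = "kron_vec (unit_vec mA p) (zB i q)"
    have u: "?u \<in> carrier_vec (mA * nB)" using that by (simp add: z_carrier)
    have "c i * f \<in> {g. g \<cdot>\<^sub>v ?u \<in> ?R}"
    proof (rule component_spanned_by_dual[OF that(1)])
      show "additive_closed {g. g \<cdot>\<^sub>v ?u \<in> ?R}" by (rule smult_additive_closed[OF TR u])
      fix k assume "k < degree (b i)"
      then have "(RightSector, i, p, q, e i k) \<in> J"
        using that by (auto simp: logical_index_def set_exponents)
      from sup[OF this] show "c i * h i (e i k) \<in> {g. g \<cdot>\<^sub>v ?u \<in> ?R}"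
        using u by (simp add: supZ_right)
    qed
    moreover have "(c i * f) \<cdot>\<^sub>v ?u = f \<cdot>\<^sub>v ?u"
      using that
      by (intro smult_kron_absorb) (auto simp: z_idempotent z_dim)
    ultimately show ?thesis by simp
  qed
  show ?thesis
    unfolding Pi_mat_def
  proof (rule block_diagonal_mult_vec_mem[OF T _ _ _ _ z])
    fix u :: "'l cyc vec" assume u: "u \<in> carrier_vec (nA * mB)"
    show "kron_mat GA FB *\<^sub>v u \<in> ?L"
      unfolding kernel_projection_def dims index_transpose_mat
    proof (rule kron_select_cols_rows_mem[OF TL u])
      show "zA i p $ r * xB j q $ s = 0" if "i < t" "j < t" "i \<noteq> j" "r < nA" "s < mB" for i j p q r s
        using that by (intro z_orthogonal[of i j]) (simp_all add: z_idempotent)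
    qed (use z_finite z_carrier genL in auto)
  next
    fix u :: "'l cyc vec" assume u: "u \<in> carrier_vec (mA * nB)"
    show "kron_mat FA GB *\<^sub>v u \<in> ?R"
      unfolding kernel_projection_def dims index_transpose_mat
    proof (rule kron_select_rows_cols_mem[OF TR u])
      show "zB i p $ r * xA j q $ s = 0" if "i < t" "j < t" "i \<noteq> j" "r < nB" "s < mA" for i j p q r s
        using that by (intro z_orthogonal[of i j]) (simp_all add: z_idempotent)
    qed (use z_finite z_carrier genR in auto)
  qed (use projection_carriers in simp_all)
qed

text \<open>Conjugate transposition exchanges roles: the conjugated cokernel vectors become columns
  and the kernel vectors become rows, which matches the shape of \<open>supX\<close>.\<close>

lemma conj_transpose_Pi: "conj_transpose Pi_mat =
  four_block_mat
    (kron_mat (transpose_mat (select_cols t nA (\<lambda>i j. map_vec cyc_conj (zA i j)) IA))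
      (select_cols t mB (\<lambda>i j. map_vec cyc_conj (xB i j)) IBs))
    (0\<^sub>m (nA * mB) (mA * nB)) (0\<^sub>m (mA * nB) (nA * mB))
    (kron_mat (select_cols t mA (\<lambda>i j. map_vec cyc_conj (xA i j)) IAs)
      (transpose_mat (select_cols t nB (\<lambda>i j. map_vec cyc_conj (zB i j)) IB)))"
proof -
  have "conj_transpose Pi_mat = four_block_mat (conj_transpose (kron_mat GA FB))
      (0\<^sub>m (nA * mB) (mA * nB)) (0\<^sub>m (mA * nB) (nA * mB)) (conj_transpose (kron_mat FA GB))"
    unfolding Pi_mat_def using projection_carriers
    by (intro eq_matI) (auto simp: conj_transpose_def)
  then show ?thesis
    by (simp add: conj_transpose_kron_mat kernel_projection_def conj_transpose_select_cols
        conj_transpose_transpose_select_cols z_carrier)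
qed

lemma conj_Pi_mem_span_supX:
  assumes z: "z \<in> carrier_vec N"
  shows "conj_transpose Pi_mat *\<^sub>v z \<in> binary_span N (supX ` J)"
proof -
  let ?T = "binary_span N (supX ` J)"
  have sub: "supX ` J \<subseteq> carrier_vec N" using supX_carrier by blast
  have T: "vec_additive_closed N ?T" by (rule binary_span_closed[OF sub])
  let ?L = "{u \<in> carrier_vec (nA * mB). u @\<^sub>v 0\<^sub>v (mA * nB) \<in> ?T}"
  let ?R = "{u \<in> carrier_vec (mA * nB). 0\<^sub>v (nA * mB) @\<^sub>v u \<in> ?T}"
  have TL: "vec_additive_closed (nA * mB) ?L" and TR: "vec_additive_closed (mA * nB) ?R"
    using vec_additive_closed_left_sector[OF T] vec_additive_closed_right_sector[OF T] by simp_all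
  have sup: "supX k \<in> ?T" if "k \<in> J" for k using binary_span_superset[OF sub] that by blast
  have conj_idem: "cyc_conj (c i) * cyc_conj f = cyc_conj f" if "c i * f = f" for i f
    using that by (metis cyc_conj_mult)
  have genL: "f \<cdot>\<^sub>v kron_vec (unit_vec nA p) (map_vec cyc_conj (xB i q)) \<in> ?L"
    if "i < t" "q \<in> IBs i" "p \<in> IA i" for i p q f
  proof -
    let ?u = "kron_vec (unit_vec nA p) (map_vec cyc_conj (xB i q))"
    have u: "?u \<in> carrier_vec (nA * mB)" using that by (simp add: z_carrier)
    \<comment> \<open>The scalars in \<open>supX\<close> are the conjugates of
      \<open>c i * cyc_conj (cyc_x ^ m)\<close>, so the spanning statement is applied to conjugated
      scalars.\<close>
    have "c i * cyc_conj f \<in> {g. cyc_conj g \<cdot>\<^sub>v ?u \<in> ?L}"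
    proof (rule component_spanned_by_conj_x[OF that(1)])
      show "additive_closed {g. cyc_conj g \<cdot>\<^sub>v ?u \<in> ?L}"
        using smult_additive_closed[OF TL u] by (simp add: additive_closed_def cyc_conj_add)
      fix k assume "k < degree (b i)"
      then have "(LeftSector, i, p, q, e i k) \<in> J"
        using that by (auto simp: logical_index_def set_exponents)
      from sup[OF this] show "c i * cyc_conj (cyc_x ^ e i k) \<in> {g. cyc_conj g \<cdot>\<^sub>v ?u \<in> ?L}"
        using u by (simp add: supX_left cyc_conj_mult)
    qed
    moreover have "(cyc_conj (c i) * f) \<cdot>\<^sub>v ?u = f \<cdot>\<^sub>v ?u"
      using that
      by (intro smult_kron_absorb) (auto simp: z_idempotent z_dim conj_idem)
    ultimately show ?thesis by (simp add: cyc_conj_mult)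
  qed
  have genR: "f \<cdot>\<^sub>v kron_vec (map_vec cyc_conj (xA i p)) (unit_vec nB q) \<in> ?R"
    if "i < t" "p \<in> IAs i" "q \<in> IB i" for i p q f
  proof -
    let ?u = "kron_vec (map_vec cyc_conj (xA i p)) (unit_vec nB q)"
    have u: "?u \<in> carrier_vec (mA * nB)" using that by (simp add: z_carrier)
    have "c i * cyc_conj f \<in> {g. cyc_conj g \<cdot>\<^sub>v ?u \<in> ?R}"
    proof (rule component_spanned_by_conj_x[OF that(1)])
      show "additive_closed {g. cyc_conj g \<cdot>\<^sub>v ?u \<in> ?R}"
        using smult_additive_closed[OF TR u] by (simp add: additive_closed_def cyc_conj_add)
      fix k assume "k < degree (b i)"
      then have "(RightSector, i, p, q, e i k) \<in> J"
        using that by (auto simp: logical_index_def set_exponents)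
      from sup[OF this] show "c i * cyc_conj (cyc_x ^ e i k) \<in> {g. cyc_conj g \<cdot>\<^sub>v ?u \<in> ?R}"
        using u by (simp add: supX_right cyc_conj_mult)
    qed
    moreover have "(cyc_conj (c i) * f) \<cdot>\<^sub>v ?u = f \<cdot>\<^sub>v ?u"
      using that
      by (intro smult_kron_absorb) (auto simp: z_idempotent z_dim conj_idem)
    ultimately show ?thesis by (simp add: cyc_conj_mult)
  qed
  show ?thesis
    unfolding conj_transpose_Pi
  proof (rule block_diagonal_mult_vec_mem[OF T _ _ _ _ z])
    fix u :: "'l cyc vec" assume u: "u \<in> carrier_vec (nA * mB)"
    show "kron_mat (transpose_mat (select_cols t nA (\<lambda>i j. map_vec cyc_conj (zA i j)) IA))
        (select_cols t mB (\<lambda>i j. map_vec cyc_conj (xB i j)) IBs) *\<^sub>v u \<in> ?L"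
    proof (rule kron_select_rows_cols_mem[OF TL u])
      show "map_vec cyc_conj (xB i p) $ r * map_vec cyc_conj (zA j q) $ s = 0"
        if "i < t" "j < t" "i \<noteq> j" "r < mB" "s < nA" for i j p q r s
        using that z_orthogonal[of i j "xB i p $ r" "zA j q $ s"]
        by (simp add: z_idempotent z_dim flip: cyc_conj_mult)
    qed (use z_finite z_carrier genL in auto)
  next
    fix u :: "'l cyc vec" assume u: "u \<in> carrier_vec (mA * nB)"
    show "kron_mat (select_cols t mA (\<lambda>i j. map_vec cyc_conj (xA i j)) IAs)
        (transpose_mat (select_cols t nB (\<lambda>i j. map_vec cyc_conj (zB i j)) IB)) *\<^sub>v u \<in> ?R"
    proof (rule kron_select_cols_rows_mem[OF TR u])
      show "map_vec cyc_conj (xA i p) $ r * map_vec cyc_conj (zB j q) $ s = 0"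
        if "i < t" "j < t" "i \<noteq> j" "r < mA" "s < nB" for i j p q r s
        using that z_orthogonal[of i j "xA i p $ r" "zB j q $ s"]
        by (simp add: z_idempotent z_dim flip: cyc_conj_mult)
    qed (use z_finite z_carrier genR in auto)
  qed (auto simp: select_cols_def)
qed

section \<open>Representatives of homology and cohomology classes\<close>

lemma mat_kernel_D1: "v \<in> mat_kernel D1 \<longleftrightarrow> v \<in> carrier_vec N \<and> D1 *\<^sub>v v = 0\<^sub>v (mA * mB)"
  using boundary_carrier by (auto simp: mat_kernel_def)

lemma mat_kernel_D2s:
  "v \<in> mat_kernel (conj_transpose D2) \<longleftrightarrow> v \<in> carrier_vec N \<and> conj_transpose D2 *\<^sub>v v = 0\<^sub>v (nA * nB)"
  using conj_transpose_carrier[OF boundary_carrier(2)] by (auto simp: mat_kernel_def)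

text \<open>On a cycle the term \<open>H1 * D1\<close> of the homotopy vanishes, so \<open>v\<close>
  differs from its projection by a boundary.\<close>

lemma homology_span:
  assumes "v \<in> mat_kernel D1"
  shows "\<exists>s w. s \<in> binary_span N (supZ ` J) \<and> w \<in> carrier_vec (nA * nB) \<and> v = s + D2 *\<^sub>v w"
proof -
  have v: "v \<in> carrier_vec N" "D1 *\<^sub>v v = 0\<^sub>v (mA * mB)"
    using assms by (simp_all add: mat_kernel_D1)
  obtain H1 H2 where H: "H1 \<in> carrier_mat N (mA * mB)" "H2 \<in> carrier_mat (nA * nB) N"
    and eq: "D2 * H2 + H1 * D1 = 1\<^sub>m N + Pi_mat" by (rule homotopy)
  have "(D2 * H2 + H1 * D1) *\<^sub>v v = D2 *\<^sub>v (H2 *\<^sub>v v)"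
    using H v boundary_carrier
    by (simp add: add_mult_distrib_mat_vec[of _ N N] assoc_mult_mat_vec[of _ N _ _ N]
        mult_mat_zero_vec[OF H(1)])
  moreover have "(1\<^sub>m N + Pi_mat) *\<^sub>v v = v + Pi_mat *\<^sub>v v"
    using v Pi_carrier by (simp add: add_mult_distrib_mat_vec[of _ N N])
  moreover have "Pi_mat *\<^sub>v v \<in> carrier_vec N" using v Pi_carrier by simp
  ultimately have "v = Pi_mat *\<^sub>v v + D2 *\<^sub>v (H2 *\<^sub>v v)"
    using v eq by (metis comm_add_vec vec_cyc_cancel)
  moreover have "H2 *\<^sub>v v \<in> carrier_vec (nA * nB)" using H v by simp
  ultimately show ?thesis using Pi_mem_span_supZ[OF v(1)] by blast
qed

text \<open>Conjugate transposition reverses the products in the homotopy: the term with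
  \<open>H2\<close> now vanishes on cocycles, and \<open>H1\<close> supplies the coboundary.\<close>

lemma cohomology_span:
  assumes "v \<in> mat_kernel (conj_transpose D2)"
  shows "\<exists>s w. s \<in> binary_span N (supX ` J) \<and> w \<in> carrier_vec (mA * mB) \<and> v = s + conj_transpose D1 *\<^sub>v w"
proof -
  have v: "v \<in> carrier_vec N" "conj_transpose D2 *\<^sub>v v = 0\<^sub>v (nA * nB)"
    using assms by (simp_all add: mat_kernel_D2s)
  obtain H1 H2 where H: "H1 \<in> carrier_mat N (mA * mB)" "H2 \<in> carrier_mat (nA * nB) N"
    and "D2 * H2 + H1 * D1 = 1\<^sub>m N + Pi_mat" by (rule homotopy)
  then have "conj_transpose (D2 * H2 + H1 * D1) = conj_transpose (1\<^sub>m N + Pi_mat)" by simp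
  then have eq: "conj_transpose H2 * conj_transpose D2 + conj_transpose D1 * conj_transpose H1 =
      1\<^sub>m N + conj_transpose Pi_mat"
    using H boundary_carrier Pi_carrier
    by (simp add: conj_transpose_add[of _ N N] conj_transpose_mult[of D2 N _ H2 N] conj_transpose_mult[of H1 N _ D1 N])
  note carriers = conj_transpose_carrier[OF H(1)] conj_transpose_carrier[OF H(2)]
    conj_transpose_carrier[OF boundary_carrier(1)] conj_transpose_carrier[OF boundary_carrier(2)]
    conj_transpose_carrier[OF Pi_carrier]
  have "(conj_transpose H2 * conj_transpose D2 + conj_transpose D1 * conj_transpose H1) *\<^sub>v v =
      conj_transpose D1 *\<^sub>v (conj_transpose H1 *\<^sub>v v)"
    using v carriers
    by (simp add: add_mult_distrib_mat_vec[of _ N N] assoc_mult_mat_vec[of _ N _ _ N]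
        mult_mat_zero_vec[OF carriers(2)])
  moreover have "(1\<^sub>m N + conj_transpose Pi_mat) *\<^sub>v v = v + conj_transpose Pi_mat *\<^sub>v v"
    using v carriers by (simp add: add_mult_distrib_mat_vec[of _ N N])
  moreover have "conj_transpose Pi_mat *\<^sub>v v \<in> carrier_vec N" using v carriers by simp
  ultimately have "v = conj_transpose Pi_mat *\<^sub>v v + conj_transpose D1 *\<^sub>v (conj_transpose H1 *\<^sub>v v)"
    using v eq by (metis comm_add_vec vec_cyc_cancel)
  moreover have "conj_transpose H1 *\<^sub>v v \<in> carrier_vec (mA * mB)" using carriers v by simp
  ultimately show ?thesis using conj_Pi_mem_span_supX[OF v(1)] by blast
qed

lemma boundary_comp: "D1 * D2 = 0\<^sub>m (mA * mB) (nA * nB)"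
  by (rule lp_boundary_comp[OF A B])

lemma coboundary_comp: "conj_transpose D2 * conj_transpose D1 = 0\<^sub>m (nA * nB) (mA * mB)"
  using boundary_comp conj_transpose_mult[OF boundary_carrier] by simp

lemma pairing_supX_boundary:
  assumes "k \<in> J" "w \<in> carrier_vec (nA * nB)"
  shows "pairing (D2 *\<^sub>v w) (supX k) = 0"
  using assms supX_carrier[OF assms(1)] boundary_carrier
  by (subst pairing_adjoint[of _ N "nA * nB"]) (auto simp: supX_cocycle pairing_zero_right)

lemma pairing_supZ_coboundary:
  assumes "k \<in> J" "w \<in> carrier_vec (mA * mB)"
  shows "pairing (conj_transpose D1 *\<^sub>v w) (supZ k) = 0"
  using assms supZ_carrier[OF assms(1)] conj_transpose_carrier[OF boundary_carrier(1)]
  by (subst pairing_adjoint[of _ N "mA * mB"]) (auto simp: supZ_cycle pairing_zero_right)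

lemma pairing_supX_supZ:
  assumes "k \<in> J" "k' \<in> J"
  shows "pairing (supX k) (supZ k') = (if k = k' then 1 else 0)"
proof -
  have "pairing (supX k) (supZ k') = pairing (supZ k') (supX k)"
    using carrier_vecD[OF supX_carrier[OF assms(1)]] carrier_vecD[OF supZ_carrier[OF assms(2)]]
    by (intro pairing_commute) simp
  then show ?thesis using pairing_supZ_supX[OF assms(2,1)] by auto
qed

lemma supZ_kernel: "k \<in> J \<Longrightarrow> supZ k \<in> mat_kernel D1"
  by (simp add: mat_kernel_D1 supZ_carrier supZ_cycle)

lemma supX_kernel: "k \<in> J \<Longrightarrow> supX k \<in> mat_kernel (conj_transpose D2)"
  by (simp add: mat_kernel_D2s supX_carrier supX_cocycle)

lemmas homology_results = homology_basis_by_duality[OF boundary_carrier boundary_comp finite_J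
    supZ_kernel pairing_supX_boundary pairing_supZ_supX homology_span]

lemmas cohomology_results = homology_basis_by_duality[OF conj_transpose_carrier[OF boundary_carrier(2)]
    conj_transpose_carrier[OF boundary_carrier(1)] coboundary_comp finite_J
    supX_kernel pairing_supZ_coboundary pairing_supX_supZ cohomology_span]

text \<open>The \<open>insert\<close> admits the zero rows that the Kronecker products produce
  wherever two different components meet.\<close>

lemma generates_homologyI:
  assumes "supZ ` J \<subseteq> S" "S \<subseteq> insert (0\<^sub>v N) (supZ ` J)"
  shows "generates_homology D1 D2 S"
proof (rule homology_results(2))
  show "S \<subseteq> mat_kernel D1"
    using assms(2) supZ_kernel mult_mat_zero_vec[OF boundary_carrier(1)] by (auto simp: mat_kernel_D1)
qed (use assms(1) in auto)

lemma generates_cohomologyI: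
  assumes "supX ` J \<subseteq> S" "S \<subseteq> insert (0\<^sub>v N) (supX ` J)"
  shows "generates_homology (conj_transpose D2) (conj_transpose D1) S"
proof (rule cohomology_results(2))
  show "S \<subseteq> mat_kernel (conj_transpose D2)"
    using assms(2) supX_kernel mult_mat_zero_vec[OF conj_transpose_carrier[OF boundary_carrier(2)]]
    by (auto simp: mat_kernel_D2s)
qed (use assms(1) in auto)

end

section \<open>Rows of the generator matrices\<close>

text \<open>An ordered counterpart of \<open>Sigma\<close>, matching the nested list comprehensions
  that define the generator matrices.\<close>

definition list_Sigma :: "'a list \<Rightarrow> ('a \<Rightarrow> 'b list) \<Rightarrow> ('a \<times> 'b) list" where
  "list_Sigma xs ys = concat (map (\<lambda>x. map (Pair x) (ys x)) xs)"

lemma set_list_Sigma [simp]: "set (list_Sigma xs ys) = Sigma (set xs) (\<lambda>x. set (ys x))"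
  by (auto simp: list_Sigma_def)

lemma distinct_list_Sigma:
  "distinct xs \<Longrightarrow> (\<And>x. x \<in> set xs \<Longrightarrow> distinct (ys x)) \<Longrightarrow> distinct (list_Sigma xs ys)"
  by (induction xs) (auto simp: list_Sigma_def distinct_map inj_on_def)

lemma map_upt_mult:
  "map f [0..<m * n] = concat (map (\<lambda>i. map (\<lambda>j. f (i * n + j)) [0..<n]) [0..<m])"
proof (induction m)
  case (Suc m)
  have "[0..<Suc m * n] = [0..<m * n] @ [m * n..<m * n + n]"
    using upt_add_eq_append[of 0 "m * n" n] by (simp add: add.commute)
  moreover have "map f [m * n..<m * n + n] = map (\<lambda>j. f (m * n + j)) [0..<n]"
    by (rule nth_equalityI) simp_all
  ultimately show ?case using Suc by simp
qed simp

text \<open>The index convention \<open>i * n + j\<close> for tensor products lists the rows in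
  lexicographic order of the pairs.\<close>

lemma rows_kron_mat:
  fixes us vs :: "'a::comm_ring_1 vec list"
  assumes us: "set us \<subseteq> carrier_vec n1" and vs: "set vs \<subseteq> carrier_vec n2"
  shows "rows (kron_mat (mat_of_rows n1 us) (mat_of_rows n2 vs)) =
    concat (map (\<lambda>u. map (kron_vec u) vs) us)"
proof -
  let ?K = "kron_mat (mat_of_rows n1 us) (mat_of_rows n2 vs)"
  have row: "row ?K (i * length vs + j) = kron_vec (us ! i) (vs ! j)"
    if ij: "i < length us" "j < length vs" for i j
  proof -
    have dims: "dim_vec (us ! i) = n1" "dim_vec (vs ! j) = n2"
      using us vs ij by (auto dest: nth_mem)
    have bound: "i * length vs + j < length us * length vs"
      using mult_le_mono1[of "Suc i" "length us" "length vs"] ij by simp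
    have div_mod: "(i * length vs + j) div length vs = i" "(i * length vs + j) mod length vs = j"
      using ij by (simp_all add: div_nat_eqI mult.commute)
    show ?thesis
    proof (rule eq_vecI)
      fix s assume "s < dim_vec (kron_vec (us ! i) (vs ! j))"
      then have "s < n1 * n2" using dims by simp
      then show "row ?K (i * length vs + j) $ s = kron_vec (us ! i) (vs ! j) $ s"
        using ij bound dims div_mod
        by (simp add: kron_index kron_vec_index div_mod_less_mult mat_of_rows_index)
    qed (simp add: dims)
  qed
  have map_nth_comp: "map (\<lambda>j. f (xs ! j)) [0..<length xs] = map f xs"
    for f :: "'a vec \<Rightarrow> 'z" and xs
    by (rule nth_equalityI) simp_all
  have "rows ?K = concat (map (\<lambda>i. map (\<lambda>j. row ?K (i * length vs + j)) [0..<length vs]) [0..<length us])"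
    by (simp add: rows_def map_upt_mult)
  also have "\<dots> = concat (map (\<lambda>i. map (\<lambda>j. kron_vec (us ! i) (vs ! j)) [0..<length vs]) [0..<length us])"
    by (intro arg_cong[where f = concat] map_cong refl) (simp add: row)
  also have "\<dots> = concat (map (\<lambda>u. map (kron_vec u) vs) us)"
    by (simp only: map_nth_comp map_nth_comp[of "\<lambda>u. map (kron_vec u) vs"])
  finally show ?thesis .
qed

text \<open>Distinct index lists allow the rows to be indexed by a set of pairs, while the multiset
  keeps coinciding row vectors apart.\<close>

lemma mset_rows_kron_mat:
  fixes f :: "'x \<Rightarrow> 'a::comm_ring_1 vec" and g :: "'y \<Rightarrow> 'a vec"
  assumes f: "\<And>x. x \<in> set xs \<Longrightarrow> f x \<in> carrier_vec n1" and g: "\<And>y. y \<in> set ys \<Longrightarrow> g y \<in> carrier_vec n2"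
    and distinct: "distinct xs" "distinct ys"
  shows "mset (rows (kron_mat (mat_of_rows n1 (map f xs)) (mat_of_rows n2 (map g ys)))) =
    image_mset (\<lambda>(x, y). kron_vec (f x) (g y)) (mset_set (set xs \<times> set ys))"
proof -
  let ?P = "list_Sigma xs (\<lambda>_. ys)"
  have "rows (kron_mat (mat_of_rows n1 (map f xs)) (mat_of_rows n2 (map g ys))) =
      map (\<lambda>(x, y). kron_vec (f x) (g y)) ?P"
    using f g by (subst rows_kron_mat) (auto simp: list_Sigma_def map_concat comp_def)
  moreover have "mset_set (set ?P) = mset ?P"
    using distinct by (intro mset_set_set distinct_list_Sigma)
  ultimately show ?thesis by simp
qed

lemma diag_block_mat_pair:
  "diag_block_mat [P, Q] = four_block_mat P (0\<^sub>m (dim_row P) (dim_col Q)) (0\<^sub>m (dim_row Q) (dim_col P)) Q"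
  by (intro eq_matI) (auto simp: Let_def)

lemma rows_diag_block_mat_pair:
  "rows (diag_block_mat [P, Q]) =
    map (\<lambda>r. r @\<^sub>v 0\<^sub>v (dim_col Q)) (rows P) @ map (\<lambda>r. 0\<^sub>v (dim_col P) @\<^sub>v r) (rows Q)"
  unfolding diag_block_mat_pair
  by (intro nth_equalityI eq_vecI) (auto simp: nth_append)

text \<open>Intended for \<open>S\<close> the set of all index pairs and \<open>\<phi>\<close> the
  embedding of those with a common component; the remaining pairs give zero rows and are filtered
  out.\<close>

lemma filter_image_mset_reindex:
  assumes S: "finite S" and inj: "inj_on \<phi> K" and sub: "\<phi> ` K \<subseteq> S"
    and F: "\<And>k. k \<in> K \<Longrightarrow> F (\<phi> k) = G k" and P: "\<And>k. k \<in> K \<Longrightarrow> P (G k)"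
    and other: "\<And>s. s \<in> S \<Longrightarrow> s \<notin> \<phi> ` K \<Longrightarrow> \<not> P (F s)"
  shows "filter_mset P (image_mset F (mset_set S)) = image_mset G (mset_set K)"
proof -
  have K: "finite K" using S sub inj by (metis finite_imageD finite_subset)
  have "filter_mset P (image_mset F (mset_set S)) = image_mset F (mset_set {s \<in> S. P (F s)})"
    using S by (simp flip: image_mset_filter_mset_swap add: filter_mset_mset_set)
  also have "{s \<in> S. P (F s)} = \<phi> ` K"
  proof
    show "{s \<in> S. P (F s)} \<subseteq> \<phi> ` K" using other by blast
    show "\<phi> ` K \<subseteq> {s \<in> S. P (F s)}" using sub F P by auto
  qed
  also have "image_mset F (mset_set (\<phi> ` K)) = image_mset (F \<circ> \<phi>) (mset_set K)"
    using inj by (simp flip: image_mset_mset_set add: multiset.map_comp)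
  also have "\<dots> = image_mset G (mset_set K)"
    using K F by (intro image_mset_cong) simp
  finally show ?thesis .
qed

context lifted_product
begin

definition "index_pairs I = list_Sigma [0..<t] (\<lambda>i. sorted_list_of_set (I i))"
definition "index_triples I = list_Sigma [0..<t] (\<lambda>i. list_Sigma (sorted_list_of_set (I i)) (\<lambda>_. exponents b e i))"

lemma distinct_exponents: "i < t \<Longrightarrow> distinct (exponents b e i)"
  using exponent_distinct by (simp add: exponents_def distinct_map atLeast0LessThan)

lemma distinct_index_lists: "distinct (index_pairs I)" "distinct (index_triples I)"
  unfolding index_pairs_def index_triples_def
  by (auto intro!: distinct_list_Sigma distinct_exponents)

lemma set_index_pairs:
  "(\<And>i. i < t \<Longrightarrow> finite (I i)) \<Longrightarrow> set (index_pairs I) = (SIGMA i:{..<t}. I i)"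
  by (auto simp: index_pairs_def)

lemma set_index_triples:
  "(\<And>i. i < t \<Longrightarrow> finite (I i)) \<Longrightarrow>
    set (index_triples I) = (SIGMA i:{..<t}. I i \<times> set (exponents b e i))"
  by (auto simp: index_triples_def)

lemma generator_matrices:
  "G_mat t c \<beta> C I = mat_of_rows (dim_col C) (map (\<lambda>(i, j). zeta (c i) (\<beta> i) C (I i) j) (index_pairs I))"
  "E_mat t b c e h C Is = mat_of_rows (dim_row C)
    (map (\<lambda>(i, j, m). (h i m * c i) \<cdot>\<^sub>v unit_vec (dim_row C) j) (index_triples Is))"
  "G_star_mat t b c \<beta> e C Is = mat_of_rows (dim_row C)
    (map (\<lambda>(i, j, m). (cyc_x ^ m * cyc_conj (c i)) \<cdot>\<^sub>v xi_bar (c i) (\<beta> i) C (Is i) j) (index_triples Is))"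
  "E_star_mat t c C I = mat_of_rows (dim_col C)
    (map (\<lambda>(i, j). cyc_conj (c i) \<cdot>\<^sub>v unit_vec (dim_col C) j) (index_pairs I))"
  by (simp_all add: G_mat_def E_mat_def G_star_mat_def E_star_mat_def index_pairs_def index_triples_def
      list_Sigma_def map_concat comp_def)

text \<open>Each operator pairs to 1 with its conjugate partner, so filtering out zero rows discards
  no logical operator.\<close>

lemma supZ_nonzero: "k \<in> J \<Longrightarrow> supZ k \<noteq> 0\<^sub>v N"
  using pairing_supZ_supX[of k k] by auto

lemma supX_nonzero: "k \<in> J \<Longrightarrow> supX k \<noteq> 0\<^sub>v N"
  using pairing_supX_supZ[of k k] by auto

lemma image_mset_J:
  "image_mset f (mset_set J) =
    image_mset (\<lambda>k. f (LeftSector, k)) (mset_set J_left) + image_mset (\<lambda>k. f (RightSector, k)) (mset_set J_right)"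
proof -
  have "mset_set J = mset_set (Pair LeftSector ` J_left) + mset_set (Pair RightSector ` J_right)"
    unfolding J_eq using finite_J_sectors by (intro mset_set_Union) auto
  then show ?thesis
    by (simp flip: image_mset_mset_set add: multiset.map_comp comp_def inj_on_def)
qed

lemma J_left_mem: "k \<in> J_left \<Longrightarrow> (LeftSector, k) \<in> J"
  and J_right_mem: "k \<in> J_right \<Longrightarrow> (RightSector, k) \<in> J"
  by (auto simp: J_eq)

text \<open>Rows pairing different components vanish, because their idempotents are orthogonal.\<close>

lemma sector_rows:
  fixes L R :: "nat \<Rightarrow> nat \<Rightarrow> nat \<Rightarrow> nat \<Rightarrow> nat \<Rightarrow> 'l cyc vec"
  assumes L: "\<And>i p q m. (LeftSector, i, p, q, m) \<in> J \<Longrightarrow> L i p i q m @\<^sub>v 0\<^sub>v (mA * nB) = f (LeftSector, i, p, q, m)"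
    and L0: "\<And>i p i' q m. i < t \<Longrightarrow> i' < t \<Longrightarrow> i \<noteq> i' \<Longrightarrow> L i p i' q m = 0\<^sub>v (nA * mB)"
    and R: "\<And>i p q m. (RightSector, i, p, q, m) \<in> J \<Longrightarrow> 0\<^sub>v (nA * mB) @\<^sub>v R i q i p m = f (RightSector, i, p, q, m)"
    and R0: "\<And>i q i' p m. i < t \<Longrightarrow> i' < t \<Longrightarrow> i \<noteq> i' \<Longrightarrow> R i q i' p m = 0\<^sub>v (mA * nB)"
    and f: "\<And>k. k \<in> J \<Longrightarrow> f k \<noteq> 0\<^sub>v N"
  shows "filter_mset (\<lambda>r. r \<noteq> 0\<^sub>v N)
      (image_mset (\<lambda>r. r @\<^sub>v 0\<^sub>v (mA * nB)) (image_mset (\<lambda>((i, p), (i', q, m)). L i p i' q m)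
          (mset_set (set (index_pairs IA) \<times> set (index_triples IBs)))) +
        image_mset (\<lambda>r. 0\<^sub>v (nA * mB) @\<^sub>v r) (image_mset (\<lambda>((i', p, m), (i, q)). R i q i' p m)
          (mset_set (set (index_triples IAs) \<times> set (index_pairs IB))))) =
    image_mset f (mset_set J)"
proof -
  have zero: "0\<^sub>v (nA * mB) @\<^sub>v 0\<^sub>v (mA * nB) = (0\<^sub>v N :: 'l cyc vec)" by (intro eq_vecI) auto
  have sets: "set (index_pairs IA) = (SIGMA i:{..<t}. IA i)" "set (index_pairs IB) = (SIGMA i:{..<t}. IB i)"
    "set (index_triples IAs) = (SIGMA i:{..<t}. IAs i \<times> set (exponents b e i))"
    "set (index_triples IBs) = (SIGMA i:{..<t}. IBs i \<times> set (exponents b e i))"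
    by (simp_all add: set_index_pairs set_index_triples z_finite)
  let ?L = "\<lambda>((i, p), (i', q, m)). L i p i' q m @\<^sub>v 0\<^sub>v (mA * nB)"
  let ?R = "\<lambda>((i', p, m), (i, q)). 0\<^sub>v (nA * mB) @\<^sub>v R i q i' p m"
  \<comment> \<open>Diagonal embeddings: the component \<open>i\<close> is repeated in both tensor
    factors.\<close>
  let ?pL = "\<lambda>(i, p, q, m). ((i, p), (i, q, m))" and ?pR = "\<lambda>(i, p, q, m). ((i, p, m), (i, q))"
  have L_zero: "?L s = 0\<^sub>v N"
    if s: "s \<in> set (index_pairs IA) \<times> set (index_triples IBs)" "s \<notin> ?pL ` J_left" for s
  proof -
    obtain i p i' q m where s_eq: "s = ((i, p), (i', q, m))" "i < t" "i' < t"
      "p \<in> IA i" "q \<in> IBs i'" "m \<in> set (exponents b e i')"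
      using s(1) by (auto simp: sets)
    then have "i \<noteq> i'" using s(2) by (force simp: J_left_def)
    then show ?thesis using s_eq by (simp add: L0 zero)
  qed
  have R_zero: "?R s = 0\<^sub>v N"
    if s: "s \<in> set (index_triples IAs) \<times> set (index_pairs IB)" "s \<notin> ?pR ` J_right" for s
  proof -
    obtain i p i' q m where s_eq: "s = ((i', p, m), (i, q))" "i < t" "i' < t"
      "p \<in> IAs i'" "q \<in> IB i" "m \<in> set (exponents b e i')"
      using s(1) by (auto simp: sets)
    then have "i \<noteq> i'" using s(2) by (force simp: J_right_def)
    then show ?thesis using s_eq by (simp add: R0 zero)
  qed
  have "filter_mset (\<lambda>r. r \<noteq> 0\<^sub>v N)
      (image_mset ?L (mset_set (set (index_pairs IA) \<times> set (index_triples IBs)))) =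
      image_mset (\<lambda>k. f (LeftSector, k)) (mset_set J_left)"
  proof (rule filter_image_mset_reindex)
    show "inj_on ?pL J_left" by (auto simp: inj_on_def)
    show "?pL ` J_left \<subseteq> set (index_pairs IA) \<times> set (index_triples IBs)"
      by (auto simp: sets J_left_def)
    show "?L (?pL k) = f (LeftSector, k)" "f (LeftSector, k) \<noteq> 0\<^sub>v N" if "k \<in> J_left" for k
      using J_left_mem[OF that] by (auto simp: L f split: prod.split)
  qed (simp_all add: L_zero)
  moreover have "filter_mset (\<lambda>r. r \<noteq> 0\<^sub>v N)
      (image_mset ?R (mset_set (set (index_triples IAs) \<times> set (index_pairs IB)))) =
      image_mset (\<lambda>k. f (RightSector, k)) (mset_set J_right)"
  proof (rule filter_image_mset_reindex)
    show "inj_on ?pR J_right" by (auto simp: inj_on_def)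
    show "?pR ` J_right \<subseteq> set (index_triples IAs) \<times> set (index_pairs IB)"
      by (auto simp: sets J_right_def)
    show "?R (?pR k) = f (RightSector, k)" "f (RightSector, k) \<noteq> 0\<^sub>v N" if "k \<in> J_right" for k
      using J_right_mem[OF that] by (auto simp: R f split: prod.split)
  qed (simp_all add: R_zero)
  ultimately show ?thesis
    by (simp add: image_mset_J multiset.map_comp comp_def case_prod_unfold)
qed

lemma rows_L_Z:
  "filter_mset (\<lambda>r. r \<noteq> 0\<^sub>v N) (mset (rows (L_Z t b c \<beta> e h A B IA IAs IB IBs))) =
    image_mset supZ (mset_set J)"
proof -
  have left: "mset (rows (kron_mat (G_mat t c \<beta> A IA) (E_mat t b c e h B IBs))) =
      image_mset (\<lambda>((i, p), (i', q, m)). kron_vec (zA i p) ((h i' m * c i') \<cdot>\<^sub>v unit_vec mB q))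
        (mset_set (set (index_pairs IA) \<times> set (index_triples IBs)))"
    unfolding generator_matrices dims
    by (subst mset_rows_kron_mat)
      (auto simp: distinct_index_lists set_index_pairs set_index_triples z_finite z_carrier
        intro!: image_mset_cong)
  have right: "mset (rows (kron_mat (E_mat t b c e h A IAs) (G_mat t c \<beta> B IB))) =
      image_mset (\<lambda>((i', p, m), (i, q)). kron_vec ((h i' m * c i') \<cdot>\<^sub>v unit_vec mA p) (zB i q))
        (mset_set (set (index_triples IAs) \<times> set (index_pairs IB)))"
    unfolding generator_matrices dims
    by (subst mset_rows_kron_mat)
      (auto simp: distinct_index_lists set_index_pairs set_index_triples z_finite z_carrier
        intro!: image_mset_cong)
  \<comment> \<open>Multiplication by \<open>c i\<close> leaves the kernel vector of component
    \<open>i\<close> unchanged but annihilates the scalar belonging to component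
    \<open>i'\<close>.\<close>
  have zero: "kron_vec (zA i p) ((h i' m * c i') \<cdot>\<^sub>v unit_vec mB q) = 0\<^sub>v (nA * mB)"
    "kron_vec ((h i' m * c i') \<cdot>\<^sub>v unit_vec mA p) (zB i q) = 0\<^sub>v (mA * nB)"
    if i: "i < t" "i' < t" "i \<noteq> i'" for i i' p q m
  proof -
    have "c i * (h i' m * c i') = (c i * c i') * h i' m" by (simp only: mult_ac)
    then have 0: "c i * (h i' m * c i') = 0" using i by (simp add: idempotent_orthogonal)
    have "(c i * (h i' m * c i')) \<cdot>\<^sub>v kron_vec (zA i p) (unit_vec mB q) =
        (h i' m * c i') \<cdot>\<^sub>v kron_vec (zA i p) (unit_vec mB q)"
      "(c i * (h i' m * c i')) \<cdot>\<^sub>v kron_vec (unit_vec mA p) (zB i q) =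
        (h i' m * c i') \<cdot>\<^sub>v kron_vec (unit_vec mA p) (zB i q)"
      using i by (auto intro!: smult_kron_absorb simp: z_idempotent z_dim)
    then show "kron_vec (zA i p) ((h i' m * c i') \<cdot>\<^sub>v unit_vec mB q) = 0\<^sub>v (nA * mB)"
      "kron_vec ((h i' m * c i') \<cdot>\<^sub>v unit_vec mA p) (zB i q) = 0\<^sub>v (mA * nB)"
      unfolding 0 kron_vec_smult_left kron_vec_smult_right
      using i by (auto simp: z_dim vec_eq_iff)
  qed
  have cols: "dim_col (kron_mat (E_mat t b c e h A IAs) (G_mat t c \<beta> B IB)) = mA * nB"
    "dim_col (kron_mat (G_mat t c \<beta> A IA) (E_mat t b c e h B IBs)) = nA * mB"
    by (simp_all add: generator_matrices)
  show ?thesis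
    unfolding L_Z_def rows_diag_block_mat_pair mset_append mset_map left right cols
    by (rule sector_rows)
      (simp_all add: zero supZ_nonzero, simp_all add: supZ_left supZ_right kron_vec_smult_left
        kron_vec_smult_right mult.commute[of "h _ _"])
qed

lemma rows_L_X:
  "filter_mset (\<lambda>r. r \<noteq> 0\<^sub>v N) (mset (rows (L_X t b c \<beta> e A B IA IAs IB IBs))) =
    image_mset supX (mset_set J)"
proof -
  have left: "mset (rows (kron_mat (E_star_mat t c A IA) (G_star_mat t b c \<beta> e B IBs))) =
      image_mset (\<lambda>((i, p), (i', q, m)). kron_vec (cyc_conj (c i) \<cdot>\<^sub>v unit_vec nA p)
          ((cyc_x ^ m * cyc_conj (c i')) \<cdot>\<^sub>v map_vec cyc_conj (xB i' q)))
        (mset_set (set (index_pairs IA) \<times> set (index_triples IBs)))"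
    unfolding generator_matrices dims xi_bar_eq
    by (subst mset_rows_kron_mat)
      (auto simp: distinct_index_lists set_index_pairs set_index_triples z_finite z_carrier
        intro!: image_mset_cong)
  have right: "mset (rows (kron_mat (G_star_mat t b c \<beta> e A IAs) (E_star_mat t c B IB))) =
      image_mset (\<lambda>((i', p, m), (i, q)). kron_vec
          ((cyc_x ^ m * cyc_conj (c i')) \<cdot>\<^sub>v map_vec cyc_conj (xA i' p)) (cyc_conj (c i) \<cdot>\<^sub>v unit_vec nB q))
        (mset_set (set (index_triples IAs) \<times> set (index_pairs IB)))"
    unfolding generator_matrices dims xi_bar_eq
    by (subst mset_rows_kron_mat)
      (auto simp: distinct_index_lists set_index_pairs set_index_triples z_finite z_carrier
        intro!: image_mset_cong)
  \<comment> \<open>In this family both factors carry an explicit idempotent, so a mismatch of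
    components is already visible in the scalars.\<close>
  have coeff: "cyc_conj (c i) * (cyc_x ^ m * cyc_conj (c i')) =
      (if i = i' then cyc_conj (c i) * cyc_x ^ m else 0)"
    if i: "i < t" "i' < t" for i i' m
  proof -
    have "cyc_conj (c i) * (cyc_x ^ m * cyc_conj (c i')) = cyc_conj (c i * c i') * cyc_x ^ m"
      by (simp only: cyc_conj_mult mult_ac)
    then show ?thesis using i by (auto simp: idempotent idempotent_orthogonal)
  qed
  have L: "kron_vec (cyc_conj (c i) \<cdot>\<^sub>v unit_vec nA p)
        ((cyc_x ^ m * cyc_conj (c i')) \<cdot>\<^sub>v map_vec cyc_conj (xB i' q)) =
      (if i = i' then cyc_conj (c i) * cyc_x ^ m else 0) \<cdot>\<^sub>v
        kron_vec (unit_vec nA p) (map_vec cyc_conj (xB i' q))"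
    and R: "kron_vec ((cyc_x ^ m * cyc_conj (c i')) \<cdot>\<^sub>v map_vec cyc_conj (xA i' p)) (cyc_conj (c i) \<cdot>\<^sub>v unit_vec nB q) =
      (if i = i' then cyc_conj (c i) * cyc_x ^ m else 0) \<cdot>\<^sub>v
        kron_vec (map_vec cyc_conj (xA i' p)) (unit_vec nB q)"
    if "i < t" "i' < t" for i i' p q m
    unfolding kron_vec_smult_left kron_vec_smult_right smult_smult_assoc
    by (simp_all only: coeff[OF that] mult.commute[of "cyc_x ^ m * cyc_conj (c i')"])
  have zero: "0 \<cdot>\<^sub>v kron_vec (unit_vec nA p) (map_vec cyc_conj (xB i q)) = 0\<^sub>v (nA * mB)"
    "0 \<cdot>\<^sub>v kron_vec (map_vec cyc_conj (xA i p)) (unit_vec nB q) = 0\<^sub>v (mA * nB)"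
    if "i < t" for i p q
    using that by (auto simp: z_dim vec_eq_iff)
  have lt: "i < t" if "(s, i, p, q, m) \<in> J" for s i p q m
    using that by (auto simp: logical_index_def)
  have cols: "dim_col (kron_mat (G_star_mat t b c \<beta> e A IAs) (E_star_mat t c B IB)) = mA * nB"
    "dim_col (kron_mat (E_star_mat t c A IA) (G_star_mat t b c \<beta> e B IBs)) = nA * mB"
    by (simp_all add: generator_matrices)
  show ?thesis
    unfolding L_X_def rows_diag_block_mat_pair mset_append mset_map left right cols
    by (rule sector_rows) (simp_all add: L R zero lt supX_nonzero, simp_all add: supX_left supX_right)
qed

lemma subset_rows:
  assumes "filter_mset (\<lambda>r. r \<noteq> z) (mset rs) = image_mset f (mset_set J)"
  shows "f ` J \<subseteq> set rs" "set rs \<subseteq> insert z (f ` J)"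
proof -
  have "set_mset (filter_mset (\<lambda>r. r \<noteq> z) (mset rs)) = f ` J"
    using finite_J by (simp add: assms)
  then show "f ` J \<subseteq> set rs" "set rs \<subseteq> insert z (f ` J)" by auto
qed

end

theorem theorem12:
  fixes A B :: "('l::finite) cyc mat"
    and mA nA mB nB t :: nat
    and b :: "nat \<Rightarrow> bit poly"
    and \<beta> :: "nat \<Rightarrow> bit alg_closure"
    and c :: "nat \<Rightarrow> 'l cyc"
    and e :: "nat \<Rightarrow> nat \<Rightarrow> nat"
    and h :: "nat \<Rightarrow> nat \<Rightarrow> 'l cyc"
    and IA IAs IB IBs :: "nat \<Rightarrow> nat set"
  assumes l_odd: "odd CARD('l)"
    and A: "A \<in> carrier_mat mA nA"
    and B: "B \<in> carrier_mat mB nB"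
    and factorization: "monom 1 CARD('l) + 1 = (\<Prod>i<t. b i)"
    and b_irreducible: "\<And>i. i < t \<Longrightarrow> irreducible (b i)"
    and b_distinct: "inj_on b {..<t}"
    and root: "\<And>i. i < t \<Longrightarrow> poly (map_poly to_ac (b i)) (\<beta> i) = 0"
    and idempotent: "\<And>i. i < t \<Longrightarrow> c i * c i = c i"
    and idempotent_1: "\<And>i. i < t \<Longrightarrow> [cyc_rep (c i) = 1] (mod b i)"
    and idempotent_0: "\<And>i j. i < t \<Longrightarrow> j < t \<Longrightarrow> j \<noteq> i \<Longrightarrow> [cyc_rep (c i) = 0] (mod b j)"
    and info_A: "\<And>i. i < t \<Longrightarrow>
      information_set (\<beta> i) nA (kernel_code (\<beta> i) (map_mat (cyc_eval (\<beta> i)) A)) (IA i)"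
    and info_A_star: "\<And>i. i < t \<Longrightarrow>
      information_set (\<beta> i) mA
        (kernel_code (\<beta> i) (transpose_mat (map_mat (cyc_eval (\<beta> i)) A))) (IAs i)"
    and info_B: "\<And>i. i < t \<Longrightarrow>
      information_set (\<beta> i) nB (kernel_code (\<beta> i) (map_mat (cyc_eval (\<beta> i)) B)) (IB i)"
    and info_B_star: "\<And>i. i < t \<Longrightarrow>
      information_set (\<beta> i) mB
        (kernel_code (\<beta> i) (transpose_mat (map_mat (cyc_eval (\<beta> i)) B))) (IBs i)"
    and exponent_range: "\<And>i k. i < t \<Longrightarrow> k < degree (b i) \<Longrightarrow> e i k < CARD('l)"
    and exponent_distinct: "\<And>i. i < t \<Longrightarrow> inj_on (e i) {..<degree (b i)}"
    and exponent_basis: "\<And>i. i < t \<Longrightarrow>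
      family_basis class_ring (gen_field_module (\<beta> i)) {..<degree (b i)}
        (\<lambda>k. inverse (\<beta> i) ^ e i k)"
    and dual: "\<And>i j k. i < t \<Longrightarrow> j < degree (b i) \<Longrightarrow> k < degree (b i) \<Longrightarrow>
      cyc_coeff (c i * h i (e i k)) (e i j) = (if j = k then 1 else 0)"
  shows "
    let D1 = lp_boundary1 A B; D2 = lp_boundary2 A B;
        D1s = conj_transpose D1; D2s = conj_transpose D2;
        LZ = L_Z t b c \<beta> e h A B IA IAs IB IBs; LX = L_X t b c \<beta> e A B IA IAs IB IBs;
        supZ = supp_Z c \<beta> h A B IA IB; supX = supp_X c \<beta> A B IAs IBs;
        J = logical_index t b e IA IAs IB IBs;
        nonzero = (\<lambda>r. r \<noteq> 0\<^sub>v (nA * mB + mA * nB))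
    in generates_homology D1 D2 (set (rows LZ)) \<and>
       generates_homology D2s D1s (set (rows LX)) \<and>
       filter_mset nonzero (mset (rows LZ)) = image_mset supZ (mset_set J) \<and>
       filter_mset nonzero (mset (rows LX)) = image_mset supX (mset_set J) \<and>
       family_basis class_ring (homology D1 D2) J (\<lambda>k. homology_class D1 D2 (supZ k)) \<and>
       family_basis class_ring (homology D2s D1s) J (\<lambda>k. homology_class D2s D1s (supX k)) \<and>
       (\<forall>k\<in>J. \<forall>k'\<in>J. pairing (supZ k) (supX k') = (if k = k' then 1 else 0))"
proof -
  interpret lifted_product t b \<beta> e c h A B mA nA mB nB IA IAs IB IBs
    by unfold_locales (fact | rule assms; assumption)+
  show ?thesis
    unfolding Let_def
    using generates_homologyI[OF subset_rows[OF rows_L_Z]] generates_cohomologyI[OF subset_rows[OF rows_L_X]]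
      rows_L_Z rows_L_X homology_results(1) cohomology_results(1) pairing_supZ_supX
    by blast
qed

end
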